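(* Let $t>0$, let $0\ne\zeta\in\widehat{H}^{-t}(E,k)$ be a Tate cohomology class, and denote by $$0\to k\to M\to\Omega^{-t-1}(k)\to0$$ the corresponding extension of $kE$-modules. Then $M$ has constant $r$-radical type and constant $r$-socle type for every $0<r<n$.
   Context: $k$ is an algebraically closed field of characteristic $p>0$, $E$ is an elementary abelian $p$-group of rank $n\ge1$, $\mathbb V\subset\operatorname{Rad}(kE)$ is a linear subspace such that $\mathbb V\hookrightarrow\operatorname{Rad}(kE)\to\operatorname{Rad}(kE)/\operatorname{Rad}^2(kE)$ is an isomorphism. $\Omega(N)$ is the kernel of a projective cover of $N$, $\Omega^{-1}(N)$ is the cokernel of an injective hull of $N$, and $\Omega^{\pm s}$ denotes the $s$-fold iterate. The extension corresponding to $\zeta$ is the one with class $\zeta$ under the identification $\operatorname{Ext}^1_{kE}(\Omega^{-t-1}(k),k)\cong\widehat{\operatorname{Ext}}{}^{-t}_{kE}(k,k)=\widehat H^{-t}(E,k)$. For an $r$-dimensional subspace ($r$-plane) $U\subset\mathbb V$, $\operatorname{Rad}^j_U(M)$ is the span of all $u_1\cdots u_j m$ with $u_i\in U$, $m\in M$, and $\operatorname{Soc}^j_U(M)=\{m\in M:u_1\cdots u_j m=0\ \forall u_i\in U\}$. A finite dimensional $kE$-module $M$ has constant $r$-radical type (respectively, constant $r$-socle type) if for every $j$ with $1\le j\le(p-1)r$ the dimension of $\operatorname{Rad}^j_U(M)$ (resp. $\operatorname{Soc}^j_U(M)$) is independent of the choice of the $r$-plane $U\subset\mathbb V$. *)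

theory Defs
  imports
    "HOL-Library.Poly_Mapping"
    "HOL-Computational_Algebra.Polynomial"
begin

section \<open>The group algebra\<close>

text \<open>
  The group \<open>E\<close> is written additively, as a type. Multiplication on \<open>'e \<Rightarrow>\<^sub>0 'k\<close> is convolution over
  addition in \<open>'e\<close>, so for a finite abelian group \<open>'e\<close> this type is the group algebra \<open>kE\<close>, and
  \<open>single 0\<close> is the inclusion of scalars.
\<close>

type_synonym ('e, 'k) group_algebra = "'e \<Rightarrow>\<^sub>0 'k"

definition elementary_abelian :: "'e::{ab_group_add, finite} itself \<Rightarrow> nat \<Rightarrow> nat \<Rightarrow> bool" where
  "elementary_abelian E p n \<longleftrightarrow> prime p \<and> (\<forall>g::'e. (\<Sum>i<p. g) = 0) \<and> card (UNIV :: 'e set) = p ^ n"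

text \<open>Restriction of scalars from \<open>kE\<close> to \<open>k\<close>.\<close>

definition kscale ::
  "(('e::{ab_group_add, finite}, 'k::field) group_algebra \<Rightarrow> 'v \<Rightarrow> 'v) \<Rightarrow> 'k \<Rightarrow> 'v \<Rightarrow> 'v" where
  "kscale s c = s (Poly_Mapping.single 0 c)"

definition maximal_ideal :: "'a::comm_ring_1 set \<Rightarrow> bool" where
  "maximal_ideal I \<longleftrightarrow> module.subspace (*) I \<and> I \<noteq> UNIV \<and>
     (\<forall>J. module.subspace (*) J \<and> I \<subseteq> J \<longrightarrow> J = I \<or> J = UNIV)"

text \<open>The radical of a commutative ring, and its square as an ideal.\<close>

definition ring_Rad :: "'a::comm_ring_1 set" where
  "ring_Rad = \<Inter> {I. maximal_ideal I}"

definition ring_Rad2 :: "'a::comm_ring_1 set" where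
  "ring_Rad2 = module.span (*) {x * y | x y. x \<in> ring_Rad \<and> y \<in> ring_Rad}"

definition Rad_congruence :: "('a::comm_ring_1 \<times> 'a) set" where
  "Rad_congruence = {(x, y). x \<in> ring_Rad \<and> y \<in> ring_Rad \<and> x - y \<in> ring_Rad2}"

definition Rad_complement ::
  "('e::{ab_group_add, finite}, 'k::field) group_algebra set \<Rightarrow> bool" where
  "Rad_complement V \<longleftrightarrow> V \<subseteq> ring_Rad \<and> module.subspace (kscale (*)) V \<and>
     bij_betw (\<lambda>v. Rad_congruence `` {v}) V (ring_Rad // Rad_congruence)"

definition plane ::
  "('e::{ab_group_add, finite}, 'k::field) group_algebra set \<Rightarrow> nat \<Rightarrow>
   ('e, 'k) group_algebra set \<Rightarrow> bool" where
  "plane V r U \<longleftrightarrow> U \<subseteq> V \<and> module.subspace (kscale (*)) U \<and> vector_space.dim (kscale (*)) U = r"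


section \<open>Modules over the group algebra\<close>

text \<open>
  A module is a submodule \<open>Carrier M\<close> of a \<open>kE\<close>-module structure \<open>act M\<close> on a whole type, so that
  families of modules of different sizes can live in one type. Conditions on maps only concern their
  values on carriers.
\<close>

record (overloaded) ('e, 'k, 'v) kE_module =
  Carrier :: "'v set"
  act :: "('e, 'k) group_algebra \<Rightarrow> 'v \<Rightarrow> 'v"

definition fd_module ::
  "('e::{ab_group_add, finite}, 'k::field, 'v::ab_group_add) kE_module \<Rightarrow> bool" where
  "fd_module M \<longleftrightarrow> module (act M) \<and> module.subspace (act M) (Carrier M) \<and>
     (\<exists>B. finite B \<and> Carrier M = module.span (kscale (act M)) B)"

text \<open>The module \<open>k\<close>, with trivial action of \<open>E\<close>.\<close>

definition trivial_module :: "('e::{ab_group_add, finite}, 'k::field, 'k) kE_module" where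
  "trivial_module = \<lparr>Carrier = UNIV, act = (\<lambda>a c. (\<Sum>g\<in>UNIV. Poly_Mapping.lookup a g) * c)\<rparr>"

definition kE_hom ::
  "('e::{ab_group_add, finite}, 'k::field, 'v::ab_group_add) kE_module \<Rightarrow>
   ('e, 'k, 'w::ab_group_add) kE_module \<Rightarrow> ('v \<Rightarrow> 'w) \<Rightarrow> bool" where
  "kE_hom M N f \<longleftrightarrow> f ` Carrier M \<subseteq> Carrier N \<and>
     (\<forall>x\<in>Carrier M. \<forall>y\<in>Carrier M. f (x + y) = f x + f y) \<and>
     (\<forall>a. \<forall>x\<in>Carrier M. f (act M a x) = act N a (f x))"

definition kE_iso ::
  "('e::{ab_group_add, finite}, 'k::field, 'v::ab_group_add) kE_module \<Rightarrow>
   ('e, 'k, 'w::ab_group_add) kE_module \<Rightarrow> ('v \<Rightarrow> 'w) \<Rightarrow> bool" where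
  "kE_iso M N f \<longleftrightarrow> kE_hom M N f \<and> bij_betw f (Carrier M) (Carrier N)"

definition short_exact ::
  "('e::{ab_group_add, finite}, 'k::field, 'u::ab_group_add) kE_module \<Rightarrow>
   ('e, 'k, 'v::ab_group_add) kE_module \<Rightarrow> ('e, 'k, 'w::ab_group_add) kE_module \<Rightarrow>
   ('u \<Rightarrow> 'v) \<Rightarrow> ('v \<Rightarrow> 'w) \<Rightarrow> bool" where
  "short_exact A M C i q \<longleftrightarrow> fd_module A \<and> fd_module M \<and> fd_module C \<and>
     kE_hom A M i \<and> inj_on i (Carrier A) \<and>
     kE_hom M C q \<and> q ` Carrier M = Carrier C \<and>
     {x \<in> Carrier M. q x = 0} = i ` Carrier A"

text \<open>
  Projectivity and injectivity are those of the category of finite dimensional modules. The test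
  modules have their elements in the vector space \<open>nat \<Rightarrow>\<^sub>0 'k\<close> of countable dimension, which contains
  a copy of every finite dimensional module.
\<close>

definition projective ::
  "('e::{ab_group_add, finite}, 'k::field, 'v::ab_group_add) kE_module \<Rightarrow> bool" where
  "projective P \<longleftrightarrow> fd_module P \<and>
     (\<forall>(B :: ('e, 'k, nat \<Rightarrow>\<^sub>0 'k) kE_module) (C :: ('e, 'k, nat \<Rightarrow>\<^sub>0 'k) kE_module) g f.
        fd_module B \<and> fd_module C \<and> kE_hom B C g \<and> g ` Carrier B = Carrier C \<and> kE_hom P C f \<longrightarrow>
        (\<exists>h. kE_hom P B h \<and> (\<forall>x\<in>Carrier P. g (h x) = f x)))"

definition injective ::
  "('e::{ab_group_add, finite}, 'k::field, 'v::ab_group_add) kE_module \<Rightarrow> bool" where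
  "injective I \<longleftrightarrow> fd_module I \<and>
     (\<forall>(A :: ('e, 'k, nat \<Rightarrow>\<^sub>0 'k) kE_module) (B :: ('e, 'k, nat \<Rightarrow>\<^sub>0 'k) kE_module) g f.
        fd_module A \<and> fd_module B \<and> kE_hom A B g \<and> inj_on g (Carrier A) \<and> kE_hom A I f \<longrightarrow>
        (\<exists>h. kE_hom B I h \<and> (\<forall>x\<in>Carrier A. h (g x) = f x)))"

text \<open>An injective hull is an essential embedding into an injective module.\<close>

definition injective_hull ::
  "('e::{ab_group_add, finite}, 'k::field, 'v::ab_group_add) kE_module \<Rightarrow>
   ('e, 'k, 'w::ab_group_add) kE_module \<Rightarrow> ('v \<Rightarrow> 'w) \<Rightarrow> bool" where
  "injective_hull N I f \<longleftrightarrow> fd_module N \<and> injective I \<and> kE_hom N I f \<and> inj_on f (Carrier N) \<and>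
     (\<forall>S. module.subspace (act I) S \<and> S \<subseteq> Carrier I \<and> S \<noteq> {0} \<longrightarrow> S \<inter> f ` Carrier N \<noteq> {0})"

text \<open>
  \<open>W j\<close> is \<open>\<Omega>\<^sup>-\<^sup>j(N)\<close> for \<open>j \<le> s\<close>: \<open>W 0\<close> is identified with \<open>N\<close> by \<open>\<theta>\<close>, and \<open>W (j + 1)\<close> is the
  cokernel of the injective hull \<open>\<iota> j : W j \<rightarrow> I j\<close>.
\<close>

definition iterated_Omega_inv ::
  "nat \<Rightarrow> ('e::{ab_group_add, finite}, 'k::field, 'u::ab_group_add) kE_module \<Rightarrow>
   (nat \<Rightarrow> ('e, 'k, 'w::ab_group_add) kE_module) \<Rightarrow>
   (nat \<Rightarrow> ('e, 'k, 'i::ab_group_add) kE_module) \<Rightarrow>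
   ('u \<Rightarrow> 'w) \<Rightarrow> (nat \<Rightarrow> 'w \<Rightarrow> 'i) \<Rightarrow> (nat \<Rightarrow> 'i \<Rightarrow> 'w) \<Rightarrow> bool" where
  "iterated_Omega_inv s N W I \<theta> \<iota> \<pi> \<longleftrightarrow> kE_iso N (W 0) \<theta> \<and>
     (\<forall>j<s. injective_hull (W j) (I j) (\<iota> j) \<and>
            short_exact (W j) (I j) (W (Suc j)) (\<iota> j) (\<pi> j))"


section \<open>Tate cohomology\<close>

text \<open>
  A complete resolution \<open>\<dots> \<rightarrow> P\<^sub>1 \<rightarrow> P\<^sub>0 \<rightarrow> P\<^sub>-\<^sub>1 \<rightarrow> \<dots>\<close> of \<open>N\<close>, with differential \<open>d i : P i \<rightarrow> P (i - 1)\<close>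
  and with \<open>d 0\<close> factoring as \<open>\<epsilon> : P 0 \<rightarrow> N\<close> followed by \<open>\<eta> : N \<rightarrow> P (-1)\<close>.
\<close>

definition complete_resolution ::
  "('e::{ab_group_add, finite}, 'k::field, 'u::ab_group_add) kE_module \<Rightarrow>
   (int \<Rightarrow> ('e, 'k, 'p::ab_group_add) kE_module) \<Rightarrow> (int \<Rightarrow> 'p \<Rightarrow> 'p) \<Rightarrow>
   ('p \<Rightarrow> 'u) \<Rightarrow> ('u \<Rightarrow> 'p) \<Rightarrow> bool" where
  "complete_resolution N P d \<epsilon> \<eta> \<longleftrightarrow>
     (\<forall>i. projective (P i) \<and> kE_hom (P i) (P (i - 1)) (d i) \<and>
          {x \<in> Carrier (P i). d i x = 0} = d (i + 1) ` Carrier (P (i + 1))) \<and>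
     kE_hom (P 0) N \<epsilon> \<and> \<epsilon> ` Carrier (P 0) = Carrier N \<and>
     kE_hom N (P (-1)) \<eta> \<and> inj_on \<eta> (Carrier N) \<and>
     (\<forall>x\<in>Carrier (P 0). d 0 x = \<eta> (\<epsilon> x))"

text \<open>Cocycles and coboundaries of degree \<open>s\<close> in the complex of homomorphisms from \<open>P\<close> to \<open>k\<close>.\<close>

definition tate_cocycles ::
  "(int \<Rightarrow> ('e::{ab_group_add, finite}, 'k::field, 'p::ab_group_add) kE_module) \<Rightarrow>
   (int \<Rightarrow> 'p \<Rightarrow> 'p) \<Rightarrow> int \<Rightarrow> ('p \<Rightarrow> 'k) set" where
  "tate_cocycles P d s =
     {z. kE_hom (P s) trivial_module z \<and> (\<forall>x\<in>Carrier (P (s + 1)). z (d (s + 1) x) = 0)}"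

definition tate_coboundaries ::
  "(int \<Rightarrow> ('e::{ab_group_add, finite}, 'k::field, 'p::ab_group_add) kE_module) \<Rightarrow>
   (int \<Rightarrow> 'p \<Rightarrow> 'p) \<Rightarrow> int \<Rightarrow> ('p \<Rightarrow> 'k) set" where
  "tate_coboundaries P d s =
     {z. kE_hom (P s) trivial_module z \<and>
         (\<exists>h. kE_hom (P (s - 1)) trivial_module h \<and> (\<forall>x\<in>Carrier (P s). z x = h (d s x)))}"

definition tate_cohomology ::
  "(int \<Rightarrow> ('e::{ab_group_add, finite}, 'k::field, 'p::ab_group_add) kE_module) \<Rightarrow>
   (int \<Rightarrow> 'p \<Rightarrow> 'p) \<Rightarrow> int \<Rightarrow> ('p \<Rightarrow> 'k) set set" where
  "tate_cohomology P d s = tate_cocycles P d s //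
     {(z, z'). z \<in> tate_cocycles P d s \<and> z' \<in> tate_cocycles P d s \<and>
               (\<lambda>x. z x - z' x) \<in> tate_coboundaries P d s}"

text \<open>
  The identification of \<open>Ext\<^sup>1(\<Omega>\<^sup>-\<^sup>t\<^sup>-\<^sup>1(k), k)\<close> with the Tate cohomology of degree \<open>-t\<close>, by
  dimension shifting along \<open>0 \<rightarrow> k \<rightarrow> I 0 \<rightarrow> \<dots> \<rightarrow> I t \<rightarrow> W (t + 1) \<rightarrow> 0\<close>, for an extension
  \<open>0 \<rightarrow> k \<rightarrow> M \<rightarrow> W (t + 1) \<rightarrow> 0\<close> with maps \<open>i\<close>, \<open>q\<close>. The comparison maps \<open>\<psi> j : P (-1-j) \<rightarrow> I j\<close> lie
  over the identity of \<open>k\<close>. The map \<open>P (-t-1) \<rightarrow> W (t + 1)\<close> that they induce lifts to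
  \<open>g : P (-t-1) \<rightarrow> M\<close>, and \<open>g \<circ> d (-t)\<close> takes values in \<open>i(k)\<close>, so it is \<open>i \<circ> z\<close> for a cocycle \<open>z\<close>.
  The class of \<open>z\<close> depends only on the extension. Other sign conventions replace it by its negative.
\<close>

definition extension_has_class ::
  "nat \<Rightarrow>
   (int \<Rightarrow> ('e::{ab_group_add, finite}, 'k::field, 'p::ab_group_add) kE_module) \<Rightarrow>
   (int \<Rightarrow> 'p \<Rightarrow> 'p) \<Rightarrow> ('k \<Rightarrow> 'p) \<Rightarrow>
   (nat \<Rightarrow> ('e, 'k, 'w::ab_group_add) kE_module) \<Rightarrow>
   (nat \<Rightarrow> ('e, 'k, 'i::ab_group_add) kE_module) \<Rightarrow>
   ('k \<Rightarrow> 'w) \<Rightarrow> (nat \<Rightarrow> 'w \<Rightarrow> 'i) \<Rightarrow> (nat \<Rightarrow> 'i \<Rightarrow> 'w) \<Rightarrow>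
   ('e, 'k, 'm::ab_group_add) kE_module \<Rightarrow> ('k \<Rightarrow> 'm) \<Rightarrow> ('m \<Rightarrow> 'w) \<Rightarrow> ('p \<Rightarrow> 'k) set \<Rightarrow> bool" where
  "extension_has_class t P d \<eta> W I \<theta> \<iota> \<pi> M i q \<zeta> \<longleftrightarrow>
     (\<exists>\<psi> g. \<exists>z\<in>\<zeta>.
        (\<forall>j\<le>t. kE_hom (P (- 1 - int j)) (I j) (\<psi> j)) \<and>
        (\<forall>c. \<psi> 0 (\<eta> c) = \<iota> 0 (\<theta> c)) \<and>
        (\<forall>j<t. \<forall>x\<in>Carrier (P (- 1 - int j)).
           \<psi> (Suc j) (d (- 1 - int j) x) = \<iota> (Suc j) (\<pi> j (\<psi> j x))) \<and>
        kE_hom (P (- int t - 1)) M g \<and>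
        (\<forall>x\<in>Carrier (P (- int t - 1)). q (g x) = \<pi> t (\<psi> t x)) \<and>
        (\<forall>x\<in>Carrier (P (- int t)). g (d (- int t) x) = i (z x)))"


section \<open>Radicals and socles along planes\<close>

definition Rad_along ::
  "('e::{ab_group_add, finite}, 'k::field, 'v::ab_group_add) kE_module \<Rightarrow>
   ('e, 'k) group_algebra set \<Rightarrow> nat \<Rightarrow> 'v set" where
  "Rad_along M U j = module.span (kscale (act M))
     {act M (prod_list us) m | us m. set us \<subseteq> U \<and> length us = j \<and> m \<in> Carrier M}"

definition Soc_along ::
  "('e::{ab_group_add, finite}, 'k::field, 'v::ab_group_add) kE_module \<Rightarrow>
   ('e, 'k) group_algebra set \<Rightarrow> nat \<Rightarrow> 'v set" where
  "Soc_along M U j =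
     {m \<in> Carrier M. \<forall>us. set us \<subseteq> U \<and> length us = j \<longrightarrow> act M (prod_list us) m = 0}"

definition constant_radical_type ::
  "('e::{ab_group_add, finite}, 'k::field) group_algebra set \<Rightarrow> nat \<Rightarrow>
   ('e, 'k, 'v::ab_group_add) kE_module \<Rightarrow> bool" where
  "constant_radical_type V r M \<longleftrightarrow> fd_module M \<and>
     (\<forall>j. 1 \<le> j \<and> j \<le> (CHAR('k) - 1) * r \<longrightarrow>
       (\<forall>U U'. plane V r U \<and> plane V r U' \<longrightarrow>
          vector_space.dim (kscale (act M)) (Rad_along M U j) =
          vector_space.dim (kscale (act M)) (Rad_along M U' j)))"

definition constant_socle_type ::
  "('e::{ab_group_add, finite}, 'k::field) group_algebra set \<Rightarrow> nat \<Rightarrow>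
   ('e, 'k, 'v::ab_group_add) kE_module \<Rightarrow> bool" where
  "constant_socle_type V r M \<longleftrightarrow> fd_module M \<and>
     (\<forall>j. 1 \<le> j \<and> j \<le> (CHAR('k) - 1) * r \<longrightarrow>
       (\<forall>U U'. plane V r U \<and> plane V r U' \<longrightarrow>
          vector_space.dim (kscale (act M)) (Soc_along M U j) =
          vector_space.dim (kscale (act M)) (Soc_along M U' j)))"

end

theory Submission
  imports Defs "HOL-Library.FuncSet"
begin

text \<open>
  The extension splits over the subalgebra generated by an \<open>r\<close>-plane \<open>U\<close> with \<open>r < n\<close>, because
  negative Tate cohomology restricts to zero there. So up to a trivial summand \<open>M\<close> has the radicals
  and socles of \<open>\<Omega>\<^sup>-\<^sup>t\<^sup>-\<^sup>1(k)\<close>, and these do not depend on \<open>U\<close>: an automorphism of \<open>kE\<close> induced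
  by a linear automorphism of \<open>\<V>\<close> takes \<open>U\<close> to any other \<open>r\<close>-plane, and it fixes the isomorphism
  class of \<open>\<Omega>\<^sup>-\<^sup>t\<^sup>-\<^sup>1(k)\<close>.

  For the vanishing, let \<open>N\<^sub>U\<close> be the product of the \<open>u\<^sup>p\<^sup>-\<^sup>1\<close> over a basis of \<open>U\<close>. A class of degree
  \<open>-t\<close> is a homomorphism \<open>\<Omega>\<^sup>-\<^sup>t(k) \<rightarrow> k\<close>, and it restricts to zero if it vanishes on the kernel
  of \<open>N\<^sub>U\<close>. For \<open>t > 0\<close> this kernel lies in the radical of \<open>\<Omega>\<^sup>-\<^sup>t(k)\<close>; by dimension shifting this
  follows from the surjectivity of restriction in degree \<open>t - 1\<close>, that is, from the fact that
  every element of \<open>\<Omega>\<^sup>-\<^sup>t\<^sup>+\<^sup>1(k)\<close> annihilated by \<open>U\<close> is the sum of one annihilated by \<open>\<V>\<close>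
  and a multiple of \<open>N\<^sub>U\<close>.
\<close>

section \<open>Semilinear maps\<close>

text \<open>The obstacle is that \<open>injective\<close> speaks only of kE-linear maps, while the
  argument has to extend maps that are linear over the subalgebra of U alone, or semilinear over an
  automorphism or a retraction of kE. Higman's criterion covers all these cases at once: on an
  injective module the identity is the trace of some k-linear h, so any k-linear extension, composed
  with h and averaged over the appropriate pairs of generators, becomes an extension of the required
  kind. Evaluating the same identity on the U-socle, or modulo U, compares socles and radicals with
  the norm.

  Splitting over U takes the form \<open>i 1 \<notin> ideal_act (set us) M\<close>. Since U
  annihilates the line through \<open>i 1\<close>, this line is a direct summand over the subalgebra
  exactly when it does not lie in U M.

  The bound r < n means that a basis of U leaves vectors of a basis of V over. The norm of V is then
  the norm of U times a factor in the radical.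

  The traces run over a basis of V, whose elements need not have the form g - 1. Hence kE must first
  be shown to have the monomials with exponents below p in such a basis as a k-basis; what is used
  of this is that the norm of V is nonzero.\<close>

definition kE_mod :: "('e::{ab_group_add, finite}, 'k::field, 'v::ab_group_add) kE_module \<Rightarrow> bool" where
  "kE_mod M \<longleftrightarrow> module (act M) \<and> module.subspace (act M) (Carrier M)"

text \<open>
  Linearity over the subalgebra of \<open>kE\<close> generated by \<open>X\<close> is the case \<open>Z = Id_on X\<close>. Twists by an
  automorphism of \<open>kE\<close>, and inflation along a retraction onto a subalgebra, are other choices of \<open>Z\<close>.
\<close>

definition khom ::
  "('e::{ab_group_add, finite}, 'k::field, 'v::ab_group_add) kE_module \<Rightarrow>
   ('e, 'k, 'w::ab_group_add) kE_module \<Rightarrow>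
   (('e, 'k) group_algebra \<times> ('e, 'k) group_algebra) set \<Rightarrow> ('v \<Rightarrow> 'w) \<Rightarrow> bool" where
  "khom M N Z f \<longleftrightarrow> f ` Carrier M \<subseteq> Carrier N \<and>
     (\<forall>x\<in>Carrier M. \<forall>y\<in>Carrier M. f (x + y) = f x + f y) \<and>
     (\<forall>c. \<forall>x\<in>Carrier M. f (act M (Poly_Mapping.single 0 c) x) = act N (Poly_Mapping.single 0 c) (f x)) \<and>
     (\<forall>(x, y)\<in>Z. \<forall>v\<in>Carrier M. f (act M x v) = act N y (f v))"

lemma fd_module_kE_mod: "fd_module M \<Longrightarrow> kE_mod M"
  by (auto simp: fd_module_def kE_mod_def)

lemma kE_mod_module: "kE_mod M \<Longrightarrow> module (act M)"
  by (auto simp: kE_mod_def)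

lemma
  assumes "kE_mod M"
  shows kE_mod_0: "0 \<in> Carrier M"
    and kE_mod_add: "x \<in> Carrier M \<Longrightarrow> y \<in> Carrier M \<Longrightarrow> x + y \<in> Carrier M"
    and kE_mod_diff: "x \<in> Carrier M \<Longrightarrow> y \<in> Carrier M \<Longrightarrow> x - y \<in> Carrier M"
    and kE_mod_minus: "x \<in> Carrier M \<Longrightarrow> - x \<in> Carrier M"
    and kE_mod_act: "x \<in> Carrier M \<Longrightarrow> act M a x \<in> Carrier M"
    and kE_mod_sum: "(\<And>j. j \<in> J \<Longrightarrow> g j \<in> Carrier M) \<Longrightarrow> sum g J \<in> Carrier M"
  using assms module.subspace_0 module.subspace_add module.subspace_diff module.subspace_neg
    module.subspace_scale module.subspace_sum unfolding kE_mod_def by metis+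

lemma
  assumes "kE_mod M"
  shows act_add_right: "act M a (x + y) = act M a x + act M a y"
    and act_add_left: "act M (a + b) x = act M a x + act M b x"
    and act_act: "act M a (act M b x) = act M (a * b) x"
    and act_one: "act M 1 x = x"
    and act_zero: "act M 0 x = 0"
    and act_zero_right: "act M a 0 = 0"
    and act_diff_right: "act M a (x - y) = act M a x - act M a y"
    and act_sum_right: "act M a (sum g J) = (\<Sum>j\<in>J. act M a (g j))"
    and act_commute: "act M a (act M b x) = act M b (act M a x)"
proof -
  interpret module "act M" using assms by (simp add: kE_mod_def)
  show "act M a (x + y) = act M a x + act M a y" "act M (a + b) x = act M a x + act M b x"
    "act M a (act M b x) = act M (a * b) x" "act M 1 x = x" "act M 0 x = 0" "act M a 0 = 0"
    "act M a (x - y) = act M a x - act M a y" "act M a (sum g J) = (\<Sum>j\<in>J. act M a (g j))"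
    "act M a (act M b x) = act M b (act M a x)"
    by (simp_all add: algebra_simps scale_sum_right)
qed

lemma kscale_vector_space: "module (s :: ('e::{ab_group_add, finite}, 'k::field) group_algebra \<Rightarrow> 'v::ab_group_add \<Rightarrow> 'v) \<Longrightarrow> vector_space (kscale s)"
proof -
  assume "module s"
  then interpret module s .
  show ?thesis
    by unfold_locales (simp_all add: kscale_def single_add mult_single algebra_simps)
qed

lemma kE_mod_vector_space: "kE_mod M \<Longrightarrow> vector_space (kscale (act M))"
  by (simp add: kE_mod_def kscale_vector_space)

lemma kE_mod_kspace: "kE_mod M \<Longrightarrow> module.subspace (kscale (act M)) (Carrier M)"
proof -
  assume M: "kE_mod M"
  interpret vector_space "kscale (act M)" using M by (rule kE_mod_vector_space)
  show ?thesis by (rule subspaceI) (use M in \<open>auto simp: kscale_def kE_mod_0 kE_mod_add kE_mod_act\<close>)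
qed

lemma
  assumes "khom M N Z f"
  shows khom_in: "x \<in> Carrier M \<Longrightarrow> f x \<in> Carrier N"
    and khom_add: "x \<in> Carrier M \<Longrightarrow> y \<in> Carrier M \<Longrightarrow> f (x + y) = f x + f y"
    and khom_scalar: "x \<in> Carrier M \<Longrightarrow> f (act M (Poly_Mapping.single 0 c) x) = act N (Poly_Mapping.single 0 c) (f x)"
    and khom_act: "(a, b) \<in> Z \<Longrightarrow> x \<in> Carrier M \<Longrightarrow> f (act M a x) = act N b (f x)"
  using assms unfolding khom_def by auto

lemma khomI:
  assumes "\<And>x. x \<in> Carrier M \<Longrightarrow> f x \<in> Carrier N"
    and "\<And>x y. x \<in> Carrier M \<Longrightarrow> y \<in> Carrier M \<Longrightarrow> f (x + y) = f x + f y"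
    and "\<And>c x. x \<in> Carrier M \<Longrightarrow> f (act M (Poly_Mapping.single 0 c) x) = act N (Poly_Mapping.single 0 c) (f x)"
    and "\<And>a b x. (a, b) \<in> Z \<Longrightarrow> x \<in> Carrier M \<Longrightarrow> f (act M a x) = act N b (f x)"
  shows "khom M N Z f"
  using assms unfolding khom_def by auto

lemma khom_subset: "khom M N Z f \<Longrightarrow> Z' \<subseteq> Z \<Longrightarrow> khom M N Z' f"
  unfolding khom_def by blast

lemma kE_hom_khom: "kE_hom M N f \<Longrightarrow> Z \<subseteq> Id \<Longrightarrow> khom M N Z f"
  unfolding khom_def kE_hom_def by auto

lemma khom_zero: "khom M N Z f \<Longrightarrow> kE_mod M \<Longrightarrow> f 0 = 0"
  using khom_add[of M N Z f 0 0] by (simp add: kE_mod_0)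

lemma khom_minus: "khom M N Z f \<Longrightarrow> kE_mod M \<Longrightarrow> x \<in> Carrier M \<Longrightarrow> f (- x) = - f x"
  using khom_add[of M N Z f x "- x"] khom_zero[of M N Z f] kE_mod_minus[of M x]
  by (simp add: eq_neg_iff_add_eq_0 add.commute)

lemma khom_diff:
  "khom M N Z f \<Longrightarrow> kE_mod M \<Longrightarrow> x \<in> Carrier M \<Longrightarrow> y \<in> Carrier M \<Longrightarrow> f (x - y) = f x - f y"
  using khom_add[of M N Z f x "- y"] khom_minus[of M N Z f y] kE_mod_minus[of M y] by simp

lemma khom_sum:
  assumes "khom M N Z f" "kE_mod M" "\<And>j. j \<in> J \<Longrightarrow> g j \<in> Carrier M"
  shows "f (sum g J) = (\<Sum>j\<in>J. f (g j))"
  using assms(3)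
proof (induction J rule: infinite_finite_induct)
  case (insert x F)
  then show ?case
    using khom_add[OF assms(1), of "g x" "sum g F"] kE_mod_sum[OF assms(2), of F g] by simp
qed (use khom_zero[OF assms(1,2)] in auto)

lemma khom_compose:
  assumes "khom M N Z f" "khom N L Z' g" "Z'' \<subseteq> Z O Z'"
  shows "khom M L Z'' (g \<circ> f)"
  by (rule khomI) (use assms in \<open>auto simp: khom_in khom_add khom_scalar khom_act dest!: subsetD\<close>)

lemma khom_power:
  assumes "khom M N Z f" "kE_mod M" "kE_mod N" "(a, b) \<in> Z" "x \<in> Carrier M"
  shows "f (act M (a ^ j) x) = act N (b ^ j) (f x)"
proof (induction j)
  case 0
  then show ?case using assms by (simp add: act_one)
next
  case (Suc j)
  then show ?case
    using assms khom_act[OF assms(1,4), of "act M (a ^ j) x"] by (simp add: act_act[symmetric] kE_mod_act)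
qed

lemma khom_minus_fun:
  assumes "khom M N Z f" "khom M N Z g" "kE_mod N"
  shows "khom M N Z (\<lambda>x. f x - g x)"
  by (rule khomI) (use assms in \<open>auto simp: khom_in khom_add khom_scalar khom_act kE_mod_diff act_diff_right\<close>)

text \<open>Descent to a quotient: choosing preimages by \<open>SOME\<close> is harmless because
  \<open>g\<close> kills the kernel of \<open>\<pi>\<close>. The relation \<open>Z'\<close> must
  contain the diagonal over the first components of \<open>Z\<close>, since an action on
  \<open>W\<close> is lifted to \<open>J\<close> through \<open>\<pi>\<close> before
  \<open>g\<close> twists it.\<close>

lemma khom_factor:
  assumes J: "kE_mod J" and g: "khom J X Z g" and pi: "khom J W Z' \<pi>" "\<pi> ` Carrier J = Carrier W"
    and Z': "\<And>x y. (x, y) \<in> Z \<Longrightarrow> (x, x) \<in> Z'"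
    and ker: "\<And>y. y \<in> Carrier J \<Longrightarrow> \<pi> y = 0 \<Longrightarrow> g y = 0"
  obtains \<phi> where "khom W X Z \<phi>" "\<And>y. y \<in> Carrier J \<Longrightarrow> \<phi> (\<pi> y) = g y"
proof -
  define \<phi> where "\<phi> w = g (SOME y. y \<in> Carrier J \<and> \<pi> y = w)" for w
  have eq: "\<phi> (\<pi> y) = g y" if y: "y \<in> Carrier J" for y
  proof -
    define y' where "y' = (SOME y'. y' \<in> Carrier J \<and> \<pi> y' = \<pi> y)"
    have y': "y' \<in> Carrier J" "\<pi> y' = \<pi> y"
      using someI_ex[of "\<lambda>y'. y' \<in> Carrier J \<and> \<pi> y' = \<pi> y"] y by (auto simp: y'_def)
    then have "\<pi> (y' - y) = 0" using khom_diff[OF pi(1) J] y by simp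
    then have "g (y' - y) = 0" using ker kE_mod_diff[OF J] y y' by blast
    then have "g y' = g y" using khom_diff[OF g J] y y' by simp
    then show ?thesis by (simp add: \<phi>_def y'_def)
  qed
  have "khom W X Z \<phi>"
  proof (rule khomI)
    fix w assume "w \<in> Carrier W"
    then obtain y where y: "y \<in> Carrier J" "w = \<pi> y" using pi by auto
    then show "\<phi> w \<in> Carrier X" using eq khom_in[OF g] by simp
    show "\<phi> (act W (Poly_Mapping.single 0 c) w) = act X (Poly_Mapping.single 0 c) (\<phi> w)" for c
      using eq[of "act J (Poly_Mapping.single 0 c) y"] kE_mod_act[OF J y(1)] y eq[OF y(1)]
      by (simp add: khom_scalar[OF pi(1)] khom_scalar[OF g])
    show "\<phi> (act W a w) = act X b (\<phi> w)" if "(a, b) \<in> Z" for a b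
      using eq[of "act J a y"] kE_mod_act[OF J y(1)] y eq[OF y(1)] that
      by (simp add: khom_act[OF pi(1) Z'] khom_act[OF g that])
    fix w' assume "w' \<in> Carrier W"
    then obtain y' where y': "y' \<in> Carrier J" "w' = \<pi> y'" using pi by auto
    show "\<phi> (w + w') = \<phi> w + \<phi> w'"
      using eq[of "y + y'"] kE_mod_add[OF J y(1) y'(1)] y y' eq[OF y(1)] eq[OF y'(1)]
      by (simp add: khom_add[OF pi(1)] khom_add[OF g])
  qed
  then show ?thesis using that eq by blast
qed


section \<open>Linear algebra on carriers\<close>

text \<open>\<open>Vector_Spaces.linear\<close> concerns whole types, \<open>khom\<close> only
  carriers; this lemma passes from one to the other. The extension is zero on the vectors added to a
  basis of \<open>S\<close>, so its values stay in the span of the values of \<open>f\<close>, hence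
  in \<open>Carrier X\<close>.\<close>

lemma khom_extend:
  assumes J: "kE_mod J" and X: "kE_mod X" and S: "module.subspace (kscale (act J)) S"
    and f: "\<And>s. s \<in> S \<Longrightarrow> f s \<in> Carrier X"
      "\<And>s s'. s \<in> S \<Longrightarrow> s' \<in> S \<Longrightarrow> f (s + s') = f s + f s'"
      "\<And>c s. s \<in> S \<Longrightarrow> f (kscale (act J) c s) = kscale (act X) c (f s)"
  obtains g where "Vector_Spaces.linear (kscale (act J)) (kscale (act X)) g"
    "khom J X {} g" "\<And>s. s \<in> S \<Longrightarrow> g s = f s"
proof -
  interpret vector_space_pair "kscale (act J)" "kscale (act X)"
    using J X by (simp add: vector_space_pair_def kE_mod_vector_space)
  obtain B where B: "B \<subseteq> S" "vs1.independent B" "S \<subseteq> vs1.span B"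
    by (rule vs1.basis_exists[of S])
  define g where "g = construct B f"
  have lin: "Vector_Spaces.linear (kscale (act J)) (kscale (act X)) g"
    unfolding g_def using B(2) by (rule linear_construct)
  interpret g: Vector_Spaces.linear "kscale (act J)" "kscale (act X)" g by (rule lin)
  have eq: "g s = f s" if "s \<in> vs1.span B" for s
  proof -
    have f0: "f 0 = 0" using f(2)[of 0 0] vs1.subspace_0[OF S] by simp
    have "s \<in> S \<and> g s = f s" using that
    proof (induction rule: vs1.span_induct_alt)
      case base
      then show ?case using f0 vs1.subspace_0[OF S] by (simp add: g.zero)
    next
      case (step c x y)
      then have x: "x \<in> S" using B by auto
      have "g x = f x" unfolding g_def using construct_basis[OF B(2) step(1)] .
      then show ?case using step x f(2)[of "kscale (act J) c x" y] f(3)[of x c] S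
        by (auto simp: g.add g.scale vs1.subspace_add vs1.subspace_scale)
    qed
    then show ?thesis by simp
  qed
  have "f ` B \<subseteq> Carrier X" using f(1) B(1) by auto
  then have "vs2.span (f ` B) \<subseteq> Carrier X"
    using kE_mod_kspace[OF X] by (rule vs2.span_minimal)
  moreover have "g v \<in> vs2.span (f ` B)" for v
    unfolding g_def by (rule construct_in_span[OF B(2)])
  ultimately have "khom J X {} g"
    by (intro khomI) (use g.add g.scale in \<open>auto simp: kscale_def\<close>)
  then show ?thesis using that lin eq B(3) by blast
qed

lemma khom_linear_extend:
  assumes J: "kE_mod J" and X: "kE_mod X" and f: "khom J X Z f"
  obtains g where "Vector_Spaces.linear (kscale (act J)) (kscale (act X)) g"
    "\<And>s. s \<in> Carrier J \<Longrightarrow> g s = f s"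
proof (rule khom_extend[OF J X kE_mod_kspace[OF J], of f])
  fix g
  assume "Vector_Spaces.linear (kscale (act J)) (kscale (act X)) g" "\<And>s. s \<in> Carrier J \<Longrightarrow> g s = f s"
  then show thesis by (rule that)
qed (use f in \<open>simp_all add: khom_in khom_add khom_scalar kscale_def\<close>)

lemma dim_image_khom:
  assumes J: "kE_mod J" and X: "kE_mod X" and f: "khom J X Z f"
    and S: "S \<subseteq> Carrier J" "module.subspace (kscale (act J)) S" "inj_on f S"
  shows "vector_space.dim (kscale (act X)) (f ` S) = vector_space.dim (kscale (act J)) S"
proof -
  interpret vector_space_pair "kscale (act J)" "kscale (act X)"
    using J X by (simp add: vector_space_pair_def kE_mod_vector_space)
  obtain g where g: "Vector_Spaces.linear (kscale (act J)) (kscale (act X)) g"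
    "\<And>s. s \<in> Carrier J \<Longrightarrow> g s = f s"
    using khom_linear_extend[OF J X f] by blast
  interpret g: Vector_Spaces.linear "kscale (act J)" "kscale (act X)" g by (rule g)
  obtain B where B: "B \<subseteq> S" "vs1.independent B" "S \<subseteq> vs1.span B" "card B = vs1.dim S"
    by (rule vs1.basis_exists[of S])
  have sp: "vs1.span B = S" using B(1,3) S(2) by (simp add: vs1.span_subspace)
  have eq: "g ` S = f ` S" using g(2) S(1) by (intro image_cong) auto
  have inj: "inj_on g S" using S g(2) unfolding inj_on_def by (metis subsetD)
  have "vs2.independent (g ` B)"
    using g.independent_injective_image[OF B(2)] inj sp by simp
  moreover have "vs2.span (g ` B) = g ` S" using g.span_image sp by metis
  moreover have "card (g ` B) = card B" using inj B(1) by (meson card_image inj_on_subset)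
  ultimately show ?thesis using eq B(4) by (metis vs2.dim_span_eq_card_independent)
qed

text \<open>In an infinite dimensional ambient space \<open>dim\<close> is 0 for a set without a
  finite basis, and monotonicity can fail. The finite spanning set of the carrier excludes
  this.\<close>

lemma fd_dim_mono:
  assumes X: "fd_module X" and S: "S \<subseteq> T" "T \<subseteq> Carrier X"
  shows "vector_space.dim (kscale (act X)) S \<le> vector_space.dim (kscale (act X)) T"
proof -
  interpret vector_space "kscale (act X)"
    using X by (simp add: fd_module_kE_mod kE_mod_vector_space)
  obtain B where B: "finite B" "Carrier X = span B" using X unfolding fd_module_def by auto
  obtain C where C: "C \<subseteq> T" "independent C" "T \<subseteq> span C" "card C = dim T"
    by (rule basis_exists[of T])
  have "finite C" using independent_span_bound[OF B(1) C(2)] C S B by auto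
  then show ?thesis using dim_le_card[of S C] C S by auto
qed

lemma fd_inj_imp_surj:
  assumes X: "fd_module X" and f: "khom X X Z f" "inj_on f (Carrier X)"
  shows "f ` Carrier X = Carrier X"
proof -
  note X' = fd_module_kE_mod[OF X]
  interpret vector_space "kscale (act X)" using X' by (rule kE_mod_vector_space)
  obtain g where g: "Vector_Spaces.linear (kscale (act X)) (kscale (act X)) g"
    "\<And>s. s \<in> Carrier X \<Longrightarrow> g s = f s"
    using khom_linear_extend[OF X' X' f(1)] by blast
  interpret g: Vector_Spaces.linear "kscale (act X)" "kscale (act X)" g by (rule g)
  obtain T where T: "finite T" "Carrier X = span T" using X unfolding fd_module_def by auto
  obtain B where B: "B \<subseteq> Carrier X" "independent B" "Carrier X \<subseteq> span B"
    by (rule basis_exists[of "Carrier X"])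
  have sp: "span B = Carrier X" using B(1,3) kE_mod_kspace[OF X'] by (simp add: span_subspace)
  have finB: "finite B" using independent_span_bound[OF T(1) B(2)] B T by auto
  have inj: "inj_on g (Carrier X)" using f(2) g(2) by (simp add: inj_on_def)
  have ind: "independent (g ` B)"
    using g.independent_injective_image[OF B(2)] inj sp by simp
  have cardB: "card (g ` B) = card B" using inj B(1) by (meson card_image inj_on_subset)
  have gX: "g ` Carrier X \<subseteq> Carrier X" using g(2) f(1) khom_in by (auto simp: khom_in)
  have "Carrier X \<subseteq> span (g ` B)"
  proof
    fix c assume c: "c \<in> Carrier X"
    show "c \<in> span (g ` B)"
    proof (rule ccontr)
      assume nin: "c \<notin> span (g ` B)"
      then have "independent (insert c (g ` B))" using ind by (rule independent_insertI)
      moreover have "insert c (g ` B) \<subseteq> span B" using c gX B(1) sp by auto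
      ultimately have "card (insert c (g ` B)) \<le> card B"
        using independent_span_bound[OF finB] by blast
      moreover have "c \<notin> g ` B" using nin span_base by blast
      ultimately show False using finB cardB by simp
    qed
  qed
  also have "span (g ` B) = g ` Carrier X" using g.span_image sp by metis
  also have "\<dots> = f ` Carrier X" using g(2) by (auto simp: image_def)
  finally show ?thesis using f(1) khom_in by blast
qed

text \<open>Rank-nullity with a one-dimensional kernel: a basis of the preimage is chosen through
  \<open>e\<close>, and \<open>q\<close> maps the span of the other basis vectors bijectively onto
  \<open>S\<close>.\<close>

lemma dim_vimage_khom:
  assumes M: "kE_mod M" and W: "fd_module W" and q: "khom M W Z q" "q ` Carrier M = Carrier W"
    and ker: "{x \<in> Carrier M. q x = 0} = module.span (kscale (act M)) {e}" and e: "e \<noteq> 0"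
    and S: "S \<subseteq> Carrier W" "module.subspace (kscale (act W)) S"
  shows "vector_space.dim (kscale (act M)) {x \<in> Carrier M. q x \<in> S}
    = Suc (vector_space.dim (kscale (act W)) S)"
proof -
  note W' = fd_module_kE_mod[OF W]
  interpret vs1: vector_space "kscale (act M)" using M by (rule kE_mod_vector_space)
  interpret vs2: vector_space "kscale (act W)" using W' by (rule kE_mod_vector_space)
  let ?T = "{x \<in> Carrier M. q x \<in> S}"
  have sub: "vs1.subspace ?T"
    by (rule vs1.subspaceI)
      (use q M S in \<open>auto simp: kE_mod_0 kE_mod_add kE_mod_act khom_zero[OF q(1)] khom_add[OF q(1)]
        vs2.subspace_0 vs2.subspace_add khom_scalar[OF q(1)] kscale_def
        dest: vs2.subspace_scale\<close>)
  have eK: "e \<in> Carrier M" "q e = 0" using ker vs1.span_base[of e "{e}"] by auto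
  have eT: "e \<in> ?T" using eK vs2.subspace_0[OF S(2)] by simp
  obtain C where C: "{e} \<subseteq> C" "C \<subseteq> ?T" "vs1.independent C" "?T \<subseteq> vs1.span C"
    using vs1.maximal_independent_subset_extend[of "{e}" ?T] eT e by auto
  define C' where "C' = C - {e}"
  have CC: "C = insert e C'" "e \<notin> C'" using C(1) by (auto simp: C'_def)
  have indC': "vs1.independent C'" using C(3) CC vs1.independent_mono by blast
  have enC: "e \<notin> vs1.span C'" using C(1,3) unfolding vs1.dependent_def C'_def by blast
  have subC': "vs1.span C' \<subseteq> ?T" using C(2) CC sub by (simp add: vs1.span_minimal)
  have qz: "x = 0" if x: "x \<in> vs1.span C'" "q x = 0" for x
  proof -
    have "x \<in> vs1.span {e}" using x subC' ker by auto
    then obtain c where c: "x = kscale (act M) c e" by (auto simp: vs1.span_singleton)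
    show ?thesis
    proof (cases "c = 0")
      case False
      then have "e = kscale (act M) (inverse c) x" using c by simp
      then show ?thesis using enC x(1) vs1.span_scale by metis
    qed (use c in simp)
  qed
  have inj: "inj_on q (vs1.span C')"
  proof (rule inj_onI)
    fix x y assume a: "x \<in> vs1.span C'" "y \<in> vs1.span C'" "q x = q y"
    then have "q (x - y) = 0" using khom_diff[OF q(1) M, of x y] subC' by auto
    then show "x = y" using qz[of "x - y"] a vs1.span_diff by auto
  qed
  have im: "q ` vs1.span C' = S"
  proof
    show "q ` vs1.span C' \<subseteq> S" using subC' by auto
    show "S \<subseteq> q ` vs1.span C'"
    proof
      fix s assume s: "s \<in> S"
      then obtain x where x: "x \<in> Carrier M" "q x = s" using q(2) S(1) by (metis imageE subsetD)
      then have "x \<in> vs1.span (insert e C')" using s C(4) CC(1) by auto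
      then obtain c where c: "x - kscale (act M) c e \<in> vs1.span C'" by (auto simp: vs1.span_insert)
      have "q (x - kscale (act M) c e) = s"
        using x eK khom_diff[OF q(1) M] khom_scalar[OF q(1)] kE_mod_act[OF M]
        by (simp add: kscale_def act_zero_right[OF W'])
      then show "s \<in> q ` vs1.span C'" using c by auto
    qed
  qed
  have d: "vs2.dim S = card C'"
    using dim_image_khom[OF M W' q(1) _ _ inj] subC' im vs1.dim_span_eq_card_independent[OF indC']
    by auto
  \<comment> \<open>Needed for the successor in the conclusion, since \<open>card\<close> is 0 on
    infinite sets. Finiteness comes from \<open>W\<close>, because \<open>q\<close> is injective on
    the span of \<open>C'\<close>.\<close>
  have "finite C'"
  proof -
    obtain B where B: "finite B" "Carrier W = vs2.span B" using W unfolding fd_module_def by auto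
    obtain g where g: "Vector_Spaces.linear (kscale (act M)) (kscale (act W)) g"
      "\<And>s. s \<in> Carrier M \<Longrightarrow> g s = q s"
      using khom_linear_extend[OF M W' q(1)] by blast
    interpret g: Vector_Spaces.linear "kscale (act M)" "kscale (act W)" g by (rule g)
    have injg: "inj_on g (vs1.span C')" using inj g(2) subC' unfolding inj_on_def
      by (metis (no_types, lifting) mem_Collect_eq subsetD)
    then have "vs2.independent (g ` C')" using g.independent_injective_image[OF indC'] by simp
    moreover have "g ` C' \<subseteq> vs2.span B" using g(2) subC' vs1.span_base khom_in[OF q(1)] B(2) by fastforce
    ultimately have "finite (g ` C')" using vs2.independent_span_bound[OF B(1)] by blast
    then show ?thesis using injg by (meson finite_imageD inj_on_subset vs1.span_superset)
  qed
  then show ?thesis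
    using d CC vs1.dim_eq_card[of C ?T] C(2,3,4) sub
    by (metis (no_types, lifting) card_insert_disjoint vs1.basis_card_eq_dim)
qed


section \<open>Averaging\<close>

text \<open>
  Iterated over a basis of \<open>\<V>\<close>, this replaces the trace over the group \<open>E\<close>: unlike that trace it
  factors through the traces for the planes \<open>U \<subseteq> \<V>\<close>.
\<close>

definition tr1 ::
  "('e::{ab_group_add, finite}, 'k::field, 'v::ab_group_add) kE_module \<Rightarrow>
   ('e, 'k, 'w::ab_group_add) kE_module \<Rightarrow>
   ('e, 'k) group_algebra \<times> ('e, 'k) group_algebra \<Rightarrow> ('v \<Rightarrow> 'w) \<Rightarrow> 'v \<Rightarrow> 'w" where
  "tr1 M N z h v =
    (\<Sum>j<CHAR('k). act N (snd z ^ (CHAR('k) - 1 - j)) (h (act M (fst z ^ j) v)))"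

definition tr ::
  "('e::{ab_group_add, finite}, 'k::field, 'v::ab_group_add) kE_module \<Rightarrow>
   ('e, 'k, 'w::ab_group_add) kE_module \<Rightarrow>
   (('e, 'k) group_algebra \<times> ('e, 'k) group_algebra) list \<Rightarrow> ('v \<Rightarrow> 'w) \<Rightarrow> 'v \<Rightarrow> 'w" where
  "tr M N zs h = foldr (tr1 M N) zs h"

lemma tr_Nil [simp]: "tr M N [] h = h"
  and tr_Cons [simp]: "tr M N (z # zs) h = tr1 M N z (tr M N zs h)"
  and tr_append: "tr M N (zs @ zs') h = tr M N zs (tr M N zs' h)"
  by (simp_all add: tr_def)

text \<open>Because kE is commutative, averaging over one pair of generators preserves the
  semilinearity already gained for the others. This allows the traces to be iterated.\<close>

lemma tr1_khom:
  assumes "kE_mod M" "kE_mod N" "khom M N Z h"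
  shows "khom M N Z (tr1 M N z h)"
proof (rule khomI)
  fix x assume x: "x \<in> Carrier M"
  show "tr1 M N z h x \<in> Carrier N"
    unfolding tr1_def
    using x by (auto intro!: kE_mod_sum[OF assms(2)] kE_mod_act[OF assms(1)] kE_mod_act[OF assms(2)] khom_in[OF assms(3)])
  show "tr1 M N z h (act M (Poly_Mapping.single 0 c) x) = act N (Poly_Mapping.single 0 c) (tr1 M N z h x)" for c
    unfolding tr1_def using assms x
    by (auto simp: act_sum_right act_commute[of M _ "Poly_Mapping.single 0 c"] khom_scalar kE_mod_act
        act_commute[of N _ "Poly_Mapping.single 0 c"] intro!: sum.cong)
  show "tr1 M N z h (act M a x) = act N b (tr1 M N z h x)" if "(a, b) \<in> Z" for a b
    unfolding tr1_def using assms x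
    by (auto simp: act_sum_right act_commute[of M _ a] khom_act[OF _ that] kE_mod_act
        act_commute[of N _ b] intro!: sum.cong)
  fix y assume y: "y \<in> Carrier M"
  show "tr1 M N z h (x + y) = tr1 M N z h x + tr1 M N z h y"
    unfolding tr1_def using assms x y
    by (auto simp: act_add_right khom_add kE_mod_act sum.distrib)
qed

text \<open>For T the trace of h, the sum \<open>b T - T a\<close> telescopes to
  \<open>b ^ p h - h a ^ p\<close>, and both p-th powers vanish.\<close>

lemma tr1_intertwines:
  assumes M: "kE_mod M" and N: "kE_mod N" and h: "khom M N Z h" and p: "CHAR('k) > 0"
    and z: "a ^ CHAR('k) = 0" "b ^ CHAR('k) = 0" and v: "v \<in> Carrier M"
  shows "tr1 (M :: ('e::{ab_group_add, finite}, 'k::field, 'v::ab_group_add) kE_module) N (a, b) h (act M a v) = act N b (tr1 M N (a, b) h v)"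
proof -
  obtain m where m: "CHAR('k) = Suc m" using p gr0_implies_Suc by blast
  let ?f = "\<lambda>j. act N (b ^ (Suc m - j)) (h (act M (a ^ j) v))"
  have "tr1 M N (a, b) h (act M a v) = (\<Sum>j<Suc m. ?f (Suc j))"
    unfolding tr1_def m by (rule sum.cong) (auto simp: act_act[OF M] mult.commute)
  also have "\<dots> = (\<Sum>j<m. ?f (Suc j)) + ?f (Suc m)" by simp
  also have "?f (Suc m) = 0"
    using z(1) khom_zero[OF h M] by (simp add: m act_zero[OF M] act_one[OF N])
  also have "(\<Sum>j<m. ?f (Suc j)) = (\<Sum>j<Suc m. ?f j) - ?f 0"
    by (subst sum.lessThan_Suc_shift) simp
  also have "?f 0 = 0" using z(2) by (simp add: m act_zero[OF N])
  also have "(\<Sum>j<Suc m. ?f j) = act N b (tr1 M N (a, b) h v)"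
    unfolding tr1_def m act_sum_right[OF N]
    by (intro sum.cong refl) (auto simp: act_act[OF N] Suc_diff_le simp flip: power_Suc)
  finally show ?thesis by simp
qed

lemma tr_khom:
  fixes M :: "('e::{ab_group_add, finite}, 'k::field, 'v::ab_group_add) kE_module"
  assumes "kE_mod M" "kE_mod N" "khom M N Z h" "CHAR('k) > 0"
    and "\<And>a b. (a, b) \<in> set zs \<Longrightarrow> a ^ CHAR('k) = 0 \<and> b ^ CHAR('k) = 0"
  shows "khom M N (Z \<union> set zs) (tr M N zs h)"
  using assms(5)
proof (induction zs)
  case Nil
  then show ?case using assms by simp
next
  case (Cons z zs)
  have IH: "khom M N (Z \<union> set zs) (tr M N zs h)" by (rule Cons.IH, rule Cons.prems, simp)
  obtain a b where z: "z = (a, b)" by force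
  have "khom M N (Z \<union> set zs) (tr1 M N z (tr M N zs h))"
    by (rule tr1_khom[OF assms(1,2) IH])
  moreover have "\<forall>v\<in>Carrier M. tr1 M N z (tr M N zs h) (act M a v) = act N b (tr1 M N z (tr M N zs h) v)"
    using tr1_intertwines[OF assms(1,2) IH assms(4)] Cons.prems[of a b] z by auto
  ultimately show ?case unfolding khom_def using z by auto
qed

lemma tr_cong:
  assumes "kE_mod M" "\<And>v. v \<in> Carrier M \<Longrightarrow> h v = h' v" "v \<in> Carrier M"
  shows "tr M N zs h v = tr M N zs h' v"
  using assms(3)
proof (induction zs arbitrary: v)
  case (Cons z zs)
  then show ?case using assms(1) by (auto simp: tr1_def kE_mod_act intro!: sum.cong)
qed (use assms in auto)

text \<open>Naturality of the trace in its source; \<open>tr_comp_left\<close> is naturality in the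
  target. The lists of generators on the two sides of \<open>g\<close> may differ, which is how
  twisted maps are averaged.\<close>

lemma tr_comp_right:
  assumes L: "kE_mod L" and M: "kE_mod M" and g: "khom L M (set (zip ws xs)) g"
    and len: "length ws = length xs" "length xs = length ys" and v: "v \<in> Carrier L"
  shows "tr M N (zip xs ys) h (g v) = tr L N (zip ws ys) (h \<circ> g) v"
  using len g v
proof (induction ws xs ys arbitrary: v rule: list_induct3)
  case (Cons w ws x xs y ys)
  have g': "khom L M (set (zip ws xs)) g" using Cons.prems(1) by (rule khom_subset) auto
  have "act M (x ^ j) (g v) = g (act L (w ^ j) v)" for j
    using khom_power[OF Cons.prems(1) L M _ Cons.prems(2), of w x j] by simp
  then show ?case
    using Cons.IH[OF g' kE_mod_act[OF L Cons.prems(2)]] by (simp add: tr1_def)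
qed simp

lemma tr_comp_left:
  assumes M: "kE_mod M" and N: "kE_mod N" and L: "kE_mod L" and g: "khom N L (set (zip ys zs)) g"
    and h: "khom M N {} h"
    and len: "length xs = length ys" "length ys = length zs" and v: "v \<in> Carrier M"
  shows "g (tr M N (zip xs ys) h v) = tr M L (zip xs zs) (g \<circ> h) v"
  using len g v
proof (induction xs ys zs arbitrary: v rule: list_induct3)
  case (Cons x xs y ys z zs)
  have g': "khom N L (set (zip ys zs)) g" using Cons.prems(1) by (rule khom_subset) auto
  have kh: "khom M N {} (tr M N us h)" for us
    by (induction us) (use M N h tr1_khom in auto)
  have "g (act N (y ^ j) u) = act L (z ^ j) (g u)" if "u \<in> Carrier N" for j u
    using khom_power[OF Cons.prems(1) N L] that by auto
  then show ?case
    using Cons.IH[OF g'] Cons.prems(2) kE_mod_act[OF M] kE_mod_act[OF N] khom_in[OF kh]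
    by (simp add: tr1_def khom_sum[OF Cons.prems(1) N])
qed simp

text \<open>On a vector annihilated by the left generators only the term \<open>j = 0\<close> of
  each sum survives, and the trace becomes multiplication by the norm of the right
  generators.\<close>

lemma tr_socle:
  fixes M :: "('e::{ab_group_add, finite}, 'k::field, 'v::ab_group_add) kE_module"
  assumes M: "kE_mod M" and N: "kE_mod N" and h: "khom M N {} h" and p: "CHAR('k) > 0"
    and v: "v \<in> Carrier M" "\<And>a b. (a, b) \<in> set zs \<Longrightarrow> act M a v = 0"
  shows "tr M N zs h v = act N (\<Prod>z\<leftarrow>zs. snd z ^ (CHAR('k) - 1)) (h v)"
  using v(2)
proof (induction zs)
  case Nil
  then show ?case by (simp add: act_one[OF N])
next
  case (Cons z zs)
  obtain m where m: "CHAR('k) = Suc m" using p gr0_implies_Suc by blast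
  have kh: "khom M N {} (tr M N us h)" for us
    by (induction us) (use M N h tr1_khom in auto)
  have "act M (fst z ^ Suc j) v = 0" for j
    using Cons.prems[of "fst z" "snd z"] 
    by (simp only: power_Suc2 act_act[OF M, symmetric]) (simp add: act_zero_right[OF M])
  then have "tr M N (z # zs) h v = act N (snd z ^ m) (tr M N zs h v)"
    unfolding tr_Cons tr1_def m sum.lessThan_Suc_shift
    using khom_zero[OF kh M] by (simp add: act_zero_right[OF N] act_one[OF M])
  moreover have "tr M N zs h v = act N (\<Prod>z\<leftarrow>zs. snd z ^ (CHAR('k) - 1)) (h v)"
    by (rule Cons.IH, rule Cons.prems, rule list.set_intros(2))
  ultimately show ?case by (simp add: m act_act[OF N])
qed

text \<open>For a basis \<open>X\<close> of U this is the radical of \<open>M\<close> along U. Since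
  kE is commutative, the span over kE is no larger than the span over k, and it makes closure under
  the action immediate.\<close>

definition ideal_act ::
  "('e::{ab_group_add, finite}, 'k::field) group_algebra set \<Rightarrow>
   ('e, 'k, 'v::ab_group_add) kE_module \<Rightarrow> 'v set" where
  "ideal_act X M = module.span (act M) {act M x v | x v. x \<in> X \<and> v \<in> Carrier M}"

lemma
  assumes M: "kE_mod M"
  shows ideal_act_0: "0 \<in> ideal_act X M"
    and ideal_act_add: "v \<in> ideal_act X M \<Longrightarrow> w \<in> ideal_act X M \<Longrightarrow> v + w \<in> ideal_act X M"
    and ideal_act_diff: "v \<in> ideal_act X M \<Longrightarrow> w \<in> ideal_act X M \<Longrightarrow> v - w \<in> ideal_act X M"
    and ideal_act_scale: "v \<in> ideal_act X M \<Longrightarrow> act M a v \<in> ideal_act X M"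
    and ideal_act_sum: "(\<And>j. j \<in> J \<Longrightarrow> g j \<in> ideal_act X M) \<Longrightarrow> sum g J \<in> ideal_act X M"
    and ideal_act_base: "x \<in> X \<Longrightarrow> u \<in> Carrier M \<Longrightarrow> act M x u \<in> ideal_act X M"
    and ideal_act_carrier: "ideal_act X M \<subseteq> Carrier M"
    and ideal_act_mono: "X \<subseteq> Y \<Longrightarrow> ideal_act X M \<subseteq> ideal_act Y M"
proof -
  interpret module "act M" using M by (rule kE_mod_module)
  show "0 \<in> ideal_act X M" unfolding ideal_act_def by (rule span_zero)
  show "v \<in> ideal_act X M \<Longrightarrow> w \<in> ideal_act X M \<Longrightarrow> v + w \<in> ideal_act X M"
    unfolding ideal_act_def by (rule span_add)
  show "v \<in> ideal_act X M \<Longrightarrow> w \<in> ideal_act X M \<Longrightarrow> v - w \<in> ideal_act X M"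
    unfolding ideal_act_def by (rule span_diff)
  show "v \<in> ideal_act X M \<Longrightarrow> act M a v \<in> ideal_act X M"
    unfolding ideal_act_def by (rule span_scale)
  show "(\<And>j. j \<in> J \<Longrightarrow> g j \<in> ideal_act X M) \<Longrightarrow> sum g J \<in> ideal_act X M"
    unfolding ideal_act_def by (rule span_sum)
  show "x \<in> X \<Longrightarrow> u \<in> Carrier M \<Longrightarrow> act M x u \<in> ideal_act X M"
    unfolding ideal_act_def by (rule span_base) auto
  show "ideal_act X M \<subseteq> Carrier M"
    unfolding ideal_act_def
    by (rule span_minimal) (use M in \<open>auto simp: kE_mod_act kE_mod_def\<close>)
  show "X \<subseteq> Y \<Longrightarrow> ideal_act X M \<subseteq> ideal_act Y M"
    unfolding ideal_act_def by (rule span_mono) auto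
qed

text \<open>Dual to \<open>tr_socle\<close>: every term except \<open>j = p - 1\<close> carries a
  factor from the right generators, so modulo their ideal the trace is \<open>h\<close> applied
  after the norm of the left generators.\<close>

lemma tr_mod_ideal:
  fixes M :: "('e::{ab_group_add, finite}, 'k::field, 'v::ab_group_add) kE_module"
  assumes M: "kE_mod M" and N: "kE_mod N" and h: "khom M N {} h" and p: "CHAR('k) > 0"
    and v: "v \<in> Carrier M"
  shows "tr M N zs h v - h (act M (\<Prod>z\<leftarrow>zs. fst z ^ (CHAR('k) - 1)) v) \<in> ideal_act (snd ` set zs) N"
  using v
proof (induction zs arbitrary: v)
  case Nil
  then show ?case by (simp add: act_one[OF M] ideal_act_0[OF N])
next
  case (Cons z zs)
  obtain m where m: "CHAR('k) = Suc m" using p gr0_implies_Suc by blast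
  have kh: "khom M N {} (tr M N us h)" for us
    by (induction us) (use M N h tr1_khom in auto)
  let ?I = "ideal_act (snd ` set (z # zs)) N"
  have fv: "act M (fst z ^ j) v \<in> Carrier M" for j using Cons.prems M by (simp add: kE_mod_act)
  let ?S = "\<Sum>j<m. act N (snd z ^ (m - j)) (tr M N zs h (act M (fst z ^ j) v))"
  have e: "tr M N (z # zs) h v = ?S + tr M N zs h (act M (fst z ^ m) v)"
    by (simp add: tr1_def m act_one[OF N])
  have "?S \<in> ?I"
  proof (rule ideal_act_sum[OF N])
    fix j assume "j \<in> {..<m}"
    then have "snd z ^ (m - j) = snd z ^ (m - j - 1) * snd z" by (simp flip: power_Suc2 add: Suc_diff_Suc)
    then have eq: "act N (snd z ^ (m - j)) u = act N (snd z ^ (m - j - 1)) (act N (snd z) u)" for u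
      by (simp add: act_act[OF N])
    show "act N (snd z ^ (m - j)) (tr M N zs h (act M (fst z ^ j) v)) \<in> ?I"
      unfolding eq
      by (rule ideal_act_scale[OF N], rule ideal_act_base[OF N]) (use khom_in[OF kh fv] in auto)
  qed
  moreover have "tr M N zs h (act M (fst z ^ m) v) - h (act M (\<Prod>z\<leftarrow>z # zs. fst z ^ m) v) \<in> ?I"
    using Cons.IH[OF fv, of m] ideal_act_mono[OF N, of "snd ` set zs" "snd ` set (z # zs)"]
    by (auto simp: m act_act[OF M] mult.commute)
  ultimately have "?S + (tr M N zs h (act M (fst z ^ m) v) - h (act M (\<Prod>z\<leftarrow>z # zs. fst z ^ m) v)) \<in> ?I"
    by (rule ideal_act_add[OF N])
  then show ?case unfolding e m by (simp add: add_diff_eq)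
qed


section \<open>The group algebra of an elementary abelian group\<close>

interpretation ring_module: module "(*) :: 'a::comm_ring_1 \<Rightarrow> 'a \<Rightarrow> 'a"
  by unfold_locales (simp_all add: algebra_simps)

declare ring_module.scale_scale [simp del]

interpretation group_algebra: vector_space
  "kscale ((*) :: ('e::{ab_group_add, finite}, 'k::field) group_algebra \<Rightarrow> _ \<Rightarrow> _)"
  by (rule kscale_vector_space) (rule ring_module.module_axioms)

section \<open>The augmentation and the characteristic of kE\<close>

lemma group_algebra_expand:
  fixes a :: "('e::{ab_group_add, finite}, 'k::field) group_algebra"
  shows "a = (\<Sum>g\<in>UNIV. Poly_Mapping.single g (Poly_Mapping.lookup a g))"
  by (rule poly_mapping_eqI) (simp add: lookup_sum lookup_single when_def)

definition aug :: "('e::{ab_group_add, finite}, 'k::field) group_algebra \<Rightarrow> 'k" where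
  "aug a = (\<Sum>g\<in>UNIV. Poly_Mapping.lookup a g)"

lemma aug_0 [simp]: "aug 0 = 0"
  and aug_add: "aug (a + b) = aug a + aug b"
  and aug_diff: "aug (a - b) = aug a - aug b"
  and aug_single [simp]: "aug (Poly_Mapping.single g c) = c"
  by (simp_all add: aug_def lookup_add lookup_minus sum.distrib sum_subtractf lookup_single when_def)

lemma aug_1 [simp]: "aug 1 = 1"
  using aug_single[of 0 1] by simp

lemma aug_sum: "aug (sum f J) = (\<Sum>j\<in>J. aug (f j))"
  by (induction J rule: infinite_finite_induct) (auto simp: aug_add)

lemma aug_mult: "aug (a * b) = aug a * aug b"
proof -
  have "a * b = (\<Sum>g\<in>UNIV. \<Sum>h\<in>UNIV. Poly_Mapping.single (g + h) (Poly_Mapping.lookup a g * Poly_Mapping.lookup b h))"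
    by (subst group_algebra_expand[of a], subst group_algebra_expand[of b])
      (simp add: sum_product mult_single)
  then have "aug (a * b) = (\<Sum>g\<in>UNIV. \<Sum>h\<in>UNIV. Poly_Mapping.lookup a g * Poly_Mapping.lookup b h)"
    by (simp add: aug_sum)
  then show ?thesis by (simp add: aug_def sum_product)
qed

text \<open>The coefficients add up to 0, so subtracting 1 from every group element changes
  nothing.\<close>

lemma aug_expand:
  fixes a :: "('e::{ab_group_add, finite}, 'k::field) group_algebra"
  assumes "aug a = 0"
  shows "a = (\<Sum>g\<in>UNIV. Poly_Mapping.single 0 (Poly_Mapping.lookup a g) * (Poly_Mapping.single g 1 - 1))"
proof -
  have "(\<Sum>g\<in>UNIV. Poly_Mapping.single 0 (Poly_Mapping.lookup a g)) = (Poly_Mapping.single 0 (aug a) :: ('e, 'k) group_algebra)"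
    by (rule poly_mapping_eqI) (simp add: lookup_sum lookup_single when_def aug_def)
  then have "(\<Sum>g\<in>UNIV. Poly_Mapping.single 0 (Poly_Mapping.lookup a g) * (Poly_Mapping.single g 1 - 1)) = a"
    using assms group_algebra_expand[of a]
    by (simp add: right_diff_distrib mult_single sum_subtractf)
  then show ?thesis by simp
qed

lemma CHAR_group_algebra:
  "CHAR(('e::{ab_group_add, finite}, 'k::field) group_algebra) = CHAR('k)"
proof (rule CHAR_eqI)
  have iff: "of_nat m = (0 :: ('e, 'k) group_algebra) \<longleftrightarrow> of_nat m = (0 :: 'k)" for m
  proof -
    have aug: "aug (of_nat m :: ('e, 'k) group_algebra) = of_nat m"
      using aug_single[of "0 :: 'e" "of_nat m :: 'k"] by simp
    show ?thesis
    proof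
      assume "of_nat m = (0 :: ('e, 'k) group_algebra)"
      then show "of_nat m = (0 :: 'k)" using aug by simp
    next
      assume "of_nat m = (0 :: 'k)"
      then have "Poly_Mapping.single (0 :: 'e) (of_nat m :: 'k) = 0" by (simp only: single_zero)
      then show "of_nat m = (0 :: ('e, 'k) group_algebra)" by simp
    qed
  qed
  show "of_nat CHAR('k) = (0 :: ('e, 'k) group_algebra)" by (simp add: iff)
  show "of_nat m = (0 :: ('e, 'k) group_algebra) \<Longrightarrow> CHAR('k) dvd m" for m
    by (simp add: iff of_nat_eq_0_iff_char_dvd)
qed

text \<open>A list rather than a set: two bases are paired by \<open>zip\<close> to prescribe a
  twist, and a basis of a plane is an initial segment of a basis of V.\<close>

definition kbasis :: "('e::{ab_group_add, finite}, 'k::field) group_algebra set \<Rightarrow>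
    ('e, 'k) group_algebra list \<Rightarrow> bool" where
  "kbasis V xs \<longleftrightarrow> distinct xs \<and> \<not> module.dependent (kscale (*)) (set xs) \<and>
     module.span (kscale (*)) (set xs) = V"

lemma mult_span_group_algebra:
  fixes S T :: "('e::{ab_group_add, finite}, 'k::field) group_algebra set"
  assumes a: "a \<in> group_algebra.span S" and b: "b \<in> group_algebra.span T"
    and X: "group_algebra.subspace X" "\<And>s t. s \<in> S \<Longrightarrow> t \<in> T \<Longrightarrow> s * t \<in> X"
  shows "a * b \<in> X"
  using a
proof (induction rule: group_algebra.span_induct_alt)
  case base
  then show ?case using X by (simp add: group_algebra.subspace_0)
next
  case (step c x y)
  have "x * b \<in> X" using b
  proof (induction rule: group_algebra.span_induct_alt)
    case base
    then show ?case using X by (simp add: group_algebra.subspace_0)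
  next
    case (step d t u)
    have "x * (kscale (*) d t + u) = kscale (*) d (x * t) + x * u"
      by (simp add: kscale_def algebra_simps)
    then show ?case using step X \<open>x \<in> S\<close>
      by (simp add: group_algebra.subspace_add group_algebra.subspace_scale)
  qed
  moreover have "(kscale (*) c x + y) * b = kscale (*) c (x * b) + y * b"
    by (simp add: kscale_def algebra_simps)
  ultimately show ?case using step X
    by (simp add: group_algebra.subspace_add group_algebra.subspace_scale)
qed

lemma dim_group_algebra_le:
  fixes T :: "('e::{ab_group_add, finite}, 'k::field) group_algebra set"
  assumes "finite T" "group_algebra.span T = UNIV"
  shows "card (UNIV :: 'e set) \<le> card T"
proof -
  let ?s = "\<lambda>g. Poly_Mapping.single g 1 :: ('e, 'k) group_algebra"
  have inj: "inj ?s"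
    by (rule injI) (metis lookup_single_eq lookup_single_not_eq zero_neq_one)
  have "group_algebra.independent (range ?s)"
  proof (rule group_algebra.independent_if_scalars_zero)
    fix f x assume f: "(\<Sum>x\<in>range ?s. kscale (*) (f x) x) = 0" and x: "x \<in> range ?s"
    obtain h where h: "x = ?s h" using x by auto
    have "(\<Sum>x\<in>range ?s. kscale (*) (f x) x) = (\<Sum>g\<in>UNIV. Poly_Mapping.single g (f (?s g)))"
      using inj by (simp add: sum.reindex kscale_def mult_single)
    then have "Poly_Mapping.lookup (\<Sum>g\<in>UNIV. Poly_Mapping.single g (f (?s g))) h = 0" using f by simp
    then show "f x = 0" by (simp add: lookup_sum lookup_single when_def h)
  qed simp
  then have "card (range ?s) \<le> card T"
    using group_algebra.independent_span_bound[OF assms(1)] assms(2) by auto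
  then show ?thesis using inj by (simp add: card_image)
qed

lemma power_count_list_dvd_prod_list:
  "(a :: 'a::comm_semiring_1) ^ count_list l a dvd prod_list l"
  by (induction l) (auto intro: mult_dvd_mono)

lemma of_nat_inj_below_CHAR:
  assumes "of_nat a = (of_nat b :: 'a::semiring_1_cancel)" "a < CHAR('a)" "b < CHAR('a)"
  shows "a = b"
proof -
  have "\<not> x < y" if "of_nat x = (of_nat y :: 'a)" "y < CHAR('a)" for x y
    using that of_nat_eq_iff_char_dvd[where 'a = 'a, of x y] by (auto dest!: dvd_imp_le)
  then show ?thesis using assms by (metis linorder_neqE_nat)
qed

section \<open>Locality of kE\<close>

locale rad_complement =
  fixes V :: "('e::{ab_group_add, finite}, 'k::field) group_algebra set" and n :: nat
  assumes elementary: "elementary_abelian TYPE('e) CHAR('k) n" and complement: "Rad_complement V"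
begin

lemma prime_p: "prime CHAR('k)" and p_pos: "CHAR('k) > 0" and card_E: "card (UNIV :: 'e set) = CHAR('k) ^ n"
  using elementary by (auto simp: elementary_abelian_def prime_gt_0_nat)

text \<open>Frobenius is additive in characteristic p, and every group element has p-th power 1.
  Hence elements of augmentation 0 are nilpotent and all others are units.\<close>

lemma power_p:
  fixes a :: "('e, 'k) group_algebra"
  shows "a ^ CHAR('k) = Poly_Mapping.single 0 (aug a ^ CHAR('k))"
proof -
  have pw: "Poly_Mapping.single g c ^ j = (Poly_Mapping.single (\<Sum>i<j. g) (c ^ j) :: ('e, 'k) group_algebra)"
    for g c j
    by (induction j) (simp_all add: mult_single add.commute)
  have "a ^ CHAR('k) = (\<Sum>g\<in>UNIV. Poly_Mapping.single g (Poly_Mapping.lookup a g) ^ CHAR('k))"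
    by (subst group_algebra_expand[of a], rule freshmans_dream_sum)
      (simp_all add: CHAR_group_algebra prime_p)
  also have "\<dots> = (\<Sum>g\<in>UNIV. Poly_Mapping.single 0 (Poly_Mapping.lookup a g ^ CHAR('k)))"
    using elementary by (intro sum.cong) (auto simp: pw elementary_abelian_def)
  also have "\<dots> = Poly_Mapping.single 0 (\<Sum>g\<in>UNIV. Poly_Mapping.lookup a g ^ CHAR('k))"
    by (rule poly_mapping_eqI) (simp add: lookup_sum lookup_single when_def)
  also have "(\<Sum>g\<in>UNIV. Poly_Mapping.lookup a g ^ CHAR('k)) = aug a ^ CHAR('k)"
    unfolding aug_def by (rule freshmans_dream_sum[symmetric]) (simp_all add: prime_p)
  finally show ?thesis .
qed

lemma unit_if_aug:
  fixes a :: "('e, 'k) group_algebra"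
  assumes "aug a \<noteq> 0"
  obtains b where "a * b = 1"
proof -
  have "a * (a ^ (CHAR('k) - 1) * Poly_Mapping.single 0 (inverse (aug a ^ CHAR('k))))
    = a ^ CHAR('k) * Poly_Mapping.single 0 (inverse (aug a ^ CHAR('k)))"
    using p_pos by (simp add: mult.assoc[symmetric] flip: power_Suc)
  also have "\<dots> = 1" using assms by (simp add: power_p mult_single)
  finally show ?thesis by (rule that)
qed

text \<open>A proper ideal contains no unit, so by \<open>unit_if_aug\<close> it lies in the
  augmentation ideal, which is therefore the only maximal ideal.\<close>

lemma ring_Rad_eq: "ring_Rad = {a :: ('e, 'k) group_algebra. aug a = 0}"
proof -
  let ?K = "{a :: ('e, 'k) group_algebra. aug a = 0}"
  have K: "ring_module.subspace ?K" by (rule ring_module.subspaceI) (simp_all add: aug_add aug_mult)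
  have proper: "J \<subseteq> ?K" if J: "ring_module.subspace J" "J \<noteq> UNIV" for J
  proof
    fix a assume a: "a \<in> J"
    show "a \<in> ?K"
    proof (rule ccontr)
      assume "a \<notin> ?K"
      then obtain b where "a * b = 1" using unit_if_aug[of a] by auto
      then have "c = (c * b) * a" for c by (metis mult.assoc mult.commute mult.right_neutral)
      then have "c \<in> J" for c using ring_module.subspace_scale[OF J(1) a, of "c * b"] by metis
      then show False using J(2) by auto
    qed
  qed
  have "1 \<notin> ?K" by simp
  then have K': "?K \<noteq> UNIV" by blast
  have "maximal_ideal I \<longleftrightarrow> I = ?K" for I
    unfolding maximal_ideal_def using K K' proper by (metis subset_antisym)
  then have "{I. maximal_ideal I} = {?K}" by blast
  then show ?thesis unfolding ring_Rad_def by simp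
qed

lemma V_aug: "v \<in> V \<Longrightarrow> aug v = 0"
  using complement ring_Rad_eq by (auto simp: Rad_complement_def)

lemma V_power_p: "v \<in> V \<Longrightarrow> v ^ CHAR('k) = 0"
  using p_pos by (simp add: power_p V_aug power_0_left)

lemma V_subspace: "group_algebra.subspace V"
  using complement by (simp add: Rad_complement_def)

section \<open>Powers of the radical, and generation of kE by V\<close>

abbreviation G :: "('e, 'k) group_algebra set" where
  "G \<equiv> range (\<lambda>g. Poly_Mapping.single g 1 - 1)"

text \<open>The m-th power of the radical. It is written with the finitely many generators g - 1, so
  that nilpotency becomes a count of repeated factors.\<close>

definition Rad_power :: "nat \<Rightarrow> ('e, 'k) group_algebra set" where
  "Rad_power m = ring_module.span {prod_list l | l. set l \<subseteq> G \<and> length l = m}"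

lemma Rad_power_0: "Rad_power 0 = UNIV"
proof -
  have "a * 1 \<in> Rad_power 0" for a
    unfolding Rad_power_def by (rule ring_module.span_scale, rule ring_module.span_base) auto
  then show ?thesis by auto
qed

lemma Rad_power_add: "a \<in> Rad_power m \<Longrightarrow> b \<in> Rad_power m \<Longrightarrow> a + b \<in> Rad_power m"
  unfolding Rad_power_def by (rule ring_module.span_add)

lemma Rad_power_scale: "a \<in> Rad_power m \<Longrightarrow> c * a \<in> Rad_power m"
  unfolding Rad_power_def by (rule ring_module.span_scale)

lemma Rad_power_zero: "0 \<in> Rad_power m"
  unfolding Rad_power_def by (rule ring_module.span_zero)

lemma Rad_power_1: "ring_Rad \<subseteq> Rad_power 1"
proof
  fix a :: "('e, 'k) group_algebra" assume "a \<in> ring_Rad"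
  then have a: "a = (\<Sum>g\<in>UNIV. Poly_Mapping.single 0 (Poly_Mapping.lookup a g) * (Poly_Mapping.single g 1 - 1))"
    using aug_expand ring_Rad_eq by blast
  have "Poly_Mapping.single g 1 - 1 \<in> Rad_power 1" for g
    unfolding Rad_power_def
    by (rule ring_module.span_base) (auto intro!: exI[of _ "[Poly_Mapping.single g 1 - 1]"])
  then show "a \<in> Rad_power 1"
    unfolding Rad_power_def
    by (subst a, intro ring_module.span_sum ring_module.span_scale)
qed

lemma Rad_power_mult: "a \<in> Rad_power i \<Longrightarrow> b \<in> Rad_power j \<Longrightarrow> a * b \<in> Rad_power (i + j)"
  unfolding Rad_power_def[of i]
proof (induction rule: ring_module.span_induct_alt)
  case base
  then show ?case by (simp add: Rad_power_zero)
next
  case (step c x y)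
  then obtain l where l: "x = prod_list l" "set l \<subseteq> G" "length l = i" by auto
  have "x * b \<in> Rad_power (i + j)" using step.prems unfolding Rad_power_def[of j]
  proof (induction rule: ring_module.span_induct_alt)
    case base
    then show ?case by (simp add: Rad_power_zero)
  next
    case (step d z u)
    then obtain l' where l': "z = prod_list l'" "set l' \<subseteq> G" "length l' = j" by auto
    have "x * z = prod_list (l @ l')" by (simp add: l l')
    moreover have "prod_list (l @ l') \<in> Rad_power (i + j)"
      unfolding Rad_power_def using l l' by (intro ring_module.span_base CollectI exI[of _ "l @ l'"]) auto
    ultimately have "x * z \<in> Rad_power (i + j)" by simp
    then have "d * (x * z) + x * u \<in> Rad_power (i + j)"
      using step by (auto intro: Rad_power_add Rad_power_scale)
    then show ?case by (simp add: algebra_simps)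
  qed
  then have "c * (x * b) + y * b \<in> Rad_power (i + j)"
    using step by (auto intro: Rad_power_add Rad_power_scale)
  then show ?case by (simp add: algebra_simps)
qed

lemma Rad2_Rad_power: "ring_Rad2 \<subseteq> Rad_power 2"
  unfolding ring_Rad2_def
proof (rule ring_module.span_minimal)
  show "{x * y |x y. x \<in> ring_Rad \<and> y \<in> ring_Rad} \<subseteq> Rad_power 2"
    using Rad_power_mult[of _ 1 _ 1] Rad_power_1 by (auto simp: numeral_2_eq_2)
qed (simp add: Rad_power_def)

text \<open>Pigeonhole: among p^n p factors taken from at most p^n generators, some generator occurs
  at least p times, and its p-th power is 0. The exponent is chosen for this count, not for
  sharpness.\<close>

lemma Rad_power_nilpotent: "Rad_power (CHAR('k) ^ n * CHAR('k)) = {0}"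
proof -
  have "prod_list l = 0" if l: "set l \<subseteq> G" "length l = CHAR('k) ^ n * CHAR('k)" for l
  proof -
    have "\<exists>a\<in>G. count_list l a \<ge> CHAR('k)"
    proof (rule ccontr)
      assume "\<not> ?thesis"
      then have lt: "count_list l a < CHAR('k)" if "a \<in> G" for a using that by (auto simp: not_le)
      have "length l = (\<Sum>a\<in>G. count_list l a)" using sum_count_set[OF l(1)] by simp
      also have "\<dots> < (\<Sum>a\<in>G. CHAR('k))"
        using lt by (intro sum_strict_mono) auto
      also have "\<dots> \<le> CHAR('k) ^ n * CHAR('k)"
        using card_image_le[of UNIV "\<lambda>g. Poly_Mapping.single g 1 - 1 :: ('e, 'k) group_algebra"] card_E
        by simp
      finally show False using l by simp
    qed
    then obtain a where a: "a \<in> G" "count_list l a \<ge> CHAR('k)" by auto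
    have "a ^ CHAR('k) = 0" using a(1) p_pos by (auto simp: power_p aug_diff power_0_left)
    then have "a ^ count_list l a = 0" using a(2) by (metis le_iff_add power_add mult_zero_left)
    then show ?thesis using power_count_list_dvd_prod_list[of a l] by simp
  qed
  then have "{prod_list l | l. set l \<subseteq> G \<and> length l = CHAR('k) ^ n * CHAR('k)} \<subseteq> {0}" by auto
  then have "Rad_power (CHAR('k) ^ n * CHAR('k)) \<subseteq> {0}"
    unfolding Rad_power_def by (rule ring_module.span_minimal) simp
  then show ?thesis using ring_module.span_zero unfolding Rad_power_def by blast
qed

lemma Rad2_subspace: "ring_module.subspace (ring_Rad2 :: ('e, 'k) group_algebra set)"
  unfolding ring_Rad2_def by simp

lemma Rad2_subset: "(ring_Rad2 :: ('e, 'k) group_algebra set) \<subseteq> ring_Rad"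
  unfolding ring_Rad2_def ring_Rad_eq
  by (rule ring_module.span_minimal)
    (auto simp: aug_mult aug_add intro!: ring_module.subspaceI)

lemma Rad_congruence_Image:
  fixes x y :: "('e, 'k) group_algebra"
  assumes "x \<in> ring_Rad" "y \<in> ring_Rad"
  shows "Rad_congruence `` {x} = Rad_congruence `` {y} \<longleftrightarrow> x - y \<in> ring_Rad2"
proof
  assume eq: "Rad_congruence `` {x} = Rad_congruence `` {y}"
  have "x \<in> Rad_congruence `` {x}"
    using assms ring_module.subspace_0[OF Rad2_subspace] by (simp add: Rad_congruence_def)
  then have "x \<in> Rad_congruence `` {y}" by (simp only: eq)
  then have "y - x \<in> ring_Rad2" by (simp add: Rad_congruence_def)
  then show "x - y \<in> ring_Rad2" using ring_module.subspace_neg[OF Rad2_subspace] by fastforce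
next
  note sub = ring_module.subspace_add[OF Rad2_subspace] ring_module.subspace_diff[OF Rad2_subspace]
  assume xy: "x - y \<in> ring_Rad2"
  have "x - z \<in> ring_Rad2 \<longleftrightarrow> y - z \<in> ring_Rad2" for z
    using sub(2)[of "x - z" "x - y"] sub(1)[of "y - z" "x - y"] xy by auto
  then show "Rad_congruence `` {x} = Rad_congruence `` {y}"
    using assms by (auto simp: Rad_congruence_def)
qed

lemma V_Rad2: "v \<in> V \<Longrightarrow> v \<in> ring_Rad2 \<Longrightarrow> v = 0"
proof -
  assume v: "v \<in> V" "v \<in> ring_Rad2"
  have "Rad_congruence `` {v} = Rad_congruence `` {0}"
    using v Rad2_subset ring_module.subspace_0[OF Rad2_subspace] by (subst Rad_congruence_Image) auto
  moreover have "inj_on (\<lambda>v. Rad_congruence `` {v}) V"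
    using complement by (auto simp: Rad_complement_def bij_betw_def)
  ultimately show ?thesis
    using v group_algebra.subspace_0[OF V_subspace] by (auto dest: inj_onD)
qed

lemma Rad_V:
  assumes "a \<in> ring_Rad"
  obtains v where "v \<in> V" "a - v \<in> ring_Rad2"
proof -
  have "Rad_congruence `` {a} \<in> ring_Rad // Rad_congruence" using assms by (rule quotientI)
  moreover have "(\<lambda>v. Rad_congruence `` {v}) ` V = ring_Rad // Rad_congruence"
    using complement by (simp add: Rad_complement_def bij_betw_def)
  ultimately obtain v where v: "v \<in> V" "Rad_congruence `` {a} = Rad_congruence `` {v}"
    by (metis (no_types, lifting) imageE)
  moreover have "v \<in> ring_Rad" using v(1) complement by (auto simp: Rad_complement_def)
  ultimately show ?thesis using that assms Rad_congruence_Image by blast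
qed

text \<open>V agrees with the radical modulo its square. Hence an element of the m-th power of the
  radical is approximated by polynomials in V up to the next power, and nilpotency ends the
  successive approximation.\<close>

lemma V_generates: "group_algebra.span {prod_list l | l. set l \<subseteq> V} = UNIV"
proof -
  let ?S = "group_algebra.span {prod_list l | l. set l \<subseteq> V}"
  have Vmult: "v * s \<in> ?S" if v: "v \<in> V" and s: "s \<in> ?S" for v s
    using group_algebra.span_base[OF v] s group_algebra.subspace_span
  proof (rule mult_span_group_algebra)
    show "v' * t \<in> ?S" if v': "v' \<in> V" and t: "t \<in> {prod_list l | l. set l \<subseteq> V}" for v' t
    proof -
      obtain l where "t = prod_list l" "set l \<subseteq> V" using t by auto
      then show ?thesis using v'
        by (intro group_algebra.span_base CollectI exI[of _ "v' # l"]) auto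
    qed
  qed
  \<comment> \<open>With v the representative of x in V, \<open>x * prod_list l - v * s\<close>
    equals \<open>(x - v) * prod_list l + v * (prod_list l - s)\<close>. Both summands gain a
    degree, the first because \<open>x - v\<close> lies in the square of the radical, the second by
    induction.\<close>
  have prod: "\<exists>s\<in>?S. prod_list l - s \<in> Rad_power (Suc (length l))" if "set l \<subseteq> G" for l
    using that
  proof (induction l)
    case Nil
    have "1 \<in> ?S" by (rule group_algebra.span_base) (auto intro!: exI[of _ "[]"])
    moreover have "0 \<in> Rad_power (Suc 0)" by (simp add: Rad_power_zero)
    ultimately show ?case by (intro bexI[of _ 1]) auto
  next
    case (Cons x l)
    then obtain s where s: "s \<in> ?S" "prod_list l - s \<in> Rad_power (Suc (length l))" by auto
    have "x \<in> ring_Rad" using Cons.prems by (auto simp: ring_Rad_eq aug_diff)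
    then obtain v where v: "v \<in> V" "x - v \<in> ring_Rad2" by (rule Rad_V)
    have "prod_list l \<in> Rad_power (length l)"
      unfolding Rad_power_def using Cons.prems by (intro ring_module.span_base) auto
    then have "(x - v) * prod_list l \<in> Rad_power (2 + length l)"
      using v Rad2_Rad_power by (intro Rad_power_mult) auto
    moreover have "v * (prod_list l - s) \<in> Rad_power (1 + Suc (length l))"
      using v complement Rad_power_1 s by (intro Rad_power_mult) (auto simp: Rad_complement_def)
    ultimately have "(x - v) * prod_list l + v * (prod_list l - s) \<in> Rad_power (Suc (length (x # l)))"
      by (intro Rad_power_add) (simp_all add: numeral_2_eq_2)
    then have "prod_list (x # l) - v * s \<in> Rad_power (Suc (length (x # l)))"
      by (simp add: algebra_simps)
    then show ?case using Vmult[OF v(1) s(1)] by blast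
  qed
  have step: "\<exists>s\<in>?S. a - s \<in> Rad_power (Suc m)" if "a \<in> Rad_power m" for a m
    using that unfolding Rad_power_def[of m]
  proof (induction rule: ring_module.span_induct_alt)
    case base
    have "0 \<in> Rad_power (Suc m)" by (simp add: Rad_power_zero)
    then show ?case by (intro bexI[of _ 0]) (auto intro: group_algebra.span_zero)
  next
    case (step c x y)
    then obtain l where l: "x = prod_list l" "set l \<subseteq> G" "length l = m" by auto
    obtain s where s: "s \<in> ?S" "x - s \<in> Rad_power (Suc m)" using prod[OF l(2)] l by auto
    obtain s' where s': "s' \<in> ?S" "y - s' \<in> Rad_power (Suc m)" using step by auto
    have xm: "x \<in> Rad_power m" unfolding Rad_power_def using l by (intro ring_module.span_base) auto
    \<comment> \<open>\<open>Rad_power\<close> is a span over kE, whereas \<open>?S\<close> is a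
      span over k. Replacing the coefficient \<open>c\<close> by its augmentation leaves an error in
      the radical, which raises the degree.\<close>
    let ?c = "Poly_Mapping.single 0 (aug c)"
    have "c - ?c \<in> Rad_power 1" using Rad_power_1 by (auto simp: ring_Rad_eq aug_diff)
    then have "(c - ?c) * x \<in> Rad_power (Suc m)" using Rad_power_mult[OF _ xm, of _ 1] by simp
    moreover have "?c * (x - s) \<in> Rad_power (Suc m)"
      using Rad_power_mult[OF _ s(2), of ?c 0] by (simp add: Rad_power_0)
    ultimately have "((c - ?c) * x + ?c * (x - s)) + (y - s') \<in> Rad_power (Suc m)"
      using s'(2) by (intro Rad_power_add)
    moreover have "kscale (*) (aug c) s + s' \<in> ?S"
      using s s' by (intro group_algebra.span_add group_algebra.span_scale)
    moreover have "((c - ?c) * x + ?c * (x - s)) + (y - s') = c * x + y - (kscale (*) (aug c) s + s')"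
      by (simp add: kscale_def algebra_simps)
    ultimately show ?case by (intro bexI[of _ "kscale (*) (aug c) s + s'"]) simp_all
  qed
  have "\<exists>s\<in>?S. a - s \<in> Rad_power m" for a m
  proof (induction m)
    case 0
    then show ?case by (intro bexI[of _ 0]) (auto simp: Rad_power_0 intro: group_algebra.span_zero)
  next
    case (Suc m)
    then obtain s where s: "s \<in> ?S" "a - s \<in> Rad_power m" by auto
    then obtain s' where s': "s' \<in> ?S" "a - s - s' \<in> Rad_power (Suc m)" using step by blast
    then show ?case using s group_algebra.span_add by (intro bexI[of _ "s + s'"]) (auto simp: algebra_simps)
  qed
  then have "\<exists>s\<in>?S. a - s \<in> Rad_power (CHAR('k) ^ n * CHAR('k))" for a .
  then have "a \<in> ?S" for a unfolding Rad_power_nilpotent by fastforce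
  then show ?thesis by blast
qed

lemma kbasis_subset: "kbasis V xs \<Longrightarrow> set xs \<subseteq> V"
  using group_algebra.span_superset by (auto simp: kbasis_def)

lemma group_algebra_induct [consumes 1, case_names scalar add mult basis]:
  assumes xs: "kbasis V xs"
    and sc: "\<And>c. Q (Poly_Mapping.single 0 c)" and add: "\<And>a b. Q a \<Longrightarrow> Q b \<Longrightarrow> Q (a + b)"
    and mult: "\<And>a b. Q a \<Longrightarrow> Q b \<Longrightarrow> Q (a * b)" and b: "\<And>x. x \<in> set xs \<Longrightarrow> Q x"
  shows "Q a"
proof -
  have Q0: "Q 0" using sc[of 0] by simp
  have Q1: "Q 1" using sc[of 1] by simp
  have V: "Q v" if "v \<in> V" for v
  proof -
    have "v \<in> group_algebra.span (set xs)" using that xs by (simp add: kbasis_def)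
    then show ?thesis
      by (induction rule: group_algebra.span_induct_alt) (auto simp: Q0 kscale_def intro: add mult sc b)
  qed
  have P: "Q (prod_list l)" if "set l \<subseteq> V" for l
    using that by (induction l) (auto simp: Q1 intro: mult V)
  have "a \<in> group_algebra.span {prod_list l | l. set l \<subseteq> V}" by (simp add: V_generates)
  then show ?thesis
    by (induction rule: group_algebra.span_induct_alt) (auto simp: Q0 kscale_def intro: add mult sc P)
qed

text \<open>Sending g to the class of g - 1 is a homomorphism from E to V, and its image spans V
  over k. A k-basis inside the image is independent over the prime field as well, and the image has
  at most p^n elements.\<close>

lemma dim_V_le: assumes xs: "kbasis V xs" shows "length xs \<le> n"
proof -
  define pr where "pr g = (SOME v. v \<in> V \<and> (Poly_Mapping.single g 1 - 1) - v \<in> ring_Rad2)" for g :: 'e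
  have pr: "pr g \<in> V" "(Poly_Mapping.single g 1 - 1) - pr g \<in> ring_Rad2" for g
  proof -
    have "Poly_Mapping.single g 1 - 1 \<in> (ring_Rad :: ('e, 'k) group_algebra set)"
      by (simp add: ring_Rad_eq aug_diff)
    then have "\<exists>v. v \<in> V \<and> (Poly_Mapping.single g 1 - 1) - v \<in> ring_Rad2" using Rad_V by metis
    then show "pr g \<in> V" "(Poly_Mapping.single g 1 - 1) - pr g \<in> ring_Rad2"
      using someI_ex unfolding pr_def by (metis (mono_tags, lifting))+
  qed
  have uniq: "v = w" if "v \<in> V" "w \<in> V" "v - w \<in> ring_Rad2" for v w
    using V_Rad2[of "v - w"] group_algebra.subspace_diff[OF V_subspace] that by simp
  note sub = ring_module.subspace_add[OF Rad2_subspace] ring_module.subspace_diff[OF Rad2_subspace]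
  have pr_add: "pr (g + h) = pr g + pr h" for g h
  proof (rule uniq)
    let ?s = "\<lambda>g. Poly_Mapping.single g 1 - 1 :: ('e, 'k) group_algebra"
    \<comment> \<open>Additivity of \<open>pr\<close> holds because (g - 1)(h - 1) is the defect of
      additivity of g - 1 and lies in the square of the radical.\<close>
    have gh: "?s g * ?s h \<in> ring_Rad2"
      unfolding ring_Rad2_def
      by (intro ring_module.span_base CollectI exI[of _ "?s g"] exI[of _ "?s h"])
        (simp add: ring_Rad_eq aug_diff)
    have "?s g * ?s h - (?s (g + h) - pr (g + h)) + (?s g - pr g) + (?s h - pr h) \<in> ring_Rad2"
      by (rule sub(1)[OF sub(1)[OF sub(2)[OF gh pr(2)] pr(2)] pr(2)])
    moreover have "?s g * ?s h = ?s (g + h) - ?s g - ?s h" by (simp add: algebra_simps mult_single)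
    ultimately show "pr (g + h) - (pr g + pr h) \<in> ring_Rad2" by (simp add: algebra_simps)
  qed (use pr(1) in \<open>auto intro: group_algebra.subspace_add[OF V_subspace]\<close>)
  have pr_0: "pr 0 = 0" using pr_add[of 0 0] by simp
  have multiple: "\<exists>h. Poly_Mapping.single 0 (of_nat m) * pr g = pr h" for m g
  proof (induction m)
    case 0
    then show ?case using pr_0 by (auto intro: exI[of _ 0])
  next
    case (Suc m)
    then obtain h where "Poly_Mapping.single 0 (of_nat m) * pr g = pr h" by auto
    then have "Poly_Mapping.single 0 (of_nat (Suc m)) * pr g = pr (g + h)"
      by (simp only: of_nat_Suc single_add ring_distribs) (simp add: pr_add)
    then show ?case by blast
  qed
  have sums: "(\<Sum>b\<in>C. f b) \<in> range pr" if "\<And>b. b \<in> C \<Longrightarrow> f b \<in> range pr" for C and f :: "_ \<Rightarrow> ('e, 'k) group_algebra"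
    using that
  proof (induction C rule: infinite_finite_induct)
    case (insert x F)
    have "f x \<in> range pr" "sum f F \<in> range pr" using insert by simp_all
    then obtain g h where "f x = pr g" "sum f F = pr h" by blast
    then have "sum f (insert x F) = pr (g + h)" using insert by (simp add: pr_add)
    then show ?case by simp
  qed (use pr_0 in \<open>auto intro: rangeI[of _ 0] simp: image_iff intro!: exI[of _ 0]\<close>)
  have span: "V \<subseteq> group_algebra.span (range pr)"
  proof
    fix v assume v: "v \<in> V"
    let ?w = "\<Sum>g\<in>UNIV. Poly_Mapping.single 0 (Poly_Mapping.lookup v g) * pr g"
    have w: "?w = (\<Sum>g\<in>UNIV. kscale (*) (Poly_Mapping.lookup v g) (pr g))" by (simp add: kscale_def)
    have ws: "?w \<in> group_algebra.span (range pr)"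
      unfolding w by (intro group_algebra.span_sum group_algebra.span_scale group_algebra.span_base) simp
    have wV: "?w \<in> V"
      unfolding w using pr(1) V_subspace
      by (intro group_algebra.subspace_sum group_algebra.subspace_scale) auto
    have "v - ?w = (\<Sum>g\<in>UNIV. Poly_Mapping.single 0 (Poly_Mapping.lookup v g) * (Poly_Mapping.single g 1 - 1 - pr g))"
      by (subst aug_expand[OF V_aug[OF v]]) (simp add: sum_subtractf[symmetric] algebra_simps)
    also have "\<dots> \<in> ring_Rad2"
      using pr(2) Rad2_subspace
      by (intro ring_module.subspace_sum ring_module.subspace_scale) auto
    finally have "v = ?w" using uniq v wV by blast
    then show "v \<in> group_algebra.span (range pr)" using ws by simp
  qed
  obtain B where B: "B \<subseteq> range pr" "group_algebra.independent B" "range pr \<subseteq> group_algebra.span B"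
    by (rule group_algebra.basis_exists[of "range pr"])
  have finB: "finite B" by (rule finite_subset[OF B(1)]) simp
  have spB: "group_algebra.span B = V"
  proof
    show "group_algebra.span B \<subseteq> V" using B(1) pr(1) V_subspace by (intro group_algebra.span_minimal) auto
    show "V \<subseteq> group_algebra.span B" using span group_algebra.span_minimal[OF B(3)] by auto
  qed
  have "group_algebra.dim V = card B"
    using group_algebra.dim_span_eq_card_independent[OF B(2)] spB by simp
  moreover have "group_algebra.dim V = length xs"
    using xs group_algebra.dim_span_eq_card_independent[of "set xs"]
    by (auto simp: kbasis_def distinct_card)
  \<comment> \<open>The combinations of \<open>B\<close> with coefficients 0, ..., p - 1 stay in the
    image of \<open>pr\<close>, which is closed under addition, and they are distinct because
    \<open>B\<close> is independent.\<close>
  moreover have "CHAR('k) ^ card B \<le> CHAR('k) ^ n"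
  proof -
    let ?F = "\<lambda>\<alpha>. \<Sum>b\<in>B. kscale (*) (of_nat (\<alpha> b)) b"
    have "?F \<alpha> \<in> range pr" for \<alpha>
      using multiple B(1) by (intro sums) (auto simp: kscale_def image_iff)
    then have "?F ` (B \<rightarrow>\<^sub>E {..<CHAR('k)}) \<subseteq> range pr" by blast
    moreover have "inj_on ?F (B \<rightarrow>\<^sub>E {..<CHAR('k)})"
    proof (rule inj_onI)
      fix \<alpha> \<beta> assume ab: "\<alpha> \<in> B \<rightarrow>\<^sub>E {..<CHAR('k)}" "\<beta> \<in> B \<rightarrow>\<^sub>E {..<CHAR('k)}" "?F \<alpha> = ?F \<beta>"
      have "(\<Sum>b\<in>B. kscale (*) (of_nat (\<alpha> b) - of_nat (\<beta> b)) b) = 0"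
        using ab(3) by (simp add: group_algebra.scale_left_diff_distrib sum_subtractf)
      then have "of_nat (\<alpha> b) = (of_nat (\<beta> b) :: 'k)" if "b \<in> B" for b
        using group_algebra.independentD[OF B(2) finB subset_refl, of "\<lambda>b. of_nat (\<alpha> b) - of_nat (\<beta> b)"] that by simp
      then have "\<alpha> b = \<beta> b" if "b \<in> B" for b
        using that ab(1,2) by (intro of_nat_inj_below_CHAR[where 'a = 'k]) (auto simp: PiE_iff)
      then show "\<alpha> = \<beta>" using ab(1,2) by (auto intro: PiE_ext)
    qed
    moreover have "finite (range pr)" by simp
    ultimately have "card (B \<rightarrow>\<^sub>E {..<CHAR('k)}) \<le> card (range pr)" by (intro card_inj_on_le)
    also have "\<dots> \<le> CHAR('k) ^ n" using card_image_le[of UNIV pr] card_E by simp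
    finally show ?thesis using finB by (simp add: card_PiE)
  qed
  then have "card B \<le> n" using prime_p prime_gt_1_nat power_le_imp_le_exp by metis
  ultimately show ?thesis by simp
qed

text \<open>The monomials with exponents below p in the basis span kE, which has dimension p^n.
  There are \<open>p ^ length xs\<close> exponent vectors, so \<open>n \<le> length xs\<close>.
  Equality, given by \<open>dim_V_le\<close>, leaves no room for a zero monomial, and the norm is
  the top monomial.\<close>

lemma
  assumes xs: "kbasis V xs"
  shows length_kbasis: "length xs = n" and norm_nonzero: "(\<Prod>x\<leftarrow>xs. x ^ (CHAR('k) - 1)) \<noteq> 0"
proof -
  have dist: "distinct xs" using xs by (simp add: kbasis_def)
  define mon where "mon \<alpha> = (\<Prod>x\<in>set xs. x ^ \<alpha> x)" for \<alpha> :: "_ \<Rightarrow> nat"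
  let ?E = "set xs \<rightarrow>\<^sub>E {..<CHAR('k)}"
  let ?S = "group_algebra.span (mon ` ?E)"
  have finE: "finite ?E" by (simp add: finite_PiE)
  \<comment> \<open>Multiplication by a basis vector raises one exponent: either it stays below p,
    or the factor \<open>x ^ p = 0\<close> appears.\<close>
  have xmult: "x * s \<in> ?S" if x: "x \<in> set xs" and s: "s \<in> ?S" for x s
    using group_algebra.span_base[of x "{x}"] s group_algebra.subspace_span
  proof (rule mult_span_group_algebra)
    fix y t assume "y \<in> {x}" "t \<in> mon ` ?E"
    then obtain \<alpha> where \<alpha>: "y = x" "t = mon \<alpha>" "\<alpha> \<in> ?E" by auto
    have "mon \<alpha> = x ^ \<alpha> x * (\<Prod>z\<in>set xs - {x}. z ^ \<alpha> z)"
      unfolding mon_def using x by (simp add: prod.remove[of "set xs" x])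
    moreover have "mon (\<alpha>(x := Suc (\<alpha> x))) = x ^ Suc (\<alpha> x) * (\<Prod>z\<in>set xs - {x}. z ^ \<alpha> z)"
    proof -
      have "(\<Prod>z\<in>set xs - {x}. z ^ (\<alpha>(x := Suc (\<alpha> x))) z) = (\<Prod>z\<in>set xs - {x}. z ^ \<alpha> z)"
        by (rule prod.cong) auto
      then show ?thesis unfolding mon_def using x by (simp add: prod.remove[of "set xs" x])
    qed
    ultimately have eq: "y * t = mon (\<alpha>(x := Suc (\<alpha> x)))"
      "y * t = x ^ Suc (\<alpha> x) * (\<Prod>z\<in>set xs - {x}. z ^ \<alpha> z)" using \<alpha> by (simp_all add: mult.assoc)
    show "y * t \<in> ?S"
    proof (cases "Suc (\<alpha> x) < CHAR('k)")
      case True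
      then have "\<alpha>(x := Suc (\<alpha> x)) \<in> ?E" using \<alpha>(3) x by (auto simp: PiE_iff extensional_def)
      then show ?thesis unfolding eq(1) by (intro group_algebra.span_base) auto
    next
      case False
      moreover have "\<alpha> x < CHAR('k)" using \<alpha>(3) x by (auto simp: PiE_iff)
      ultimately have "x ^ Suc (\<alpha> x) = 0" using V_power_p kbasis_subset[OF xs] x
        by (metis Suc_lessI subsetD)
      then show ?thesis unfolding eq(2) by (simp add: group_algebra.span_zero)
    qed
  qed simp
  have Vmult: "v * s \<in> ?S" if v: "v \<in> V" and s: "s \<in> ?S" for v s
  proof -
    have "v \<in> group_algebra.span (set xs)" using v xs by (simp add: kbasis_def)
    then show ?thesis using group_algebra.span_base[OF s] group_algebra.subspace_span
      by (rule mult_span_group_algebra) (use xmult in auto)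
  qed
  \<comment> \<open>The value \<open>undefined\<close> off \<open>set xs\<close> is what membership
    in the extensional function space \<open>?E\<close> demands.\<close>
  have "mon (\<lambda>x. if x \<in> set xs then 0 else undefined) = 1" by (simp add: mon_def)
  moreover have "(\<lambda>x. if x \<in> set xs then 0 else undefined) \<in> ?E" using p_pos by (auto simp: PiE_iff extensional_def)
  ultimately have "1 \<in> ?S" by (metis group_algebra.span_base image_eqI)
  then have "prod_list l \<in> ?S" if "set l \<subseteq> V" for l
    using that by (induction l) (auto intro: Vmult)
  then have "group_algebra.span {prod_list l |l. set l \<subseteq> V} \<subseteq> ?S"
    by (intro group_algebra.span_minimal) auto
  then have top: "?S = UNIV" using V_generates by auto
  have "card (mon ` ?E) \<le> card ?E" using finE by (rule card_image_le)
  then have card: "card (mon ` ?E) \<le> CHAR('k) ^ length xs" using dist by (simp add: card_PiE distinct_card)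
  moreover have le: "CHAR('k) ^ n \<le> card (mon ` ?E)"
    using dim_group_algebra_le[OF _ top] finE card_E by simp
  ultimately have "CHAR('k) ^ n \<le> CHAR('k) ^ length xs" by linarith
  then have "n \<le> length xs" using prime_p prime_gt_1_nat power_le_imp_le_exp by metis
  then show len: "length xs = n" using dim_V_le[OF xs] by simp
  show "(\<Prod>x\<leftarrow>xs. x ^ (CHAR('k) - 1)) \<noteq> 0"
  proof
    assume zero: "(\<Prod>x\<leftarrow>xs. x ^ (CHAR('k) - 1)) = 0"
    have "mon (\<lambda>x. if x \<in> set xs then CHAR('k) - 1 else undefined) = (\<Prod>x\<leftarrow>xs. x ^ (CHAR('k) - 1))"
      using dist by (simp add: mon_def prod.distinct_set_conv_list)
    moreover have "(\<lambda>x. if x \<in> set xs then CHAR('k) - 1 else undefined) \<in> ?E" using p_pos by (auto simp: PiE_iff extensional_def)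
    ultimately have "0 \<in> mon ` ?E" using zero by (metis image_eqI)
    \<comment> \<open>Dropping a zero monomial would leave a spanning set with fewer than p^n
      elements.\<close>
    moreover have "group_algebra.span (mon ` ?E - {0}) = UNIV" using top by simp
    then have "CHAR('k) ^ n \<le> card (mon ` ?E - {0})"
      using dim_group_algebra_le[of "mon ` ?E - {0}"] finE card_E by simp
    ultimately have "CHAR('k) ^ n < card (mon ` ?E)" using finE
      by (metis card_Diff1_less finite_imageI le_less_trans)
    then show False using card len by simp
  qed
qed

lemma V_finite_independent:
  assumes "B \<subseteq> V" "group_algebra.independent B"
  shows "finite B"
proof -
  have "UNIV \<subseteq> group_algebra.span (range (\<lambda>g. Poly_Mapping.single g 1 :: ('e, 'k) group_algebra))"
  proof
    fix a :: "('e, 'k) group_algebra"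
    have "a = (\<Sum>g\<in>UNIV. kscale (*) (Poly_Mapping.lookup a g) (Poly_Mapping.single g 1))"
      by (subst group_algebra_expand[of a]) (simp add: kscale_def mult_single)
    also have "\<dots> \<in> group_algebra.span (range (\<lambda>g. Poly_Mapping.single g 1))"
      by (intro group_algebra.span_sum group_algebra.span_scale group_algebra.span_base) simp
    finally show "a \<in> group_algebra.span (range (\<lambda>g. Poly_Mapping.single g 1))" .
  qed
  then show ?thesis
    using group_algebra.independent_span_bound[of "range (\<lambda>g. Poly_Mapping.single g 1)" B] assms by auto
qed

lemma plane_basis:
  assumes "plane V r U"
  obtains us vs where "length us = r" "group_algebra.span (set us) = U" "kbasis V (us @ vs)"
proof -
  have U: "U \<subseteq> V" "group_algebra.subspace U" "group_algebra.dim U = r"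
    using assms by (auto simp: plane_def)
  obtain B where B: "B \<subseteq> U" "group_algebra.independent B" "U \<subseteq> group_algebra.span B" "card B = group_algebra.dim U"
    by (rule group_algebra.basis_exists[of U])
  obtain C where C: "B \<subseteq> C" "C \<subseteq> V" "group_algebra.independent C" "V \<subseteq> group_algebra.span C"
    using group_algebra.maximal_independent_subset_extend[of B V] B U by blast
  have fin: "finite C" using V_finite_independent C by blast
  then obtain us where us: "set us = B" "distinct us" using finite_distinct_list C(1) finite_subset by metis
  obtain vs where vs: "set vs = C - B" "distinct vs" using finite_distinct_list fin by blast
  have "group_algebra.span B = U" using B U by (simp add: group_algebra.span_subspace)
  moreover have "group_algebra.span C = V" using C V_subspace by (simp add: group_algebra.span_subspace)
  moreover have "set (us @ vs) = C" using us vs C by auto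
  moreover have "length us = r" using us B U distinct_card by metis
  ultimately show ?thesis using that[of us vs] us vs C by (auto simp: kbasis_def)
qed

end


section \<open>Injective modules and averaging\<close>

text \<open>Higman's criterion for injectivity over the subalgebra generated by \<open>xs\<close>.\<close>

definition higman :: "('e::{ab_group_add, finite}, 'k::field, 'v::ab_group_add) kE_module \<Rightarrow>
    ('e, 'k) group_algebra list \<Rightarrow> bool" where
  "higman M xs \<longleftrightarrow> (\<exists>h. khom M M {} h \<and> (\<forall>v\<in>Carrier M. tr M M (zip xs xs) h v = v))"

definition regular :: "('e::{ab_group_add, finite}, 'k::field, ('e, 'k) group_algebra) kE_module" where
  "regular = \<lparr>Carrier = UNIV, act = (*)\<rparr>"

lemma regular_simps [simp]: "Carrier regular = UNIV" "act regular = (*)"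
  by (simp_all add: regular_def)

lemma kE_mod_regular: "kE_mod (regular :: ('e::{ab_group_add, finite}, 'k::field, _) kE_module)"
  by (simp add: kE_mod_def ring_module.module_axioms)

lemma lookup_scalar_mult:
  fixes a :: "('e::{ab_group_add, finite}, 'k::field) group_algebra"
  shows "Poly_Mapping.lookup (Poly_Mapping.single 0 c * a) g = c * Poly_Mapping.lookup a g"
  by (subst group_algebra_expand[of a])
    (simp add: sum_distrib_left mult_single lookup_sum lookup_single when_def)

lemma prod_list_zip_fst:
  "length xs = length ys \<Longrightarrow> (\<Prod>z\<leftarrow>zip xs ys. f (fst z)) = (\<Prod>x\<leftarrow>xs. f x)"
  and prod_list_zip_snd:
  "length xs = length ys \<Longrightarrow> (\<Prod>z\<leftarrow>zip xs ys. f (snd z)) = (\<Prod>y\<leftarrow>ys. f y)"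
  by (induction xs ys rule: list_induct2) auto

lemma set_zip_same: "set (zip xs xs) = Id_on (set xs)"
  by (auto simp: zip_same Id_on_def)

lemma khom_prod_list:
  assumes f: "khom M N (set (zip xs ys)) f" and M: "kE_mod M" and N: "kE_mod N"
    and len: "length xs = length ys" and v: "v \<in> Carrier M"
  shows "f (act M (\<Prod>x\<leftarrow>xs. x ^ j) v) = act N (\<Prod>y\<leftarrow>ys. y ^ j) (f v)"
  using len f v
proof (induction xs ys arbitrary: v rule: list_induct2)
  case Nil
  then show ?case by (simp add: act_one[OF M] act_one[OF N])
next
  case (Cons x xs y ys)
  have f': "khom M N (set (zip xs ys)) f" using Cons.prems(1) by (rule khom_subset) auto
  show ?case
    using khom_power[OF Cons.prems(1) M N, of x y _ j] Cons.IH[OF f' Cons.prems(2)] kE_mod_act[OF M Cons.prems(2)]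
    by (simp add: act_act[OF M, symmetric] act_act[OF N, symmetric])
qed

context rad_complement begin

lemma khom_kE_linear:
  assumes xs: "kbasis V xs" and f: "khom M N (set (zip xs xs)) f" and M: "kE_mod M" and N: "kE_mod N"
    and v: "v \<in> Carrier M"
  shows "f (act M a v) = act N a (f v)"
proof -
  have "\<forall>v\<in>Carrier M. f (act M a v) = act N a (f v)"
    using xs
  proof (induction a rule: group_algebra_induct)
    case (scalar c)
    then show ?case using khom_scalar[OF f] by simp
  next
    case (add a b)
    then show ?case
      using khom_add[OF f] kE_mod_act[OF M] by (simp add: act_add_left[OF M] act_add_left[OF N])
  next
    case (mult a b)
    then show ?case
      using kE_mod_act[OF M] by (simp add: act_act[OF M, symmetric] act_act[OF N, symmetric])
  next
    case (basis x)
    then show ?case using khom_act[OF f, of x x] by (simp add: set_zip_same Id_on_def)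
  qed
  then show ?thesis using v by blast
qed

lemma khom_kE_hom:
  assumes "kbasis V xs" "khom M N (set (zip xs xs)) f" "kE_mod M" "kE_mod N"
  shows "kE_hom M N f"
  using khom_kE_linear[OF assms] khom_in[OF assms(2)] khom_add[OF assms(2)]
  unfolding kE_hom_def by blast

lemma kbasis_power_p: "kbasis V xs \<Longrightarrow> x \<in> set xs \<Longrightarrow> x ^ CHAR('k) = 0"
  using kbasis_subset V_power_p by blast

text \<open>The trace of a functional that is 1 on the norm is kE-linear, hence multiplication by
  its value at 1. This value is congruent to 1 modulo the radical, so it is a unit, and dividing by
  it turns the trace into the identity.\<close>

lemma regular_higman:
  assumes xs: "kbasis V xs"
  shows "higman (regular :: ('e, 'k, _) kE_module) xs"
proof -
  let ?R = "regular :: ('e, 'k, _) kE_module"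
  let ?N = "\<Prod>x\<leftarrow>xs. x ^ (CHAR('k) - 1)"
  note R = kE_mod_regular[where 'e = 'e and 'k = 'k]
  obtain g0 where g0: "Poly_Mapping.lookup ?N g0 \<noteq> 0"
    using norm_nonzero[OF xs] by (metis lookup_zero poly_mapping_eqI)
  \<comment> \<open>A coordinate on which the norm does not vanish, scaled to be 1 at the norm and
    read as a scalar of kE.\<close>
  define h0 where "h0 a = (Poly_Mapping.single 0 (Poly_Mapping.lookup a g0 / Poly_Mapping.lookup ?N g0) :: ('e, 'k) group_algebra)" for a
  have h0: "khom ?R ?R {} h0"
    by (rule khomI)
      (simp_all add: h0_def lookup_add lookup_scalar_mult mult_single add_divide_distrib single_add)
  define T where "T = tr ?R ?R (zip xs xs) h0"
  have T: "khom ?R ?R (set (zip xs xs)) T"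
    using tr_khom[OF R R h0 p_pos, of "zip xs xs"] kbasis_power_p[OF xs]
    by (auto simp: T_def set_zip_same)
  have Ta: "T a = a * T 1" for a
    using khom_kE_linear[OF xs T R R, of 1 a] by simp
  have "T 1 - h0 (?N * 1) \<in> ideal_act (set xs) ?R"
    using tr_mod_ideal[OF R R h0 p_pos, of 1 "zip xs xs"]
    by (simp add: T_def prod_list_zip_fst[where f = "\<lambda>x. x ^ (CHAR('k) - Suc 0)"] set_zip_same Id_on_def image_UN)
  moreover have "h0 ?N = 1" using g0 by (simp add: h0_def)
  moreover have "ideal_act (set xs) ?R \<subseteq> {a. aug a = 0}"
    unfolding ideal_act_def regular_simps
    using V_aug kbasis_subset[OF xs]
    by (intro ring_module.span_minimal ring_module.subspaceI) (auto simp: aug_mult aug_add)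
  ultimately have "aug (T 1) = 1" by (auto simp: aug_diff)
  then obtain b where b: "T 1 * b = 1" using unit_if_aug[of "T 1"] by auto
  have gb: "khom ?R ?R (set (zip xs xs)) (\<lambda>a. a * b)"
    by (rule khomI) (auto simp: set_zip_same algebra_simps)
  have "tr ?R ?R (zip xs xs) ((\<lambda>a. a * b) \<circ> h0) a = a" for a
    using tr_comp_left[OF R R R gb h0, of xs a] Ta[of a] b by (simp add: T_def[symmetric] mult.assoc)
  moreover have "khom ?R ?R {} ((\<lambda>a. a * b) \<circ> h0)" using h0 gb by (rule khom_compose) simp
  ultimately show ?thesis unfolding higman_def by blast
qed

end

text \<open>
  The vector space \<open>nat \<Rightarrow>\<^sub>0 'k\<close> as a direct sum of countably many copies of \<open>kE\<close>, with the
  \<open>g\<close>-coordinate of the \<open>m\<close>-th copy at position \<open>m |E| + enum g\<close>.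
\<close>

definition enum :: "'e::finite \<Rightarrow> nat" where
  "enum = (SOME f. bij_betw f UNIV {..<card (UNIV :: 'e set)})"

lemma bij_enum: "bij_betw (enum :: 'e::finite \<Rightarrow> nat) UNIV {..<card (UNIV :: 'e set)}"
proof -
  have "\<exists>f. bij_betw f (UNIV :: 'e set) {..<card (UNIV :: 'e set)}"
    using ex_bij_betw_finite_nat[of "UNIV :: 'e set"] by (simp add: atLeast0LessThan)
  then show ?thesis unfolding enum_def by (rule someI_ex)
qed

lemma enum_less: "enum (g :: 'e::finite) < card (UNIV :: 'e set)"
  using bij_enum by (auto simp: bij_betw_def)

lemma inv_enum: "inv enum (enum g) = g"
  using bij_enum by (auto simp: bij_betw_def intro: inv_f_f)

lemma enum_inv: "i < card (UNIV :: 'e::finite set) \<Longrightarrow> enum (inv enum i :: 'e) = i"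
  using bij_enum[where 'e = 'e] by (metis bij_betw_def f_inv_into_f lessThan_iff)

definition component :: "nat \<Rightarrow> (nat \<Rightarrow>\<^sub>0 'k) \<Rightarrow> ('e::{ab_group_add, finite}, 'k::field) group_algebra" where
  "component m f = (\<Sum>g\<in>UNIV. Poly_Mapping.single g (Poly_Mapping.lookup f (m * card (UNIV :: 'e set) + enum g)))"

definition assemble :: "(nat \<Rightarrow> ('e::{ab_group_add, finite}, 'k::field) group_algebra) \<Rightarrow> nat \<Rightarrow>\<^sub>0 'k" where
  "assemble F = Abs_poly_mapping (\<lambda>i.
     Poly_Mapping.lookup (F (i div card (UNIV :: 'e set))) (inv enum (i mod card (UNIV :: 'e set))))"

lemma lookup_component:
  "Poly_Mapping.lookup (component m f :: ('e::{ab_group_add, finite}, 'k::field) group_algebra) g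
    = Poly_Mapping.lookup f (m * card (UNIV :: 'e set) + enum g)"
  by (simp add: component_def lookup_sum lookup_single when_def)

lemma component_add: "component m (f + f') = component m f + component m f'"
  by (rule poly_mapping_eqI) (simp add: lookup_component lookup_add)

lemma component_0 [simp]: "component m 0 = 0"
  by (rule poly_mapping_eqI) (simp add: lookup_component)

lemma component_eqI:
  assumes "\<And>m. (component m f :: ('e::{ab_group_add, finite}, 'k::field) group_algebra) = component m f'"
  shows "f = f'"
proof (rule poly_mapping_eqI)
  fix i
  let ?N = "card (UNIV :: 'e set)"
  have "i = (i div ?N) * ?N + enum (inv enum (i mod ?N) :: 'e)"
    using enum_inv[of "i mod ?N", where 'e = 'e] by (simp add: card_gt_0_iff)
  then show "Poly_Mapping.lookup f i = Poly_Mapping.lookup f' i"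
    using assms lookup_component by metis
qed

lemma finite_component:
  "finite {m. (component m f :: ('e::{ab_group_add, finite}, 'k::field) group_algebra) \<noteq> 0}"
proof (rule finite_subset)
  let ?N = "card (UNIV :: 'e set)"
  show "{m. (component m f :: ('e, 'k) group_algebra) \<noteq> 0} \<subseteq> (\<lambda>i. i div ?N) ` Poly_Mapping.keys f"
  proof
    fix m assume "m \<in> {m. (component m f :: ('e, 'k) group_algebra) \<noteq> 0}"
    then have "(component m f :: ('e, 'k) group_algebra) \<noteq> 0" by simp
    then obtain g where "Poly_Mapping.lookup (component m f :: ('e, 'k) group_algebra) g \<noteq> 0"
      by (metis lookup_zero poly_mapping_eqI)
    then have "m * ?N + enum g \<in> Poly_Mapping.keys f"
      by (simp add: lookup_component in_keys_iff)
    moreover have "(m * ?N + enum g) div ?N = m" using enum_less[of g] by simp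
    ultimately show "m \<in> (\<lambda>i. i div ?N) ` Poly_Mapping.keys f" by (metis image_eqI)
  qed
qed simp

text \<open>\<open>Abs_poly_mapping\<close> is meaningful only for finite support. A family with
  finitely many nonzero members is supported in finitely many blocks of length |E|.\<close>

lemma component_assemble:
  fixes F :: "nat \<Rightarrow> ('e::{ab_group_add, finite}, 'k::field) group_algebra"
  assumes "finite {m. F m \<noteq> 0}"
  shows "component m (assemble F) = F m"
proof (rule poly_mapping_eqI)
  fix g
  let ?N = "card (UNIV :: 'e set)"
  let ?f = "\<lambda>i. Poly_Mapping.lookup (F (i div ?N)) (inv enum (i mod ?N))"
  have "{i. ?f i \<noteq> 0} \<subseteq> (\<Union>m\<in>{m. F m \<noteq> 0}. {..< Suc m * ?N})"
  proof
    fix i assume "i \<in> {i. ?f i \<noteq> 0}"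
    then have "F (i div ?N) \<noteq> 0" by auto
    moreover have "i < Suc (i div ?N) * ?N"
      using dividend_less_times_div[of ?N i] by (simp add: card_gt_0_iff mult.commute)
    ultimately show "i \<in> (\<Union>m\<in>{m. F m \<noteq> 0}. {..< Suc m * ?N})" by blast
  qed
  then have "finite {i. ?f i \<noteq> 0}" by (rule finite_subset) (use assms in auto)
  then have "Poly_Mapping.lookup (assemble F) = ?f" by (simp add: assemble_def)
  then show "Poly_Mapping.lookup (component m (assemble F)) g = Poly_Mapping.lookup (F m) g"
    using enum_less[of g] by (simp add: lookup_component inv_enum)
qed

text \<open>The action lives on the whole type and does not depend on \<open>r\<close>; only the
  carrier, the first \<open>r\<close> copies of kE, does. The type is that of the test modules of
  \<open>injective\<close>, so free modules and their submodules can serve as tests.\<close>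

definition free_module :: "nat \<Rightarrow> ('e::{ab_group_add, finite}, 'k::field, nat \<Rightarrow>\<^sub>0 'k) kE_module" where
  "free_module r = \<lparr>Carrier = {f. \<forall>m\<ge>r. (component m f :: ('e, 'k) group_algebra) = 0},
     act = (\<lambda>a f. assemble (\<lambda>m. a * component m f))\<rparr>"

lemma mem_free_module:
  "f \<in> Carrier (free_module r :: ('e::{ab_group_add, finite}, 'k::field, nat \<Rightarrow>\<^sub>0 'k) kE_module)
    \<longleftrightarrow> (\<forall>m\<ge>r. (component m f :: ('e, 'k) group_algebra) = 0)"
  by (simp add: free_module_def)

lemma component_act:
  fixes a :: "('e::{ab_group_add, finite}, 'k::field) group_algebra"
  shows "component m (act (free_module r) a f) = a * component m f"
proof -
  have "finite {m. a * component m f \<noteq> 0}"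
    by (rule finite_subset[OF _ finite_component[of f, where 'e = 'e]]) auto
  then show ?thesis by (simp add: free_module_def component_assemble)
qed

lemma kE_mod_free: "kE_mod (free_module r :: ('e::{ab_group_add, finite}, 'k::field, nat \<Rightarrow>\<^sub>0 'k) kE_module)"
proof -
  let ?J = "free_module r :: ('e, 'k, nat \<Rightarrow>\<^sub>0 'k) kE_module"
  have mod: "module (act ?J)"
    by unfold_locales
      (rule component_eqI[where 'e = 'e], simp add: component_act component_add algebra_simps)+
  then interpret module "act ?J" .
  have "subspace (Carrier ?J)"
    by (rule subspaceI) (simp_all add: mem_free_module component_act component_add)
  then show ?thesis using mod by (simp add: kE_mod_def)
qed

lemma lookup_kscale_free:
  "Poly_Mapping.lookup (kscale (act (free_module r :: ('e::{ab_group_add, finite}, 'k::field, nat \<Rightarrow>\<^sub>0 'k) kE_module)) c f) i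
    = c * Poly_Mapping.lookup f i"
proof -
  let ?N = "card (UNIV :: 'e set)"
  define g where "g = (inv enum (i mod ?N) :: 'e)"
  have i: "(i div ?N) * ?N + enum g = i"
    using enum_inv[of "i mod ?N", where 'e = 'e] by (simp add: card_gt_0_iff g_def)
  show ?thesis
    using lookup_component[of "i div ?N" "kscale (act (free_module r :: ('e, 'k, nat \<Rightarrow>\<^sub>0 'k) kE_module)) c f" g]
      lookup_component[of "i div ?N" f g]
    by (simp add: i kscale_def component_act lookup_scalar_mult)
qed

lemma fd_free: "fd_module (free_module r :: ('e::{ab_group_add, finite}, 'k::field, nat \<Rightarrow>\<^sub>0 'k) kE_module)"
proof -
  let ?J = "free_module r :: ('e, 'k, nat \<Rightarrow>\<^sub>0 'k) kE_module"
  let ?N = "card (UNIV :: 'e set)"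
  let ?B = "(\<lambda>i. Poly_Mapping.single i (1::'k)) ` {..<r * ?N}"
  interpret vector_space "kscale (act ?J)" by (rule kE_mod_vector_space[OF kE_mod_free])
  have car: "f \<in> Carrier ?J \<longleftrightarrow> (\<forall>i\<ge>r * ?N. Poly_Mapping.lookup f i = 0)" for f
  proof
    assume f: "f \<in> Carrier ?J"
    show "\<forall>i\<ge>r * ?N. Poly_Mapping.lookup f i = 0"
    proof (intro allI impI)
      fix i assume "r * ?N \<le> i"
      then have "r \<le> i div ?N" by (simp add: less_eq_div_iff_mult_less_eq card_gt_0_iff)
      then have "(component (i div ?N) f :: ('e, 'k) group_algebra) = 0" using f by (simp add: free_module_def)
      then have "Poly_Mapping.lookup f ((i div ?N) * ?N + enum (inv enum (i mod ?N) :: 'e)) = 0"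
        by (metis lookup_component lookup_zero)
      then show "Poly_Mapping.lookup f i = 0"
        using enum_inv[of "i mod ?N", where 'e = 'e] by (simp add: card_gt_0_iff)
    qed
  next
    assume f: "\<forall>i\<ge>r * ?N. Poly_Mapping.lookup f i = 0"
    have "(component m f :: ('e, 'k) group_algebra) = 0" if "m \<ge> r" for m
    proof (rule poly_mapping_eqI)
      fix g :: 'e
      have "r * ?N \<le> m * ?N + enum g" using that by (simp add: trans_le_add1)
      then show "Poly_Mapping.lookup (component m f) g = Poly_Mapping.lookup 0 g"
        using f by (simp add: lookup_component)
    qed
    then show "f \<in> Carrier ?J" by (simp add: free_module_def)
  qed
  have "Carrier ?J = span ?B"
  proof
    show "span ?B \<subseteq> Carrier ?J"
      by (rule span_minimal[OF _ kE_mod_kspace[OF kE_mod_free]])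
        (auto simp: car lookup_single when_def)
    show "Carrier ?J \<subseteq> span ?B"
    proof
      fix f assume f: "f \<in> Carrier ?J"
      have "f = (\<Sum>i<r * ?N. kscale (act ?J) (Poly_Mapping.lookup f i) (Poly_Mapping.single i 1))"
      proof (rule poly_mapping_eqI)
        fix j
        have "Poly_Mapping.lookup (\<Sum>i<r * ?N. kscale (act ?J) (Poly_Mapping.lookup f i) (Poly_Mapping.single i 1)) j
          = (\<Sum>i<r * ?N. if i = j then Poly_Mapping.lookup f i else 0)"
          unfolding lookup_sum lookup_kscale_free by (rule sum.cong) (auto simp: lookup_single when_def)
        also have "\<dots> = (if j < r * ?N then Poly_Mapping.lookup f j else 0)"
          by (simp add: sum.delta')
        finally show "Poly_Mapping.lookup f j = Poly_Mapping.lookup (\<Sum>i<r * ?N. kscale (act ?J) (Poly_Mapping.lookup f i) (Poly_Mapping.single i 1)) j"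
          using f car by auto
      qed
      also have "\<dots> \<in> span ?B" by (intro span_sum span_scale span_base) auto
      finally show "f \<in> span ?B" .
    qed
  qed
  then show ?thesis
    using kE_mod_free[of r, where 'e = 'e and 'k = 'k] unfolding fd_module_def kE_mod_def by blast
qed

lemma component_khom:
  "khom (free_module r :: ('e::{ab_group_add, finite}, 'k::field, nat \<Rightarrow>\<^sub>0 'k) kE_module) regular (set (zip xs xs)) (component m)"
  by (rule khomI) (auto simp: component_add component_act set_zip_same)

lemma free_higman:
  assumes "higman (regular :: ('e::{ab_group_add, finite}, 'k::field, _) kE_module) xs"
  shows "higman (free_module r :: ('e, 'k, nat \<Rightarrow>\<^sub>0 'k) kE_module) xs"
proof -
  let ?J = "free_module r :: ('e, 'k, nat \<Rightarrow>\<^sub>0 'k) kE_module"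
  let ?R = "regular :: ('e, 'k, _) kE_module"
  note J = kE_mod_free[of r, where 'e = 'e and 'k = 'k] and R = kE_mod_regular[where 'e = 'e and 'k = 'k]
  obtain h where h: "khom ?R ?R {} h" "\<And>a. tr ?R ?R (zip xs xs) h a = a"
    using assms unfolding higman_def by auto
  have h_0: "h 0 = 0" using khom_zero[OF h(1) R] .
  define hJ where "hJ f = assemble (\<lambda>m. h (component m f))" for f
  have cJ: "component m (hJ f) = h (component m f)" for m f
    unfolding hJ_def
    by (rule component_assemble, rule finite_subset[OF _ finite_component[of f, where 'e = 'e]])
      (auto simp: h_0)
  have hJ: "khom ?J ?J {} hJ"
  proof (rule khomI)
    show "hJ x \<in> Carrier ?J" if "x \<in> Carrier ?J" for x
      using that by (auto simp: free_module_def cJ h_0)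
    show "hJ (x + y) = hJ x + hJ y" for x y
      by (rule component_eqI[where 'e = 'e]) (use khom_add[OF h(1)] in \<open>simp add: cJ component_add\<close>)
    show "hJ (act ?J (Poly_Mapping.single 0 c) x) = act ?J (Poly_Mapping.single 0 c) (hJ x)" for c x
      by (rule component_eqI[where 'e = 'e]) (use khom_scalar[OF h(1)] in \<open>simp add: cJ component_act\<close>)
  qed auto
  have "tr ?J ?J (zip xs xs) hJ f = f" if f: "f \<in> Carrier ?J" for f
  proof (rule component_eqI[where 'e = 'e])
    fix m
    have "component m (tr ?J ?J (zip xs xs) hJ f) = tr ?J ?R (zip xs xs) (component m \<circ> hJ) f"
      by (rule tr_comp_left[OF J J R component_khom hJ _ _ f]) simp_all
    also have "component m \<circ> hJ = h \<circ> component m" by (auto simp: cJ)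
    also have "tr ?J ?R (zip xs xs) (h \<circ> component m) f = tr ?R ?R (zip xs xs) h (component m f)"
      by (rule tr_comp_right[symmetric, OF J R component_khom _ _ f]) simp_all
    also have "\<dots> = component m f" by (rule h(2))
    finally show "(component m (tr ?J ?J (zip xs xs) hJ f) :: ('e, 'k) group_algebra) = component m f" .
  qed
  then show ?thesis using hJ unfolding higman_def by blast
qed

text \<open>A linear functional l on \<open>I\<close> corresponds to the kE-linear map to kE that
  sends v to the sum over g of l(-g v) g. The coordinate functionals of a basis together give the
  embedding.\<close>

lemma embed_free:
  fixes I :: "('e::{ab_group_add, finite}, 'k::field, 'v::ab_group_add) kE_module"
  assumes "fd_module I"
  obtains r \<epsilon> where "kE_hom I (free_module r) \<epsilon>" "inj_on \<epsilon> (Carrier I)"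
proof -
  note I = fd_module_kE_mod[OF assms]
  interpret vector_space "kscale (act I)" using I by (rule kE_mod_vector_space)
  obtain T where T: "finite T" "Carrier I = span T" using assms by (auto simp: fd_module_def)
  obtain B where B: "B \<subseteq> Carrier I" "independent B" "Carrier I \<subseteq> span B"
    by (rule basis_exists[of "Carrier I"])
  have spB: "span B = Carrier I" using B(1,3) kE_mod_kspace[OF I] by (simp add: span_subspace)
  have finB: "finite B" using independent_span_bound[OF T(1) B(2)] B(1) T by auto
  then obtain b where b: "bij_betw b {..<card B} B"
    using ex_bij_betw_nat_finite[OF finB] by (auto simp: atLeast0LessThan)
  define l where "l m v = representation B v (b m)" for m v
  have l_add: "l m (v + w) = l m v + l m w" if "v \<in> Carrier I" "w \<in> Carrier I" for m v w
    using that representation_add[OF B(2), of w v] by (simp add: l_def spB add.commute)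
  have l_scale: "l m (act I (Poly_Mapping.single 0 c) v) = c * l m v" if "v \<in> Carrier I" for m v c
    using that representation_scale[OF B(2), of v c] by (simp add: l_def spB kscale_def)
  define E where "E m v = (\<Sum>g\<in>UNIV. Poly_Mapping.single g (l m (act I (Poly_Mapping.single (- g) 1) v)) :: ('e, 'k) group_algebra)" for m v
  have E_add: "E m (v + w) = E m v + E m w" if "v \<in> Carrier I" "w \<in> Carrier I" for m v w
    using that by (simp add: E_def act_add_right[OF I] l_add kE_mod_act[OF I] single_add sum.distrib)
  have E_0: "E m 0 = 0" for m using E_add[of 0 0 m] kE_mod_0[OF I] by simp
  have E_single: "E m (act I (Poly_Mapping.single h c) v) = Poly_Mapping.single h c * E m v"
    if v: "v \<in> Carrier I" for m v h c
  proof -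
    have "l m (act I (Poly_Mapping.single (- (g + h)) 1) (act I (Poly_Mapping.single h c) v))
      = c * l m (act I (Poly_Mapping.single (- g) 1) v)" for g
    proof -
      have "act I (Poly_Mapping.single (- (g + h)) 1) (act I (Poly_Mapping.single h c) v)
        = act I (Poly_Mapping.single 0 c) (act I (Poly_Mapping.single (- g) 1) v)"
        by (simp add: act_act[OF I] mult_single)
      then show ?thesis using l_scale[OF kE_mod_act[OF I v]] by simp
    qed
    then have "Poly_Mapping.single h c * E m v = (\<Sum>g\<in>UNIV. Poly_Mapping.single (g + h)
        (l m (act I (Poly_Mapping.single (- (g + h)) 1) (act I (Poly_Mapping.single h c) v))))"
      by (simp add: E_def sum_distrib_left mult_single add.commute)
    also have "\<dots> = E m (act I (Poly_Mapping.single h c) v)"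
      unfolding E_def
      by (rule sum.reindex_bij_witness[of _ "\<lambda>g. g - h" "\<lambda>g. g + h"]) simp_all
    finally show ?thesis by simp
  qed
  have E_act: "E m (act I a v) = a * E m v" if v: "v \<in> Carrier I" for m v a
  proof -
    have "E m (act I (\<Sum>g\<in>X. Poly_Mapping.single g (Poly_Mapping.lookup a g)) v)
      = (\<Sum>g\<in>X. Poly_Mapping.single g (Poly_Mapping.lookup a g)) * E m v" for X
      by (induction X rule: infinite_finite_induct)
        (auto simp: act_zero[OF I] E_0 act_add_left[OF I] E_add kE_mod_act[OF I] v E_single distrib_right)
    then show ?thesis using group_algebra_expand[of a] by metis
  qed
  \<comment> \<open>The coefficient at 0 of \<open>E m v\<close> is the coordinate
    \<open>l m v\<close>, so the maps \<open>E m\<close> separate points.\<close>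
  have E_inj: "v = w" if vw: "v \<in> Carrier I" "w \<in> Carrier I" "\<And>m. m < card B \<Longrightarrow> E m v = E m w" for v w
  proof -
    have lE: "l m v = Poly_Mapping.lookup (E m v) 0" if "v \<in> Carrier I" for m v
    proof -
      have "Poly_Mapping.lookup (E m v) 0 = l m (act I 1 v)"
        by (simp add: E_def lookup_sum lookup_single when_def)
      then show ?thesis by (simp add: act_one[OF I])
    qed
    have "l m v = l m w" if "m < card B" for m using that vw lE by simp
    then have "representation B v x = representation B w x" if "x \<in> B" for x
      using b that unfolding l_def bij_betw_def by (metis imageE lessThan_iff)
    moreover have "(\<Sum>x\<in>B. kscale (act I) (representation B u x) x) = u" if "u \<in> Carrier I" for u
      using sum_representation_eq[OF B(2) _ finB subset_refl] that spB by simp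
    ultimately show ?thesis using vw(1,2) by (metis (no_types, lifting) sum.cong)
  qed
  define F where "F v m = (if m < card B then E m v else 0)" for v m
  define \<epsilon> where "\<epsilon> v = assemble (F v)" for v
  have comp: "component m (\<epsilon> v) = F v m" for m v
    unfolding \<epsilon>_def by (rule component_assemble, rule finite_subset[of _ "{..<card B}"]) (auto simp: F_def)
  have "kE_hom I (free_module (card B)) \<epsilon>"
    unfolding kE_hom_def
  proof (intro conjI ballI allI)
    show "\<epsilon> ` Carrier I \<subseteq> Carrier (free_module (card B) :: ('e, 'k, _) kE_module)"
      by (auto simp: free_module_def comp F_def)
    show "\<epsilon> (x + y) = \<epsilon> x + \<epsilon> y" if "x \<in> Carrier I" "y \<in> Carrier I" for x y
      by (rule component_eqI[where 'e = 'e]) (use that in \<open>simp add: comp component_add F_def E_add\<close>)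
    show "\<epsilon> (act I a x) = act (free_module (card B)) a (\<epsilon> x)" if "x \<in> Carrier I" for x a
      by (rule component_eqI[where 'e = 'e]) (use that in \<open>simp add: comp component_act F_def E_act\<close>)
  qed
  moreover have "inj_on \<epsilon> (Carrier I)"
  proof (rule inj_onI)
    fix v w assume vw: "v \<in> Carrier I" "w \<in> Carrier I" "\<epsilon> v = \<epsilon> w"
    then have "F v m = F w m" for m using comp by metis
    then have "E m v = E m w" if "m < card B" for m using that F_def by metis
    then show "v = w" using E_inj vw by blast
  qed
  ultimately show ?thesis by (rule that)
qed

text \<open>Used to replace a module on an arbitrary type by an isomorphic copy on the type of test
  modules.\<close>

lemma kE_hom_image_fd:
  assumes I: "fd_module I" and J: "kE_mod J" and f: "kE_hom I J f"
  shows "fd_module (J\<lparr>Carrier := f ` Carrier I\<rparr>)"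
proof -
  note I' = fd_module_kE_mod[OF I]
  have f': "khom I J {} f" using f by (rule kE_hom_khom) simp
  interpret J: module "act J" using J by (rule kE_mod_module)
  interpret vector_space_pair "kscale (act I)" "kscale (act J)"
    using I' J by (simp add: vector_space_pair_def kE_mod_vector_space)
  have fa: "f (act I a x) = act J a (f x)" "f (x + y) = f x + f y" if "x \<in> Carrier I" "y \<in> Carrier I" for a x y
    using f that by (auto simp: kE_hom_def)
  have sub: "J.subspace (f ` Carrier I)"
  proof (rule J.subspaceI)
    show "0 \<in> f ` Carrier I" using khom_zero[OF f' I'] kE_mod_0[OF I'] by (metis image_eqI)
    show "x + y \<in> f ` Carrier I" if "x \<in> f ` Carrier I" "y \<in> f ` Carrier I" for x y
      using that fa(2) kE_mod_add[OF I'] by (auto simp flip: fa(2))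
    show "act J c x \<in> f ` Carrier I" if "x \<in> f ` Carrier I" for c x
      using that kE_mod_act[OF I'] by (auto simp flip: fa(1))
  qed
  obtain B where B: "finite B" "Carrier I = vs1.span B" using I by (auto simp: fd_module_def)
  obtain g where g: "Vector_Spaces.linear (kscale (act I)) (kscale (act J)) g"
    "\<And>s. s \<in> Carrier I \<Longrightarrow> g s = f s"
    using khom_linear_extend[OF I' J f'] by blast
  interpret g: Vector_Spaces.linear "kscale (act I)" "kscale (act J)" g by (rule g)
  have "f ` Carrier I = g ` Carrier I" using g(2) by (intro image_cong) auto
  also have "\<dots> = vs2.span (g ` B)" using g.span_image B(2) by metis
  finally show ?thesis
    using sub B(1) J unfolding fd_module_def by (auto simp: kE_mod_def)
qed

text \<open>An injective module is a direct summand of a free one, and Higman's criterion passes to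
  summands by naturality of the trace.\<close>

lemma (in rad_complement) injective_higman:
  fixes I :: "('e, 'k, 'v::ab_group_add) kE_module"
  assumes inj: "injective I" and xs: "kbasis V xs"
  shows "higman I xs"
proof -
  have fdI: "fd_module I" using inj by (simp add: injective_def)
  note I = fd_module_kE_mod[OF fdI]
  obtain r \<epsilon> where \<epsilon>: "kE_hom I (free_module r) \<epsilon>" "inj_on \<epsilon> (Carrier I)"
    using embed_free[OF fdI] by blast
  let ?J = "free_module r :: ('e, 'k, nat \<Rightarrow>\<^sub>0 'k) kE_module"
  note J = kE_mod_free[of r, where 'e = 'e and 'k = 'k]
  \<comment> \<open>The test module is the image of \<open>I\<close> in the free module. Extending
    the inverse of \<open>\<epsilon>\<close> from it to \<open>?J\<close> gives the retraction
    \<open>\<rho>\<close>.\<close>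
  let ?K = "?J\<lparr>Carrier := \<epsilon> ` Carrier I\<rparr>"
  let ?f = "the_inv_into (Carrier I) \<epsilon>"
  have f\<epsilon>: "?f (\<epsilon> v) = v" if "v \<in> Carrier I" for v using \<epsilon>(2) that by (rule the_inv_into_f_f)
  have K: "kE_hom ?K ?J (\<lambda>x. x)" using \<epsilon>(1) by (auto simp: kE_hom_def)
  have f: "kE_hom ?K I ?f"
    unfolding kE_hom_def
  proof (intro conjI ballI allI)
    show "?f ` Carrier ?K \<subseteq> Carrier I" using f\<epsilon> by auto
    fix x assume "x \<in> Carrier ?K"
    then obtain v where v: "v \<in> Carrier I" "x = \<epsilon> v" by auto
    show "?f (act ?K a x) = act I a (?f x)" for a
      using \<epsilon>(1) v f\<epsilon>[OF kE_mod_act[OF I v(1), of a]] f\<epsilon>[OF v(1)] by (simp add: kE_hom_def)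
    fix y assume "y \<in> Carrier ?K"
    then obtain w where w: "w \<in> Carrier I" "y = \<epsilon> w" by auto
    show "?f (x + y) = ?f x + ?f y"
      using \<epsilon>(1) v w f\<epsilon>[OF kE_mod_add[OF I v(1) w(1)]] f\<epsilon>[OF v(1)] f\<epsilon>[OF w(1)] by (simp add: kE_hom_def)
  qed
  have extension: "\<exists>h. kE_hom B I h \<and> (\<forall>x\<in>Carrier A. h (g x) = f x)"
    if "fd_module A" "fd_module B" "kE_hom A B g" "inj_on g (Carrier A)" "kE_hom A I f"
    for A B :: "('e, 'k, nat \<Rightarrow>\<^sub>0 'k) kE_module" and g f
    using inj that unfolding injective_def by blast
  obtain \<rho> where \<rho>: "kE_hom ?J I \<rho>" "\<And>x. x \<in> Carrier ?K \<Longrightarrow> \<rho> x = ?f x"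
    using extension[OF kE_hom_image_fd[OF fdI J \<epsilon>(1)] fd_free K _ f] by auto
  have \<rho>\<epsilon>: "\<rho> (\<epsilon> v) = v" if "v \<in> Carrier I" for v using \<rho>(2) f\<epsilon> that by simp
  obtain h where h: "khom ?J ?J {} h" "\<And>f. f \<in> Carrier ?J \<Longrightarrow> tr ?J ?J (zip xs xs) h f = f"
    using free_higman[OF regular_higman[OF xs]] unfolding higman_def by blast
  have Id: "set (zip xs xs) \<subseteq> Id" by (auto simp: set_zip_same)
  have \<epsilon>k: "khom I ?J (set (zip xs xs)) \<epsilon>" and \<rho>k: "khom ?J I (set (zip xs xs)) \<rho>"
    using kE_hom_khom[OF \<epsilon>(1) Id] kE_hom_khom[OF \<rho>(1) Id] .
  have h\<epsilon>: "khom I ?J {} (h \<circ> \<epsilon>)" using \<epsilon>k h(1) by (rule khom_compose) simp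
  have "tr I I (zip xs xs) (\<rho> \<circ> (h \<circ> \<epsilon>)) v = v" if v: "v \<in> Carrier I" for v
  proof -
    have "tr I I (zip xs xs) (\<rho> \<circ> (h \<circ> \<epsilon>)) v = \<rho> (tr I ?J (zip xs xs) (h \<circ> \<epsilon>) v)"
      by (rule tr_comp_left[symmetric, OF I J I \<rho>k h\<epsilon> _ _ v]) simp_all
    also have "tr I ?J (zip xs xs) (h \<circ> \<epsilon>) v = tr ?J ?J (zip xs xs) h (\<epsilon> v)"
      by (rule tr_comp_right[symmetric, OF I J \<epsilon>k _ _ v]) simp_all
    also have "\<rho> \<dots> = v" using h(2) khom_in[OF \<epsilon>k v] \<rho>\<epsilon> v by simp
    finally show ?thesis .
  qed
  moreover have "khom I I {} (\<rho> \<circ> (h \<circ> \<epsilon>))" using h\<epsilon> \<rho>k by (rule khom_compose) simp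
  ultimately show ?thesis unfolding higman_def by blast
qed


section \<open>Semilinear maps between the modules \<open>\<Omega>\<^sup>-\<^sup>s(k)\<close>\<close>

lemma kE_hom_ideal_act:
  assumes f: "kE_hom M N f" and M: "kE_mod M" and N: "kE_mod N" and v: "v \<in> ideal_act X M"
  shows "f v \<in> ideal_act X N"
proof -
  interpret module "act M" using M by (rule kE_mod_module)
  have fk: "khom M N Id f" using f by (rule kE_hom_khom) simp
  have car: "act M a x \<in> Carrier M" if "x \<in> Carrier M" for a x using that M by (rule kE_mod_act[rotated])
  from v have "v \<in> Carrier M \<and> f v \<in> ideal_act X N" unfolding ideal_act_def[of X M]
  proof (induction rule: span_induct_alt)
    case base
    then show ?case using khom_zero[OF fk M] by (simp add: ideal_act_0[OF N] kE_mod_0[OF M])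
  next
    case (step c x y)
    then obtain u v where u: "x = act M u v" "u \<in> X" "v \<in> Carrier M" by auto
    have "y \<in> Carrier M" using step(2) by simp
    then have "f (act M c x + y) = act N c (act N u (f v)) + f y"
      using u car by (simp only: khom_add[OF fk] khom_act[OF fk IdI])
    then show ?case using step u khom_in[OF fk u(3)] car
      by (simp add: ideal_act_add[OF N] ideal_act_scale[OF N] ideal_act_base[OF N] kE_mod_add[OF M])
  qed
  then show ?thesis by simp
qed

lemma set_zip_replicate: "set (zip (replicate (length ys) c) ys) = {c} \<times> set ys"
  by (induction ys) auto

section \<open>Relative injectivity, norms and socles from Higman's criterion\<close>

context rad_complement begin

text \<open>Extend \<open>\<phi>\<close> k-linearly, compose with \<open>h\<close> and average. On
  the image of \<open>\<iota>\<close>, naturality turns the average into the trace of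
  \<open>h\<close> after \<open>\<phi>\<close>, which is \<open>\<phi>\<close>. The entries of
  \<open>xs\<close> need only have p-th power zero: a second basis gives twists, and zeros give
  inflation.\<close>

lemma higman_extend:
  fixes X :: "('e, 'k, 'x::ab_group_add) kE_module"
  assumes W: "kE_mod W" and J: "kE_mod J" and X: "kE_mod X" and hig: "higman X ys"
    and len: "length xs = length ys"
    and pow: "\<And>x. x \<in> set xs \<Longrightarrow> x ^ CHAR('k) = 0" "\<And>y. y \<in> set ys \<Longrightarrow> y ^ CHAR('k) = 0"
    and i: "kE_hom W J \<iota>" "inj_on \<iota> (Carrier W)" and \<phi>: "khom W X (set (zip xs ys)) \<phi>"
  obtains \<Phi> where "khom J X (set (zip xs ys)) \<Phi>" "\<And>w. w \<in> Carrier W \<Longrightarrow> \<Phi> (\<iota> w) = \<phi> w"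
proof -
  interpret vector_space "kscale (act J)" using J by (rule kE_mod_vector_space)
  have \<iota>: "khom W J (set (zip xs xs)) \<iota>" using i(1) by (rule kE_hom_khom) (auto simp: set_zip_same)
  let ?g = "\<lambda>s. \<phi> (the_inv_into (Carrier W) \<iota> s)"
  have g: "?g (\<iota> w) = \<phi> w" if "w \<in> Carrier W" for w using the_inv_into_f_f[OF i(2) that] by simp
  have sub: "subspace (\<iota> ` Carrier W)"
  proof (rule subspaceI)
    show "0 \<in> \<iota> ` Carrier W" using khom_zero[OF \<iota> W] kE_mod_0[OF W] by (metis image_eqI)
    show "x + y \<in> \<iota> ` Carrier W" if "x \<in> \<iota> ` Carrier W" "y \<in> \<iota> ` Carrier W" for x y
      using that kE_mod_add[OF W] by (auto simp flip: khom_add[OF \<iota>])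
    show "kscale (act J) c x \<in> \<iota> ` Carrier W" if "x \<in> \<iota> ` Carrier W" for c x
      using that kE_mod_act[OF W] by (auto simp: kscale_def simp flip: khom_scalar[OF \<iota>])
  qed
  obtain f where f: "khom J X {} f" "\<And>s. s \<in> \<iota> ` Carrier W \<Longrightarrow> f s = ?g s"
  proof (rule khom_extend[OF J X sub, of ?g])
    fix s assume "s \<in> \<iota> ` Carrier W"
    then obtain w where w: "w \<in> Carrier W" "s = \<iota> w" by auto
    show "?g s \<in> Carrier X" using w g khom_in[OF \<phi>] by simp
    show "?g (kscale (act J) c s) = kscale (act X) c (?g s)" for c
      using w g kE_mod_act[OF W w(1)] khom_scalar[OF \<phi>] by (simp add: kscale_def flip: khom_scalar[OF \<iota>])
    fix s' assume "s' \<in> \<iota> ` Carrier W"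
    then obtain w' where w': "w' \<in> Carrier W" "s' = \<iota> w'" by auto
    show "?g (s + s') = ?g s + ?g s'"
      using w w' g kE_mod_add[OF W w(1) w'(1)] khom_add[OF \<phi>] by (simp flip: khom_add[OF \<iota>])
  qed (use that in blast)
  obtain h where h: "khom X X {} h" "\<And>v. v \<in> Carrier X \<Longrightarrow> tr X X (zip ys ys) h v = v"
    using hig unfolding higman_def by blast
  have hf: "khom J X {} (h \<circ> f)" using f(1) h(1) by (rule khom_compose) simp
  have "khom J X ({} \<union> set (zip xs ys)) (tr J X (zip xs ys) (h \<circ> f))"
    by (rule tr_khom[OF J X hf p_pos]) (use pow in \<open>auto dest: set_zip_leftD set_zip_rightD\<close>)
  moreover have "tr J X (zip xs ys) (h \<circ> f) (\<iota> w) = \<phi> w" if w: "w \<in> Carrier W" for w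
  proof -
    have "tr J X (zip xs ys) (h \<circ> f) (\<iota> w) = tr W X (zip xs ys) (h \<circ> f \<circ> \<iota>) w"
      by (rule tr_comp_right[OF W J \<iota> _ _ w]) (simp_all add: len)
    also have "\<dots> = tr W X (zip xs ys) (h \<circ> \<phi>) w"
      by (rule tr_cong[OF W _ w]) (simp add: f(2) g)
    also have "\<dots> = tr X X (zip ys ys) h (\<phi> w)"
      by (rule tr_comp_right[symmetric, OF W X \<phi> _ _ w]) (simp_all add: len)
    also have "\<dots> = \<phi> w" using h(2) khom_in[OF \<phi> w] by simp
    finally show ?thesis .
  qed
  ultimately show ?thesis using that by simp
qed

text \<open>Transitivity of the trace: the trace over \<open>us @ vs\<close> is the trace over
  \<open>us\<close> of the trace over \<open>vs\<close>. This is restriction of injectivity to the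
  subalgebra generated by \<open>us\<close>.\<close>

lemma higman_prefix:
  fixes M :: "('e, 'k, 'v::ab_group_add) kE_module"
  assumes M: "kE_mod M" and hig: "higman M (us @ vs)" and vs: "\<And>x. x \<in> set vs \<Longrightarrow> x ^ CHAR('k) = 0"
  shows "higman M us"
proof -
  obtain h where h: "khom M M {} h" "\<And>v. v \<in> Carrier M \<Longrightarrow> tr M M (zip (us @ vs) (us @ vs)) h v = v"
    using hig unfolding higman_def by blast
  have "khom M M ({} \<union> set (zip vs vs)) (tr M M (zip vs vs) h)"
    by (rule tr_khom[OF M M h(1) p_pos]) (use vs in \<open>auto simp: set_zip_same\<close>)
  then have "khom M M {} (tr M M (zip vs vs) h)" by (rule khom_subset) simp
  then show ?thesis using h(2) unfolding higman_def by (auto simp: tr_append)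
qed

text \<open>The identity is the trace of \<open>h\<close>. By \<open>tr_socle\<close> it is the norm
  after \<open>h\<close> on vectors annihilated by \<open>us\<close>, and by
  \<open>tr_mod_ideal\<close> it is \<open>h\<close> after the norm modulo the ideal of
  \<open>us\<close>.\<close>

lemma
  fixes M :: "('e, 'k, 'v::ab_group_add) kE_module"
  assumes M: "kE_mod M" and hig: "higman M us" and y: "y \<in> Carrier M"
  shows higman_socle: "(\<And>u. u \<in> set us \<Longrightarrow> act M u y = 0) \<Longrightarrow>
      \<exists>z\<in>Carrier M. y = act M (\<Prod>u\<leftarrow>us. u ^ (CHAR('k) - 1)) z"
    and higman_norm_kernel: "act M (\<Prod>u\<leftarrow>us. u ^ (CHAR('k) - 1)) y = 0 \<Longrightarrow> y \<in> ideal_act (set us) M"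
proof -
  obtain h where h: "khom M M {} h" "\<And>v. v \<in> Carrier M \<Longrightarrow> tr M M (zip us us) h v = v"
    using hig unfolding higman_def by blast
  show "\<exists>z\<in>Carrier M. y = act M (\<Prod>u\<leftarrow>us. u ^ (CHAR('k) - 1)) z"
    if "\<And>u. u \<in> set us \<Longrightarrow> act M u y = 0"
  proof -
    have "tr M M (zip us us) h y = act M (\<Prod>z\<leftarrow>zip us us. snd z ^ (CHAR('k) - 1)) (h y)"
      by (rule tr_socle[OF M M h(1) p_pos y]) (use that in \<open>auto simp: set_zip_same\<close>)
    then show ?thesis using h(2)[OF y] khom_in[OF h(1) y]
      by (metis prod_list_zip_snd[where f = "\<lambda>x. x ^ (CHAR('k) - 1)"])
  qed
  show "y \<in> ideal_act (set us) M" if "act M (\<Prod>u\<leftarrow>us. u ^ (CHAR('k) - 1)) y = 0"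
  proof -
    have "tr M M (zip us us) h y - h (act M (\<Prod>z\<leftarrow>zip us us. fst z ^ (CHAR('k) - 1)) y)
        \<in> ideal_act (snd ` set (zip us us)) M"
      by (rule tr_mod_ideal[OF M M h(1) p_pos y])
    moreover have "snd ` set (zip us us) = set us" by (force simp: set_zip_same Id_on_def)
    moreover have "(\<Prod>z\<leftarrow>zip us us. fst z ^ (CHAR('k) - 1)) = (\<Prod>u\<leftarrow>us. u ^ (CHAR('k) - 1))"
      by (rule prod_list_zip_fst) simp
    ultimately show ?thesis using h(2)[OF y] khom_zero[OF h(1) M] that by simp
  qed
qed

lemma norm_mult_zero:
  assumes "set us \<subseteq> V" "u \<in> set us"
  shows "u * (\<Prod>u\<leftarrow>us. u ^ (CHAR('k) - 1)) = 0"
  using assms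
proof (induction us)
  case (Cons x us)
  show ?case
  proof (cases "u = x")
    case True
    then have "u * u ^ (CHAR('k) - 1) = 0"
      using V_power_p[of u] p_pos Cons.prems(1) by (simp flip: power_Suc)
    then show ?thesis using True by (simp flip: mult.assoc)
  next
    case False
    then have "u * (\<Prod>u\<leftarrow>us. u ^ (CHAR('k) - 1)) = 0" using Cons by auto
    moreover have "u * (x ^ (CHAR('k) - 1) * (\<Prod>u\<leftarrow>us. u ^ (CHAR('k) - 1)))
      = x ^ (CHAR('k) - 1) * (u * (\<Prod>u\<leftarrow>us. u ^ (CHAR('k) - 1)))" by (rule mult.left_commute)
    ultimately show ?thesis by simp
  qed
qed simp

lemma Omega_inv_0_trivial:
  fixes W0 :: "('e, 'k, 'w::ab_group_add) kE_module"
  assumes iso: "kE_iso trivial_module W0 \<theta>" and v: "v \<in> V" and w: "w \<in> Carrier W0"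
  shows "act W0 v w = 0"
proof -
  obtain c where c: "w = \<theta> c" using w iso unfolding kE_iso_def bij_betw_def by auto
  have "act W0 v w = \<theta> (aug v * c)"
    using iso c unfolding kE_iso_def kE_hom_def by (simp add: trivial_module_def aug_def)
  also have "\<dots> = \<theta> 0" using V_aug[OF v] by simp
  also have "\<dots> = 0"
    using iso khom_add[of trivial_module W0 "{}" \<theta> 0 0] kE_hom_khom[of trivial_module W0 \<theta> "{}"]
    unfolding kE_iso_def by (simp add: trivial_module_def)
  finally show ?thesis .
qed

text \<open>
  Sending the basis of a complement of \<open>U\<close> to zero is a retraction of \<open>kE\<close> onto the subalgebra
  generated by \<open>U\<close>. The maps \<open>\<phi>\<close> are semilinear over it and lift the identity of \<open>k\<close>, so over the
  subalgebra they differ from the identity by maps \<open>\<beta> \<circ> \<iota>\<close> that factor through an injective module.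
\<close>

lemma inflation_maps:
  fixes W :: "nat \<Rightarrow> ('e, 'k, 'w::ab_group_add) kE_module" and I :: "nat \<Rightarrow> ('e, 'k, 'i::ab_group_add) kE_module"
  assumes om: "iterated_Omega_inv T trivial_module W I \<theta> \<iota> \<pi>" and basis: "kbasis V (us @ vs)"
    and s: "s < T"
  obtains \<phi> \<beta> where "khom (W s) (W s) (set (zip us us) \<union> {0} \<times> set vs) \<phi>"
    "khom (I s) (W s) (set (zip us us)) \<beta>" "\<And>w. w \<in> Carrier (W s) \<Longrightarrow> w - \<phi> w = \<beta> (\<iota> s w)"
proof -
  \<comment> \<open>Each vector y of \<open>vs\<close> is paired with 0: semilinearity for
    \<open>(0, y)\<close> says that y annihilates the values of the map.\<close>
  let ?xs = "us @ replicate (length vs) 0"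
  let ?ys = "us @ vs"
  let ?Z = "set (zip ?xs ?ys)"
  let ?D = "set (zip us us)"
  have Z: "?Z = ?D \<union> {0} \<times> set vs"
    by (simp add: zip_append set_zip_replicate)
  have xs_pow: "x ^ CHAR('k) = 0" if "x \<in> set ?xs" for x
    using that kbasis_power_p[OF basis] p_pos by (auto simp: power_0_left)
  note ys_pow = kbasis_power_p[OF basis]
  have us_pow: "x ^ CHAR('k) = 0" if "x \<in> set us" for x using that ys_pow by simp
  have st: "injective_hull (W j) (I j) (\<iota> j)" "short_exact (W j) (I j) (W (Suc j)) (\<iota> j) (\<pi> j)" if "j < T" for j
    using om that unfolding iterated_Omega_inv_def by auto
  have iso: "kE_iso trivial_module (W 0) \<theta>" using om unfolding iterated_Omega_inv_def by auto
  have "\<exists>\<phi> \<beta>. khom (W s) (W s) ?Z \<phi> \<and> khom (I s) (W s) ?D \<beta> \<and> (\<forall>w\<in>Carrier (W s). w - \<phi> w = \<beta> (\<iota> s w))"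
    using s
  proof (induction s)
    case 0
    have "short_exact (W 0) (I 0) (W (Suc 0)) (\<iota> 0) (\<pi> 0)" using st 0 by blast
    then have W0: "kE_mod (W 0)" unfolding short_exact_def by (auto intro: fd_module_kE_mod)
    note triv = Omega_inv_0_trivial[OF iso]
    \<comment> \<open>V acts as zero on \<open>W 0\<close>, so the identity is semilinear for every
      pair here, and \<open>\<beta> = 0\<close> starts the induction.\<close>
    have "khom (W 0) (W 0) ?Z (\<lambda>w. w)"
      unfolding Z by (rule khomI)
        (use triv kbasis_subset[OF basis] in \<open>auto simp: set_zip_same act_zero[OF W0]\<close>)
    moreover have "khom (I 0) (W 0) ?D (\<lambda>y. 0)"
      by (rule khomI) (auto simp: kE_mod_0[OF W0] act_zero_right[OF W0])
    ultimately show ?case by (intro exI[of _ "\<lambda>w. w"] exI[of _ "\<lambda>y. 0"]) auto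
  next
    case (Suc s)
    then have sT: "s < T" by simp
    obtain \<phi> \<beta> where \<phi>: "khom (W s) (W s) ?Z \<phi>" and \<beta>: "khom (I s) (W s) ?D \<beta>"
      and eq: "\<And>w. w \<in> Carrier (W s) \<Longrightarrow> w - \<phi> w = \<beta> (\<iota> s w)"
      using Suc.IH[OF sT] by blast
    have se: "short_exact (W s) (I s) (W (Suc s)) (\<iota> s) (\<pi> s)" using st sT by blast
    have se': "short_exact (W (Suc s)) (I (Suc s)) (W (Suc (Suc s))) (\<iota> (Suc s)) (\<pi> (Suc s))"
      using st Suc.prems by blast
    have W: "kE_mod (W s)" and I: "kE_mod (I s)" and W': "kE_mod (W (Suc s))" and I': "kE_mod (I (Suc s))"
      using se se' unfolding short_exact_def by (auto intro: fd_module_kE_mod)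
    have \<iota>: "kE_hom (W s) (I s) (\<iota> s)" "inj_on (\<iota> s) (Carrier (W s))"
      and \<pi>: "kE_hom (I s) (W (Suc s)) (\<pi> s)" "\<pi> s ` Carrier (I s) = Carrier (W (Suc s))"
      and ker: "{x \<in> Carrier (I s). \<pi> s x = 0} = \<iota> s ` Carrier (W s)"
      and \<iota>': "kE_hom (W (Suc s)) (I (Suc s)) (\<iota> (Suc s))" "inj_on (\<iota> (Suc s)) (Carrier (W (Suc s)))"
      using se se' unfolding short_exact_def by auto
    have inj: "injective (I s)" using st(1)[OF sT] by (simp add: injective_hull_def)
    have hig: "higman (I s) ?ys" by (rule injective_higman[OF inj basis])
    have hig_us: "higman (I s) us" by (rule higman_prefix[OF I hig]) (use ys_pow in simp)
    have dD: "?D \<subseteq> ?Z" "?D \<subseteq> Id" unfolding Z by (auto simp: set_zip_same)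
    have \<iota>d: "khom (W s) (I s) Id (\<iota> s)" and \<pi>d: "khom (I s) (W (Suc s)) Id (\<pi> s)"
      using kE_hom_khom[OF \<iota>(1)] kE_hom_khom[OF \<pi>(1)] by auto
    have \<iota>\<phi>: "khom (W s) (I s) ?Z (\<iota> s \<circ> \<phi>)" using \<phi> \<iota>d by (rule khom_compose) auto
    obtain \<Phi> where \<Phi>: "khom (I s) (I s) ?Z \<Phi>" "\<And>w. w \<in> Carrier (W s) \<Longrightarrow> \<Phi> (\<iota> s w) = (\<iota> s \<circ> \<phi>) w"
      by (rule higman_extend[OF W I I hig _ xs_pow ys_pow \<iota> \<iota>\<phi>]) auto
    have \<pi>\<Phi>: "khom (I s) (W (Suc s)) ?Z (\<pi> s \<circ> \<Phi>)" using \<Phi>(1) \<pi>d by (rule khom_compose) auto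
    have \<pi>\<iota>: "\<pi> s (\<iota> s w) = 0" if "w \<in> Carrier (W s)" for w using ker that by auto
    obtain \<phi>' where \<phi>': "khom (W (Suc s)) (W (Suc s)) ?Z \<phi>'" "\<And>y. y \<in> Carrier (I s) \<Longrightarrow> \<phi>' (\<pi> s y) = (\<pi> s \<circ> \<Phi>) y"
    proof (rule khom_factor[OF I \<pi>\<Phi> \<pi>d \<pi>(2)])
      fix y assume "y \<in> Carrier (I s)" "\<pi> s y = 0"
      then obtain w where "w \<in> Carrier (W s)" "y = \<iota> s w" using ker by auto
      then show "(\<pi> s \<circ> \<Phi>) y = 0" using \<Phi>(2) \<pi>\<iota> khom_in[OF \<phi>] by simp
    qed auto
    have \<iota>\<beta>: "khom (I s) (I s) ?D (\<iota> s \<circ> \<beta>)" using \<beta> \<iota>d by (rule khom_compose) (use dD in auto)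
    have idk: "khom (I s) (I s) ?D (\<lambda>y. y)" by (rule khomI) (auto simp: set_zip_same)
    \<comment> \<open>On \<open>\<iota> s w\<close> this map is \<open>\<iota> s (w - \<phi> w) -
      \<iota> s (\<beta> (\<iota> s w)) = 0\<close>, so it factors through \<open>\<pi> s\<close>.
      The correction by \<open>\<iota> s \<circ> \<beta>\<close> disappears after composition with
      \<open>\<pi> s\<close>.\<close>
    have \<Delta>: "khom (I s) (I s) ?D (\<lambda>y. (y - \<Phi> y) - (\<iota> s \<circ> \<beta>) y)"
      by (intro khom_minus_fun idk khom_subset[OF \<Phi>(1) dD(1)] \<iota>\<beta> I)
    obtain \<gamma> where \<gamma>: "khom (W (Suc s)) (I s) ?D \<gamma>"
      "\<And>y. y \<in> Carrier (I s) \<Longrightarrow> \<gamma> (\<pi> s y) = (y - \<Phi> y) - (\<iota> s \<circ> \<beta>) y"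
    proof (rule khom_factor[OF I \<Delta> \<pi>d \<pi>(2)])
      fix y assume "y \<in> Carrier (I s)" "\<pi> s y = 0"
      then obtain w where w: "w \<in> Carrier (W s)" "y = \<iota> s w" using ker by auto
      then have "(y - \<Phi> y) - (\<iota> s \<circ> \<beta>) y = \<iota> s (w - \<phi> w) - \<iota> s (\<beta> (\<iota> s w))"
        using \<Phi>(2) khom_diff[OF \<iota>d W _ khom_in[OF \<phi>]] by simp
      then show "(y - \<Phi> y) - (\<iota> s \<circ> \<beta>) y = 0" using eq w by simp
    qed auto
    \<comment> \<open>\<open>I s\<close> is injective over the subalgebra generated by
      \<open>us\<close>, so \<open>\<gamma>\<close> extends along the next embedding. Composed with
      \<open>\<pi> s\<close> it is the next \<open>\<beta>\<close>.\<close>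
    obtain \<gamma>' where \<gamma>': "khom (I (Suc s)) (I s) ?D \<gamma>'"
      "\<And>w. w \<in> Carrier (W (Suc s)) \<Longrightarrow> \<gamma>' (\<iota> (Suc s) w) = \<gamma> w"
      by (rule higman_extend[OF W' I' I hig_us _ us_pow us_pow \<iota>' \<gamma>(1)]) auto
    have \<pi>\<gamma>: "khom (I (Suc s)) (W (Suc s)) ?D (\<pi> s \<circ> \<gamma>')"
      using \<gamma>'(1) \<pi>d by (rule khom_compose) (use dD in auto)
    have "w - \<phi>' w = (\<pi> s \<circ> \<gamma>') (\<iota> (Suc s) w)" if w: "w \<in> Carrier (W (Suc s))" for w
    proof -
      obtain y where y: "y \<in> Carrier (I s)" "w = \<pi> s y" using w \<pi>(2) by auto
      note mem = khom_in[OF \<Phi>(1) y(1)] khom_in[OF \<beta> y(1)] khom_in[OF \<iota>d khom_in[OF \<beta> y(1)]]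
      have "(\<pi> s \<circ> \<gamma>') (\<iota> (Suc s) w) = \<pi> s ((y - \<Phi> y) - \<iota> s (\<beta> y))"
        using \<gamma>'(2)[OF w] \<gamma>(2)[OF y(1)] y(2) by simp
      also have "\<dots> = \<pi> s y - \<pi> s (\<Phi> y)"
        using mem y(1) \<pi>\<iota> by (simp add: khom_diff[OF \<pi>d I] kE_mod_diff[OF I])
      also have "\<dots> = w - \<phi>' w" using \<phi>'(2)[OF y(1)] y(2) by simp
      finally show ?thesis by simp
    qed
    then show ?case using \<phi>'(1) \<pi>\<gamma> by blast
  qed
  then show ?thesis using that unfolding Z by blast
qed

text \<open>
  This is the surjectivity of restriction to the subalgebra generated by \<open>us\<close> on cohomology of
  degree \<open>s \<ge> 0\<close>.
\<close>

lemma socle_restriction: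
  fixes W :: "nat \<Rightarrow> ('e, 'k, 'w::ab_group_add) kE_module" and I :: "nat \<Rightarrow> ('e, 'k, 'i::ab_group_add) kE_module"
  assumes om: "iterated_Omega_inv T trivial_module W I \<theta> \<iota> \<pi>" and basis: "kbasis V (us @ vs)"
    and s: "s < T" and w: "w \<in> Carrier (W s)" "\<And>u. u \<in> set us \<Longrightarrow> act (W s) u w = 0"
  obtains w0 w1 where "w0 \<in> Carrier (W s)" "w1 \<in> Carrier (W s)"
    "\<And>x. x \<in> set (us @ vs) \<Longrightarrow> act (W s) x w0 = 0"
    "w = w0 + act (W s) (\<Prod>u\<leftarrow>us. u ^ (CHAR('k) - 1)) w1"
proof -
  obtain \<phi> \<beta> where \<phi>: "khom (W s) (W s) (set (zip us us) \<union> {0} \<times> set vs) \<phi>"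
    and \<beta>: "khom (I s) (W s) (set (zip us us)) \<beta>"
    and eq: "\<And>w. w \<in> Carrier (W s) \<Longrightarrow> w - \<phi> w = \<beta> (\<iota> s w)"
    by (rule inflation_maps[OF om basis s]) blast
  have st: "injective_hull (W s) (I s) (\<iota> s)" "short_exact (W s) (I s) (W (Suc s)) (\<iota> s) (\<pi> s)"
    using om s unfolding iterated_Omega_inv_def by auto
  have W: "kE_mod (W s)" and I: "kE_mod (I s)" and \<iota>: "kE_hom (W s) (I s) (\<iota> s)"
    using st unfolding short_exact_def by (auto intro: fd_module_kE_mod)
  have \<iota>d: "khom (W s) (I s) Id (\<iota> s)" using kE_hom_khom[OF \<iota>] by auto
  have hig: "higman (I s) (us @ vs)"
    using injective_higman[OF _ basis] st(1) by (auto simp: injective_hull_def)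
  have hig_us: "higman (I s) us"
    by (rule higman_prefix[OF I hig]) (use kbasis_power_p[OF basis] in simp)
  have "act (I s) u (\<iota> s w) = 0" if "u \<in> set us" for u
    using khom_act[OF \<iota>d, of u u w] w that khom_zero[OF \<iota>d W] by simp
  then obtain y where y: "y \<in> Carrier (I s)" "\<iota> s w = act (I s) (\<Prod>u\<leftarrow>us. u ^ (CHAR('k) - 1)) y"
    using higman_socle[OF I hig_us khom_in[OF \<iota>d w(1)]] by blast
  have "\<beta> (\<iota> s w) = act (W s) (\<Prod>u\<leftarrow>us. u ^ (CHAR('k) - 1)) (\<beta> y)"
    unfolding y(2) by (rule khom_prod_list[OF \<beta> I W _ y(1)]) simp
  \<comment> \<open>Here \<open>\<phi> w\<close> is the part annihilated by V: \<open>\<phi>\<close>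
    commutes with \<open>us\<close>, which annihilate \<open>w\<close>, and \<open>vs\<close>
    annihilate all its values.\<close>
  then have "w = \<phi> w + act (W s) (\<Prod>u\<leftarrow>us. u ^ (CHAR('k) - 1)) (\<beta> y)"
    using eq[OF w(1)] by (simp add: algebra_simps)
  moreover have "act (W s) x (\<phi> w) = 0" if "x \<in> set (us @ vs)" for x
  proof (cases "x \<in> set us")
    case True
    then have "act (W s) x (\<phi> w) = \<phi> (act (W s) x w)"
      using khom_act[OF \<phi>, of x x w] w(1) by (simp add: set_zip_same Id_on_iff)
    then show ?thesis using w(2)[OF True] khom_zero[OF \<phi> W] by simp
  next
    case False
    then have "act (W s) x (\<phi> w) = \<phi> (act (W s) 0 w)"
      using khom_act[OF \<phi>, of 0 x w] w(1) that by simp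
    then show ?thesis using act_zero[OF W] khom_zero[OF \<phi> W] by simp
  qed
  ultimately show ?thesis using that khom_in[OF \<phi> w(1)] khom_in[OF \<beta> y(1)] by blast
qed

end


section \<open>The extension restricted to shifted subgroups\<close>

context rad_complement begin

text \<open>Write N and N' for the norms of \<open>us\<close> and \<open>vs\<close>. A lift y of w
  to \<open>I s\<close> has N y in the embedded copy of \<open>W s\<close>, annihilated by
  \<open>us\<close>. By \<open>socle_restriction\<close> this element is a multiple of N from
  \<open>W s\<close> plus an element annihilated by V; the latter is a multiple of N N' in
  \<open>I s\<close>. Correcting y accordingly makes N y zero, so the corrected lift lies in U
  \<open>I s\<close>.\<close>

lemma norm_kernel_Omega_inv:
  fixes W :: "nat \<Rightarrow> ('e, 'k, 'w::ab_group_add) kE_module" and I :: "nat \<Rightarrow> ('e, 'k, 'i::ab_group_add) kE_module"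
  assumes om: "iterated_Omega_inv T trivial_module W I \<theta> \<iota> \<pi>" and basis: "kbasis V (us @ vs)"
    and vs: "vs \<noteq> []" and s: "s < T"
    and w: "w \<in> Carrier (W (Suc s))" "act (W (Suc s)) (\<Prod>u\<leftarrow>us. u ^ (CHAR('k) - 1)) w = 0"
  shows "w \<in> ideal_act (set (us @ vs)) (W (Suc s))"
proof -
  let ?N = "\<Prod>u\<leftarrow>us. u ^ (CHAR('k) - 1)" and ?N' = "\<Prod>u\<leftarrow>vs. u ^ (CHAR('k) - 1)"
  have st: "injective_hull (W s) (I s) (\<iota> s)" "short_exact (W s) (I s) (W (Suc s)) (\<iota> s) (\<pi> s)"
    using om s unfolding iterated_Omega_inv_def by auto
  have W: "kE_mod (W s)" and I: "kE_mod (I s)" and W': "kE_mod (W (Suc s))"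
    using st unfolding short_exact_def by (auto intro: fd_module_kE_mod)
  have \<iota>: "kE_hom (W s) (I s) (\<iota> s)" "inj_on (\<iota> s) (Carrier (W s))"
    and \<pi>: "kE_hom (I s) (W (Suc s)) (\<pi> s)" "\<pi> s ` Carrier (I s) = Carrier (W (Suc s))"
    and ker: "{x \<in> Carrier (I s). \<pi> s x = 0} = \<iota> s ` Carrier (W s)"
    using st unfolding short_exact_def by auto
  have \<iota>d: "khom (W s) (I s) Id (\<iota> s)" and \<pi>d: "khom (I s) (W (Suc s)) Id (\<pi> s)"
    using kE_hom_khom[OF \<iota>(1)] kE_hom_khom[OF \<pi>(1)] by auto
  have hig: "higman (I s) (us @ vs)"
    using injective_higman[OF _ basis] st(1) by (auto simp: injective_hull_def)
  have hig_us: "higman (I s) us"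
    by (rule higman_prefix[OF I hig]) (use kbasis_power_p[OF basis] in simp)
  have usV: "set us \<subseteq> V" using kbasis_subset[OF basis] by simp
  obtain y where y: "y \<in> Carrier (I s)" "w = \<pi> s y" using w(1) \<pi>(2) by auto
  note Ny = kE_mod_act[OF I y(1), of ?N]
  have "\<pi> s (act (I s) ?N y) = 0" using w(2) y khom_act[OF \<pi>d IdI y(1)] by simp
  then obtain w' where w': "w' \<in> Carrier (W s)" "act (I s) ?N y = \<iota> s w'" using ker Ny by blast
  have "act (W s) u w' = 0" if u: "u \<in> set us" for u
  proof -
    have "\<iota> s (act (W s) u w') = act (I s) (u * ?N) y"
      using khom_act[OF \<iota>d IdI w'(1)] w'(2) by (simp add: act_act[OF I, symmetric])
    also have "\<dots> = \<iota> s 0" using norm_mult_zero[OF usV u] khom_zero[OF \<iota>d W] by (simp add: act_zero[OF I])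
    finally show ?thesis using \<iota>(2) kE_mod_act[OF W w'(1)] kE_mod_0[OF W] by (auto dest: inj_onD)
  qed
  then obtain w0 w1 where w0: "w0 \<in> Carrier (W s)" "\<And>x. x \<in> set (us @ vs) \<Longrightarrow> act (W s) x w0 = 0"
    and w1: "w1 \<in> Carrier (W s)" and dec: "w' = w0 + act (W s) ?N w1"
    using socle_restriction[OF om basis s w'(1)] by blast
  have "act (I s) x (\<iota> s w0) = 0" if "x \<in> set (us @ vs)" for x
    using khom_act[OF \<iota>d IdI w0(1), of x] w0(2)[OF that] khom_zero[OF \<iota>d W] by simp
  then obtain z where z: "z \<in> Carrier (I s)" "\<iota> s w0 = act (I s) (\<Prod>u\<leftarrow>us @ vs. u ^ (CHAR('k) - 1)) z"
    using higman_socle[OF I hig khom_in[OF \<iota>d w0(1)]] by blast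
  note iw1 = khom_in[OF \<iota>d w1] and N'z = kE_mod_act[OF I z(1), of ?N']
  \<comment> \<open>N maps the two subtracted terms to the two parts of \<open>\<iota> s w'\<close>.
    In \<open>W (Suc s)\<close> the first vanishes and the second becomes a multiple of N'.\<close>
  let ?y = "y - \<iota> s w1 - act (I s) ?N' z"
  have y': "?y \<in> Carrier (I s)" by (intro kE_mod_diff[OF I] y iw1 N'z)
  have "\<iota> s w' = act (I s) ?N (act (I s) ?N' z) + act (I s) ?N (\<iota> s w1)"
    unfolding dec using z(2) khom_add[OF \<iota>d w0(1) kE_mod_act[OF W w1]] khom_act[OF \<iota>d IdI w1]
    by (simp add: act_act[OF I])
  then have "act (I s) ?N ?y = 0" using w'(2) by (simp add: act_diff_right[OF I])
  then have "?y \<in> ideal_act (set us) (I s)" by (rule higman_norm_kernel[OF I hig_us y'])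
  then have py: "\<pi> s ?y \<in> ideal_act (set us) (W (Suc s))" by (rule kE_hom_ideal_act[OF \<pi>(1) I W'])
  have "\<pi> s (\<iota> s w1) = 0" using ker w1 by auto
  then have "\<pi> s ?y = w - act (W (Suc s)) ?N' (\<pi> s z)"
    using y(2) khom_diff[OF \<pi>d I kE_mod_diff[OF I y(1) iw1] N'z] khom_diff[OF \<pi>d I y(1) iw1]
      khom_act[OF \<pi>d IdI z(1)] by simp
  then have eq: "w = \<pi> s ?y + act (W (Suc s)) ?N' (\<pi> s z)" by simp
  \<comment> \<open>A nonempty \<open>vs\<close> and p - 1 > 0 put a basis vector of V into N', so a
    multiple of N' lies in the radical. For empty \<open>vs\<close> the norm N' would be 1.\<close>
  obtain v vs' where vs': "vs = v # vs'" using vs by (cases vs) auto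
  have "CHAR('k) - 1 = Suc (CHAR('k) - 2)" using prime_ge_2_nat[OF prime_p] by simp
  then have "?N' = v * (v ^ (CHAR('k) - 2) * (\<Prod>u\<leftarrow>vs'. u ^ (CHAR('k) - 1)))"
    using vs' by (simp add: mult.assoc)
  then have "act (W (Suc s)) ?N' (\<pi> s z)
      = act (W (Suc s)) v (act (W (Suc s)) (v ^ (CHAR('k) - 2) * (\<Prod>u\<leftarrow>vs'. u ^ (CHAR('k) - 1))) (\<pi> s z))"
    by (simp add: act_act[OF W'])
  also have "\<dots> \<in> ideal_act (set (us @ vs)) (W (Suc s))"
    using khom_in[OF \<pi>d z(1)] vs' by (intro ideal_act_base[OF W'] kE_mod_act[OF W']) auto
  finally show ?thesis
    using py ideal_act_mono[OF W', of "set us" "set (us @ vs)"] ideal_act_add[OF W'] by (subst eq) auto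
qed

text \<open>The projection from \<open>I t\<close> lifts to a kE-linear \<open>F\<close> into
  \<open>M\<close>. If \<open>i 1\<close> were in U M, it would be \<open>F y\<close> with y in U
  \<open>I t\<close>. Then y comes from some w in \<open>W t\<close> that the norm of U annihilates,
  hence from the radical of \<open>W t\<close>, and \<open>F\<close> kills such elements because V
  acts trivially on the image of \<open>i\<close>.\<close>

lemma extension_not_in_ideal:
  fixes W :: "nat \<Rightarrow> ('e, 'k, 'w::ab_group_add) kE_module" and I :: "nat \<Rightarrow> ('e, 'k, 'i::ab_group_add) kE_module"
    and M :: "('e, 'k, 'm::ab_group_add) kE_module"
  assumes om: "iterated_Omega_inv (t + 1) trivial_module W I \<theta> \<iota> \<pi>" and t: "t > 0"
    and ext: "short_exact trivial_module M (W (t + 1)) i q"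
    and basis: "kbasis V (us @ vs)" and vs: "vs \<noteq> []"
  shows "i 1 \<notin> ideal_act (set us) M"
proof
  assume i1: "i 1 \<in> ideal_act (set us) M"
  let ?xs = "us @ vs" and ?T = "trivial_module :: ('e, 'k, 'k) kE_module"
  let ?D = "set (zip ?xs ?xs)"
  have st: "injective_hull (W t) (I t) (\<iota> t)" "short_exact (W t) (I t) (W (t + 1)) (\<iota> t) (\<pi> t)"
    using om unfolding iterated_Omega_inv_def by auto
  have W: "kE_mod (W t)" and I: "kE_mod (I t)" and W': "kE_mod (W (t + 1))" and M: "kE_mod M"
    and k: "kE_mod ?T"
    using st ext unfolding short_exact_def by (auto intro: fd_module_kE_mod)
  have \<iota>: "kE_hom (W t) (I t) (\<iota> t)" "inj_on (\<iota> t) (Carrier (W t))"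
    and \<pi>: "kE_hom (I t) (W (t + 1)) (\<pi> t)" "\<pi> t ` Carrier (I t) = Carrier (W (t + 1))"
    and ker: "{x \<in> Carrier (I t). \<pi> t x = 0} = \<iota> t ` Carrier (W t)"
    and i: "kE_hom ?T M i" "inj_on i (Carrier ?T)"
    and q: "kE_hom M (W (t + 1)) q" "q ` Carrier M = Carrier (W (t + 1))"
    and kerq: "{x \<in> Carrier M. q x = 0} = i ` Carrier ?T"
    using st ext unfolding short_exact_def by auto
  have cT: "Carrier ?T = UNIV" by (simp add: trivial_module_def)
  have ik: "khom ?T M Id i" and qk: "khom M (W (t + 1)) Id q" and \<iota>d: "khom (W t) (I t) Id (\<iota> t)"
    and \<pi>d: "khom (I t) (W (t + 1)) Id (\<pi> t)"
    using kE_hom_khom[OF i(1)] kE_hom_khom[OF q(1)] kE_hom_khom[OF \<iota>(1)] kE_hom_khom[OF \<pi>(1)] by auto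
  have V_i: "act M v (i c) = 0" if "v \<in> V" for v c
  proof -
    have "act M v (i c) = i (act ?T v c)" using khom_act[OF ik IdI, of c v] by (simp add: cT)
    also have "act ?T v c = aug v * c" by (simp add: trivial_module_def aug_def)
    finally show ?thesis using V_aug[OF that] khom_zero[OF ik k] by simp
  qed
  have xsV: "set ?xs \<subseteq> V" by (rule kbasis_subset[OF basis])
  have hig: "higman (I t) ?xs"
    using injective_higman[OF _ basis] st(1) by (auto simp: injective_hull_def)
  obtain h where h: "khom (I t) (I t) {} h" "\<And>v. v \<in> Carrier (I t) \<Longrightarrow> tr (I t) (I t) (zip ?xs ?xs) h v = v"
    using hig unfolding higman_def by blast
  obtain \<sigma> where \<sigma>: "khom (W (t + 1)) M {} \<sigma>" "\<And>w. w \<in> Carrier (W (t + 1)) \<Longrightarrow> q (\<sigma> w) = w"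
  proof -
    interpret vector_space_pair "kscale (act M)" "kscale (act (W (t + 1)))"
      using M W' by (simp add: vector_space_pair_def kE_mod_vector_space)
    obtain g where g: "Vector_Spaces.linear (kscale (act M)) (kscale (act (W (t + 1)))) g"
      "\<And>s. s \<in> Carrier M \<Longrightarrow> g s = q s"
      using khom_linear_extend[OF M W' qk] by blast
    obtain \<sigma> where \<sigma>: "range \<sigma> \<subseteq> Carrier M" "Vector_Spaces.linear (kscale (act (W (t + 1)))) (kscale (act M)) \<sigma>"
      "\<forall>x\<in>g ` Carrier M. g (\<sigma> x) = x"
      using linear_exists_right_inverse_on[OF g(1) kE_mod_kspace[OF M]] by blast
    interpret \<sigma>: Vector_Spaces.linear "kscale (act (W (t + 1)))" "kscale (act M)" \<sigma> by (rule \<sigma>(2))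
    have "khom (W (t + 1)) M {} \<sigma>"
      by (rule khomI) (use \<sigma>(1) \<sigma>.add \<sigma>.scale in \<open>auto simp: kscale_def\<close>)
    moreover have "q (\<sigma> w) = w" if "w \<in> Carrier (W (t + 1))" for w
    proof -
      have "w \<in> g ` Carrier M" using that q(2) g(2) by force
      then show ?thesis using \<sigma>(1,3) g(2) by (metis rangeI subsetD)
    qed
    ultimately show ?thesis using that by blast
  qed
  \<comment> \<open>Injective modules are projective too: for the k-linear section
    \<open>\<sigma>\<close> of \<open>q\<close>, averaging
    \<open>\<sigma> \<circ> \<pi> t \<circ> h\<close> gives a kE-linear lift of
    \<open>\<pi> t\<close> through \<open>q\<close>, because the trace of \<open>h\<close> is the
    identity.\<close>
  define F where "F = tr (I t) M (zip ?xs ?xs) (\<sigma> \<circ> \<pi> t \<circ> h)"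
  have \<pi>h: "khom (I t) (W (t + 1)) {} (\<pi> t \<circ> h)" using h(1) \<pi>d by (rule khom_compose) simp
  have \<sigma>\<pi>h: "khom (I t) M {} (\<sigma> \<circ> \<pi> t \<circ> h)"
    unfolding comp_assoc using \<pi>h \<sigma>(1) by (rule khom_compose) simp
  have "khom (I t) M ({} \<union> ?D) F"
    unfolding F_def
    by (rule tr_khom[OF I M \<sigma>\<pi>h p_pos]) (use kbasis_power_p[OF basis] in \<open>auto simp: set_zip_same\<close>)
  then have F: "kE_hom (I t) M F" using khom_kE_hom[OF basis _ I M] by simp
  have Fk: "khom (I t) M Id F" using kE_hom_khom[OF F] by simp
  have D: "?D \<subseteq> Id" by (auto simp: set_zip_same)
  have qF: "q (F y) = \<pi> t y" if y: "y \<in> Carrier (I t)" for y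
  proof -
    have "q (F y) = tr (I t) (W (t + 1)) (zip ?xs ?xs) (q \<circ> (\<sigma> \<circ> \<pi> t \<circ> h)) y"
      unfolding F_def by (rule tr_comp_left[OF I M W' khom_subset[OF qk D] \<sigma>\<pi>h _ _ y]) simp_all
    also have "\<dots> = tr (I t) (W (t + 1)) (zip ?xs ?xs) (\<pi> t \<circ> h) y"
      by (rule tr_cong[OF I _ y]) (use \<sigma>(2) khom_in[OF \<pi>h] in simp)
    also have "\<dots> = \<pi> t (tr (I t) (I t) (zip ?xs ?xs) h y)"
      by (rule tr_comp_left[symmetric, OF I I W' khom_subset[OF \<pi>d D] h(1) _ _ y]) simp_all
    finally show ?thesis using h(2)[OF y] by simp
  qed
  \<comment> \<open>The restriction of \<open>F\<close> to \<open>W t\<close> is a homomorphism to k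
    along which \<open>M\<close> is the pushout of the sequence defining
    \<open>W (t + 1)\<close>.\<close>
  have F\<iota>: "\<exists>c. F (\<iota> t w) = i c" if w: "w \<in> Carrier (W t)" for w
  proof -
    have "\<pi> t (\<iota> t w) = 0" using ker w by auto
    then have "F (\<iota> t w) \<in> {x \<in> Carrier M. q x = 0}"
      using qF khom_in[OF \<iota>d w] khom_in[OF Fk] by simp
    then show ?thesis using kerq by auto
  qed
  have ideal_0: "F (\<iota> t w) = 0" if "w \<in> ideal_act (set ?xs) (W t)" for w
  proof -
    interpret module "act (W t)" using W by (rule kE_mod_module)
    have "w \<in> Carrier (W t) \<and> F (\<iota> t w) = 0" using that unfolding ideal_act_def
    proof (induction rule: span_induct_alt)
      case base
      then show ?case using kE_mod_0[OF W] khom_zero[OF \<iota>d W] khom_zero[OF Fk I] by simp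
    next
      case (step c x y)
      then obtain u v where u: "x = act (W t) u v" "u \<in> set ?xs" "v \<in> Carrier (W t)" by auto
      note m = u(3) kE_mod_act[OF W u(3), of u] kE_mod_act[OF W kE_mod_act[OF W u(3), of u], of c]
      note m' = m[THEN khom_in[OF \<iota>d]]
      obtain b where b: "F (\<iota> t v) = i b" using F\<iota>[OF u(3)] by blast
      have "F (\<iota> t (act (W t) c x)) = act M c (act M u (i b))"
        unfolding u(1) using m m' b
        by (simp add: khom_act[OF \<iota>d IdI] khom_act[OF Fk IdI] del: scale_scale)
      also have "\<dots> = 0" using V_i u(2) xsV by (auto simp: act_zero_right[OF M])
      finally have "F (\<iota> t (act (W t) c x)) = 0" .
      moreover have "y \<in> Carrier (W t)" "F (\<iota> t y) = 0" using step(2) by simp_all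
      moreover have cx: "act (W t) c x \<in> Carrier (W t)" using u(1) m(3) by simp
      ultimately show ?case
        using kE_mod_add[OF W cx] khom_add[OF \<iota>d cx] khom_add[OF Fk] khom_in[OF \<iota>d] by simp
    qed
    then show ?thesis by simp
  qed
  \<comment> \<open>\<open>M\<close> is the sum of the image of \<open>F\<close> and the line
    \<open>i(k)\<close>. The line is annihilated by U, so U M is the image of U
    \<open>I t\<close>.\<close>
  have lift: "\<exists>y\<in>ideal_act (set us) (I t). F y = m" if "m \<in> ideal_act (set us) M" for m
  proof -
    interpret module "act M" using M by (rule kE_mod_module)
    from that show ?thesis unfolding ideal_act_def[of _ M]
    proof (induction rule: span_induct_alt)
      case base
      then show ?case using ideal_act_0[OF I] khom_zero[OF Fk I] by blast
    next
      case (step c x m')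
      then obtain u m where u: "x = act M u m" "u \<in> set us" "m \<in> Carrier M" by auto
      obtain y' where y': "y' \<in> ideal_act (set us) (I t)" "F y' = m'" using step(2) by blast
      obtain y where y: "y \<in> Carrier (I t)" "\<pi> t y = q m"
        using khom_in[OF qk u(3)] \<pi>(2) by (metis imageE)
      have "q (m - F y) = 0" using khom_diff[OF qk M u(3) khom_in[OF Fk y(1)]] qF[OF y(1)] y(2) by simp
      then obtain b where "m - F y = i b"
        using kerq kE_mod_diff[OF M u(3) khom_in[OF Fk y(1)]] by blast
      then have "m = F y + i b" by (simp add: algebra_simps)
      then have "x = act M u (F y)" using u(1,2) V_i[of u b] xsV by (auto simp: act_add_right[OF M])
      then have "x = F (act (I t) u y)" using khom_act[OF Fk IdI y(1)] by simp
      then have "act M c x = F (act (I t) c (act (I t) u y))"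
        using khom_act[OF Fk IdI kE_mod_act[OF I y(1)]] by simp
      moreover have yy: "act (I t) c (act (I t) u y) \<in> ideal_act (set us) (I t)"
        using u(2) y(1) by (intro ideal_act_scale[OF I] ideal_act_base[OF I])
      ultimately have "F (act (I t) c (act (I t) u y) + y') = act M c x + m'"
        using khom_add[OF Fk] y' ideal_act_carrier[OF I] by (metis subsetD)
      then show ?case using ideal_act_add[OF I yy y'(1)] by blast
    qed
  qed
  obtain y where y: "y \<in> ideal_act (set us) (I t)" "F y = i 1" using lift[OF i1] by blast
  have yI: "y \<in> Carrier (I t)" using y(1) ideal_act_carrier[OF I] by blast
  have "i 1 \<in> {x \<in> Carrier M. q x = 0}" using kerq cT by auto
  then have "\<pi> t y = 0" using qF[OF yI] y(2) by simp
  then obtain w where w: "w \<in> Carrier (W t)" "y = \<iota> t w" using ker yI by blast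
  let ?N = "\<Prod>u\<leftarrow>us. u ^ (CHAR('k) - 1)"
  have "act (I t) ?N y = 0"
  proof -
    interpret module "act (I t)" using I by (rule kE_mod_module)
    from y(1) show ?thesis unfolding ideal_act_def
    proof (induction rule: span_induct_alt)
      case base
      then show ?case by (rule act_zero_right[OF I])
    next
      case (step c x y)
      then obtain u v where u: "x = act (I t) u v" "u \<in> set us" by auto
      have "act (I t) ?N (act (I t) c x) = act (I t) (c * (u * ?N)) v"
        by (simp add: u(1) act_act[OF I] ac_simps)
      also have "\<dots> = 0" using norm_mult_zero[of us u] u(2) xsV by (simp add: act_zero[OF I])
      finally show ?case using step(2) by (simp add: act_add_right[OF I])
    qed
  qed
  then have "\<iota> t (act (W t) ?N w) = \<iota> t 0"
    using khom_act[OF \<iota>d IdI w(1)] w(2) khom_zero[OF \<iota>d W] by simp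
  then have Nw: "act (W t) ?N w = 0"
    using \<iota>(2) kE_mod_act[OF W w(1)] kE_mod_0[OF W] by (auto dest: inj_onD)
  \<comment> \<open>Here \<open>t > 0\<close> enters. In degree 0 the norm of a nonempty
    \<open>us\<close> annihilates the trivial module \<open>W 0\<close>, whose radical is 0.\<close>
  obtain s where s: "t = Suc s" using t gr0_implies_Suc by blast
  have "w \<in> ideal_act (set ?xs) (W t)"
    using norm_kernel_Omega_inv[OF om basis vs, of s w] w(1) Nw s by simp
  then have "i 1 = i 0" using ideal_0 w(2) y(2) khom_zero[OF ik k] by simp
  then have "(1 :: 'k) = 0" by (rule inj_onD[OF i(2)]) (simp_all add: cT)
  then show False by simp
qed

text \<open>The identity of k is semilinear for any pairing of bases of V, and relative injectivity
  lifts it step by step. The kernel of the extension to \<open>I s\<close> is a submodule that meets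
  the image of \<open>W s\<close> in 0, so essentiality of the hull makes the extension
  injective.\<close>

lemma twisted_maps:
  fixes W :: "nat \<Rightarrow> ('e, 'k, 'w::ab_group_add) kE_module" and I :: "nat \<Rightarrow> ('e, 'k, 'i::ab_group_add) kE_module"
  assumes om: "iterated_Omega_inv T trivial_module W I \<theta> \<iota> \<pi>" and T: "T > 0"
    and xs: "kbasis V xs" and ys: "kbasis V ys" and s: "s \<le> T"
  shows "\<exists>\<phi>. khom (W s) (W s) (set (zip xs ys)) \<phi> \<and> inj_on \<phi> (Carrier (W s))"
  using s
proof (induction s)
  case 0
  have iso: "kE_iso trivial_module (W 0) \<theta>" and "short_exact (W 0) (I 0) (W (Suc 0)) (\<iota> 0) (\<pi> 0)"
    using om T unfolding iterated_Omega_inv_def by auto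
  then have W0: "kE_mod (W 0)" unfolding short_exact_def by (auto intro: fd_module_kE_mod)
  have triv: "act (W 0) v w = 0" if v: "v \<in> V" and w: "w \<in> Carrier (W 0)" for v w
    using Omega_inv_0_trivial[OF iso v w] .
  have "a \<in> V \<and> b \<in> V" if "(a, b) \<in> set (zip xs ys)" for a b
    using set_zip_leftD[OF that] set_zip_rightD[OF that] kbasis_subset[OF xs] kbasis_subset[OF ys] by blast
  then have "khom (W 0) (W 0) (set (zip xs ys)) (\<lambda>w. w)"
    by (intro khomI) (use triv in auto)
  then show ?case by (intro exI[of _ "\<lambda>w. w"]) simp
next
  case (Suc s)
  then have sT: "s < T" by simp
  let ?Z = "set (zip xs ys)"
  have len: "length xs = length ys" using length_kbasis[OF xs] length_kbasis[OF ys] by simp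
  obtain \<phi> where \<phi>: "khom (W s) (W s) ?Z \<phi>" "inj_on \<phi> (Carrier (W s))"
    using Suc by auto
  have st: "injective_hull (W s) (I s) (\<iota> s)" "short_exact (W s) (I s) (W (Suc s)) (\<iota> s) (\<pi> s)"
    using om sT unfolding iterated_Omega_inv_def by auto
  have fdW: "fd_module (W s)" using st unfolding short_exact_def by auto
  have W: "kE_mod (W s)" and I: "kE_mod (I s)" and W': "kE_mod (W (Suc s))"
    using st unfolding short_exact_def by (auto intro: fd_module_kE_mod)
  have \<iota>: "kE_hom (W s) (I s) (\<iota> s)" "inj_on (\<iota> s) (Carrier (W s))"
    and \<pi>: "kE_hom (I s) (W (Suc s)) (\<pi> s)" "\<pi> s ` Carrier (I s) = Carrier (W (Suc s))"
    and ker: "{x \<in> Carrier (I s). \<pi> s x = 0} = \<iota> s ` Carrier (W s)"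
    using st unfolding short_exact_def by auto
  have \<iota>d: "khom (W s) (I s) Id (\<iota> s)" and \<pi>d: "khom (I s) (W (Suc s)) Id (\<pi> s)"
    using kE_hom_khom[OF \<iota>(1)] kE_hom_khom[OF \<pi>(1)] by auto
  have hig: "higman (I s) ys"
    using injective_higman[OF _ ys] st(1) by (auto simp: injective_hull_def)
  have \<iota>\<phi>: "khom (W s) (I s) ?Z (\<iota> s \<circ> \<phi>)" using \<phi>(1) \<iota>d by (rule khom_compose) auto
  obtain \<Phi> where \<Phi>: "khom (I s) (I s) ?Z \<Phi>" "\<And>w. w \<in> Carrier (W s) \<Longrightarrow> \<Phi> (\<iota> s w) = (\<iota> s \<circ> \<phi>) w"
    by (rule higman_extend[OF W I I hig len kbasis_power_p[OF xs] kbasis_power_p[OF ys] \<iota> \<iota>\<phi>]) auto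
  let ?K = "{v \<in> Carrier (I s). \<Phi> v = 0}"
  \<comment> \<open>Semilinearity is known only on the basis, and no automorphism of kE is
    constructed. Stability of the kernel spreads from the basis to kE by induction over algebra
    generators.\<close>
  have K_act: "act (I s) a v \<in> ?K" if v: "v \<in> ?K" for a v
  proof -
    have "\<forall>v\<in>?K. act (I s) a v \<in> ?K" using xs
    proof (induction a rule: group_algebra_induct)
      case (scalar c)
      then show ?case using khom_scalar[OF \<Phi>(1)] kE_mod_act[OF I] by (simp add: act_zero_right[OF I])
    next
      case (add a b)
      then show ?case using khom_add[OF \<Phi>(1)] kE_mod_add[OF I] by (simp add: act_add_left[OF I])
    next
      case (mult a b)
      then show ?case by (simp add: act_act[OF I, symmetric])
    next
      case (basis x)
      then obtain y where "(x, y) \<in> ?Z" using len by (metis in_set_impl_in_set_zip1)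
      then show ?case using khom_act[OF \<Phi>(1)] kE_mod_act[OF I] by (simp add: act_zero_right[OF I])
    qed
    then show ?thesis using v by blast
  qed
  interpret Im: module "act (I s)" using I by (rule kE_mod_module)
  have subK: "Im.subspace ?K"
    by (rule Im.subspaceI)
      (use K_act kE_mod_0[OF I] kE_mod_add[OF I] khom_zero[OF \<Phi>(1) I] khom_add[OF \<Phi>(1)] in auto)
  have "v = 0" if v: "v \<in> ?K" "v \<in> \<iota> s ` Carrier (W s)" for v
  proof -
    obtain w where w: "w \<in> Carrier (W s)" "v = \<iota> s w" using v(2) by auto
    then have "\<iota> s (\<phi> w) = \<iota> s 0" using v(1) \<Phi>(2) khom_zero[OF \<iota>d W] by simp
    then have "\<phi> w = \<phi> 0"
      using \<iota>(2) khom_in[OF \<phi>(1) w(1)] kE_mod_0[OF W] khom_zero[OF \<phi>(1) W] by (auto dest: inj_onD)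
    then have "w = 0" using \<phi>(2) w(1) kE_mod_0[OF W] by (auto dest: inj_onD)
    then show ?thesis using w(2) khom_zero[OF \<iota>d W] by simp
  qed
  moreover have "0 \<in> ?K" "0 \<in> \<iota> s ` Carrier (W s)"
    using Im.subspace_0[OF subK] khom_zero[OF \<iota>d W] kE_mod_0[OF W] by (auto simp: image_iff intro!: bexI[of _ 0])
  ultimately have "?K \<inter> \<iota> s ` Carrier (W s) = {0}" by blast
  moreover have "S \<inter> \<iota> s ` Carrier (W s) \<noteq> {0}" if "Im.subspace S" "S \<subseteq> Carrier (I s)" "S \<noteq> {0}" for S
    using st(1) that unfolding injective_hull_def by blast
  ultimately have K: "?K = {0}" using subK by blast
  have \<Phi>_inj: "x = y" if "x \<in> Carrier (I s)" "y \<in> Carrier (I s)" "\<Phi> x = \<Phi> y" for x y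
  proof -
    have "x - y \<in> ?K" using that khom_diff[OF \<Phi>(1) I that(1,2)] kE_mod_diff[OF I that(1,2)] by simp
    then have "x - y \<in> {0}" by (simp only: K)
    then show ?thesis by simp
  qed
  \<comment> \<open>Injectivity on the quotient needs surjectivity on the submodule: what
    \<open>\<Phi>\<close> maps into the image of \<open>W s\<close> must already come from
    \<open>W s\<close>.\<close>
  have surj: "\<phi> ` Carrier (W s) = Carrier (W s)" by (rule fd_inj_imp_surj[OF fdW \<phi>])
  have \<pi>\<Phi>: "khom (I s) (W (Suc s)) ?Z (\<pi> s \<circ> \<Phi>)" using \<Phi>(1) \<pi>d by (rule khom_compose) auto
  have \<pi>\<iota>: "\<pi> s (\<iota> s w) = 0" if "w \<in> Carrier (W s)" for w using ker that by auto
  obtain \<phi>' where \<phi>': "khom (W (Suc s)) (W (Suc s)) ?Z \<phi>'" "\<And>y. y \<in> Carrier (I s) \<Longrightarrow> \<phi>' (\<pi> s y) = (\<pi> s \<circ> \<Phi>) y"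
  proof (rule khom_factor[OF I \<pi>\<Phi> \<pi>d \<pi>(2)])
    fix y assume "y \<in> Carrier (I s)" "\<pi> s y = 0"
    then obtain w where "w \<in> Carrier (W s)" "y = \<iota> s w" using ker by auto
    then show "(\<pi> s \<circ> \<Phi>) y = 0" using \<Phi>(2) \<pi>\<iota> khom_in[OF \<phi>(1)] by simp
  qed auto
  have "inj_on \<phi>' (Carrier (W (Suc s)))"
  proof (rule inj_onI)
    fix a b assume ab: "a \<in> Carrier (W (Suc s))" "b \<in> Carrier (W (Suc s))" "\<phi>' a = \<phi>' b"
    obtain x y where x: "x \<in> Carrier (I s)" "a = \<pi> s x" and y: "y \<in> Carrier (I s)" "b = \<pi> s y"
      using ab \<pi>(2) by blast
    have "\<pi> s (\<Phi> (x - y)) = 0"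
      using ab(3) \<phi>'(2)[OF x(1)] \<phi>'(2)[OF y(1)] x(2) y(2) khom_diff[OF \<pi>\<Phi> I x(1) y(1)] by simp
    moreover have xy: "x - y \<in> Carrier (I s)" by (rule kE_mod_diff[OF I x(1) y(1)])
    ultimately obtain w' where "w' \<in> Carrier (W s)" "\<Phi> (x - y) = \<iota> s w'"
      using ker khom_in[OF \<Phi>(1)] by blast
    then obtain w where w: "w \<in> Carrier (W s)" "\<Phi> (x - y) = \<iota> s (\<phi> w)" using surj by (metis imageE)
    then have "x - y = \<iota> s w" using \<Phi>_inj[OF xy khom_in[OF \<iota>d w(1)]] \<Phi>(2) by simp
    then have "\<pi> s (x - y) = 0" using \<pi>\<iota> w(1) by simp
    then show "a = b" using khom_diff[OF \<pi>d I x(1) y(1)] x(2) y(2) by simp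
  qed
  then show ?case using \<phi>'(1) by blast
qed

end

section \<open>Radicals and socles\<close>

text \<open>Semilinearity along paired lists extends to linear combinations with the same
  coefficients. Radicals need the correspondence from left to right, socles from right to
  left.\<close>

lemma khom_span:
  assumes f: "khom M N (set (zip us us')) f" and M: "kE_mod M" and N: "kE_mod N"
    and len: "length us = length us'"
  shows "u \<in> group_algebra.span (set us) \<Longrightarrow>
      \<exists>u'\<in>group_algebra.span (set us'). \<forall>w\<in>Carrier M. f (act M u w) = act N u' (f w)"
    and "u' \<in> group_algebra.span (set us') \<Longrightarrow>
      \<exists>u\<in>group_algebra.span (set us). \<forall>w\<in>Carrier M. f (act M u w) = act N u' (f w)"
proof -
  let ?P = "\<lambda>u u'. \<forall>w\<in>Carrier M. f (act M u w) = act N u' (f w)"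
  have P0: "?P 0 0" using khom_zero[OF f M] by (simp add: act_zero[OF M] act_zero[OF N])
  have Pstep: "?P (kscale (*) c x + y) (kscale (*) c x' + y')" if "?P x x'" "?P y y'" for c x y x' y'
    using that khom_add[OF f] khom_scalar[OF f] kE_mod_act[OF M]
    by (simp add: kscale_def act_add_left[OF M] act_add_left[OF N] act_act[OF M, symmetric] act_act[OF N, symmetric])
  have Pz: "?P x x'" if "(x, x') \<in> set (zip us us')" for x x' using khom_act[OF f that] by blast
  note sp = group_algebra.span_add group_algebra.span_scale group_algebra.span_base
  show "\<exists>u'\<in>group_algebra.span (set us'). ?P u u'" if "u \<in> group_algebra.span (set us)"
    using that
  proof (induction rule: group_algebra.span_induct_alt)
    case base
    then show ?case using P0 group_algebra.span_zero by blast
  next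
    case (step c x y)
    obtain x' where x': "(x, x') \<in> set (zip us us')" using step(1) len by (metis in_set_impl_in_set_zip1)
    obtain y' where y': "y' \<in> group_algebra.span (set us')" "?P y y'" using step(2) by blast
    have "kscale (*) c x' + y' \<in> group_algebra.span (set us')"
      by (rule sp(1)[OF sp(2)[OF sp(3)[OF set_zip_rightD[OF x']]] y'(1)])
    then show ?case using Pstep[OF Pz[OF x'] y'(2)] by blast
  qed
  show "\<exists>u\<in>group_algebra.span (set us). ?P u u'" if "u' \<in> group_algebra.span (set us')"
    using that
  proof (induction rule: group_algebra.span_induct_alt)
    case base
    then show ?case using P0 group_algebra.span_zero by blast
  next
    case (step c x' y')
    obtain x where x: "(x, x') \<in> set (zip us us')" using step(1) len by (metis in_set_impl_in_set_zip2)
    obtain y where y: "y \<in> group_algebra.span (set us)" "?P y y'" using step(2) by blast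
    have "kscale (*) c x + y \<in> group_algebra.span (set us)"
      by (rule sp(1)[OF sp(2)[OF sp(3)[OF set_zip_leftD[OF x]]] y(1)])
    then show ?case using Pstep[OF Pz[OF x] y(2)] by blast
  qed
qed

lemma khom_image_span:
  assumes M: "kE_mod M" and N: "kE_mod N" and f: "khom M N Z f" and S: "S \<subseteq> Carrier M"
  shows "f ` module.span (kscale (act M)) S = module.span (kscale (act N)) (f ` S)"
proof -
  interpret vector_space_pair "kscale (act M)" "kscale (act N)"
    using M N by (simp add: vector_space_pair_def kE_mod_vector_space)
  obtain g where g: "Vector_Spaces.linear (kscale (act M)) (kscale (act N)) g"
    "\<And>s. s \<in> Carrier M \<Longrightarrow> g s = f s"
    using khom_linear_extend[OF M N f] by blast
  interpret g: Vector_Spaces.linear "kscale (act M)" "kscale (act N)" g by (rule g)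
  have "vs1.span S \<subseteq> Carrier M" using S kE_mod_kspace[OF M] by (rule vs1.span_minimal)
  then have "f ` vs1.span S = g ` vs1.span S" using g(2) by (intro image_cong) auto
  also have "\<dots> = vs2.span (g ` S)" by (rule g.span_image[symmetric])
  also have "g ` S = f ` S" using g(2) S by (intro image_cong) auto
  finally show ?thesis .
qed

lemma
  assumes M: "kE_mod M"
  shows Rad_along_subspace: "module.subspace (kscale (act M)) (Rad_along M U j)"
    and Rad_along_carrier: "Rad_along M U j \<subseteq> Carrier M"
    and Soc_along_subspace: "module.subspace (kscale (act M)) (Soc_along M U j)"
    and Soc_along_carrier: "Soc_along M U j \<subseteq> Carrier M"
proof -
  interpret vector_space "kscale (act M)" using M by (rule kE_mod_vector_space)
  show "subspace (Rad_along M U j)" by (simp add: Rad_along_def)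
  show "Rad_along M U j \<subseteq> Carrier M"
    unfolding Rad_along_def
    by (rule span_minimal[OF _ kE_mod_kspace[OF M]]) (auto simp: kE_mod_act[OF M])
  show "subspace (Soc_along M U j)"
    by (rule subspaceI)
      (auto simp: Soc_along_def kscale_def kE_mod_0[OF M] kE_mod_add[OF M] kE_mod_act[OF M]
        act_zero_right[OF M] act_add_right[OF M] act_commute[OF M, of _ "Poly_Mapping.single 0 _"])
  show "Soc_along M U j \<subseteq> Carrier M" by (auto simp: Soc_along_def)
qed

text \<open>An injective semilinear map carries the radical and the socle along \<open>U\<close>
  into those along \<open>U'\<close>. Inequalities suffice, since the roles of the planes can be
  exchanged.\<close>

lemma
  assumes W: "fd_module W" and f: "khom W W Z f" "inj_on f (Carrier W)"
    and to: "\<And>u. u \<in> U \<Longrightarrow> \<exists>u'\<in>U'. \<forall>w\<in>Carrier W. f (act W u w) = act W u' (f w)"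
    and from': "\<And>u'. u' \<in> U' \<Longrightarrow> \<exists>u\<in>U. \<forall>w\<in>Carrier W. f (act W u w) = act W u' (f w)"
  shows dim_Rad_along_le: "vector_space.dim (kscale (act W)) (Rad_along W U j)
      \<le> vector_space.dim (kscale (act W)) (Rad_along W U' j)"
    and dim_Soc_along_le: "vector_space.dim (kscale (act W)) (Soc_along W U j)
      \<le> vector_space.dim (kscale (act W)) (Soc_along W U' j)"
proof -
  note W' = fd_module_kE_mod[OF W]
  interpret vector_space "kscale (act W)" using W' by (rule kE_mod_vector_space)
  let ?P = "\<lambda>a a'. \<forall>w\<in>Carrier W. f (act W a w) = act W a' (f w)"
  have P1: "?P 1 1" by (simp add: act_one[OF W'])
  have Pmult: "?P (a * b) (a' * b')" if "?P a a'" "?P b b'" for a b a' b'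
    using that kE_mod_act[OF W'] by (simp add: act_act[OF W', symmetric])
  have to_list: "\<exists>l'. set l' \<subseteq> U' \<and> length l' = length l \<and> ?P (prod_list l) (prod_list l')"
    if "set l \<subseteq> U" for l
    using that
  proof (induction l)
    case Nil
    then show ?case using P1 by (intro exI[of _ "[]"]) simp
  next
    case (Cons u l)
    then obtain l' u' where "set l' \<subseteq> U'" "length l' = length l" "?P (prod_list l) (prod_list l')"
      "u' \<in> U'" "?P u u'" using to by (metis insert_subset list.simps(15))
    then show ?case using Pmult by (intro exI[of _ "u' # l'"]) simp
  qed
  have from_list: "\<exists>l. set l \<subseteq> U \<and> length l = length l' \<and> ?P (prod_list l) (prod_list l')"
    if "set l' \<subseteq> U'" for l'
    using that
  proof (induction l')
    case Nil
    then show ?case using P1 by (intro exI[of _ "[]"]) simp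
  next
    case (Cons u' l')
    then obtain l u where "set l \<subseteq> U" "length l = length l'" "?P (prod_list l) (prod_list l')"
      "u \<in> U" "?P u u'" using from' by (metis insert_subset list.simps(15))
    then show ?case using Pmult by (intro exI[of _ "u # l"]) simp
  qed
  have mono: "dim S \<le> dim T" if S: "subspace S" "S \<subseteq> Carrier W" and T: "T \<subseteq> Carrier W" "f ` S \<subseteq> T" for S T
  proof -
    have "dim S = dim (f ` S)"
      using dim_image_khom[OF W' W' f(1) S(2,1)] f(2) S(2) inj_on_subset by metis
    also have "\<dots> \<le> dim T" using fd_dim_mono[OF W T(2,1)] .
    finally show ?thesis .
  qed
  show "dim (Rad_along W U j) \<le> dim (Rad_along W U' j)"
  proof (rule mono[OF Rad_along_subspace[OF W'] Rad_along_carrier[OF W'] Rad_along_carrier[OF W']])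
    let ?S = "\<lambda>U. {act W (prod_list us) m |us m. set us \<subseteq> U \<and> length us = j \<and> m \<in> Carrier W}"
    have sub: "?S U \<subseteq> Carrier W" by (auto simp: kE_mod_act[OF W'])
    have "f ` ?S U \<subseteq> ?S U'"
    proof
      fix x assume "x \<in> f ` ?S U"
      then obtain l m where l: "x = f (act W (prod_list l) m)" "set l \<subseteq> U" "length l = j" "m \<in> Carrier W" by auto
      obtain l' where l': "set l' \<subseteq> U'" "length l' = length l" "?P (prod_list l) (prod_list l')"
        using to_list[OF l(2)] by blast
      have "x = act W (prod_list l') (f m)" using l l' by simp
      then show "x \<in> ?S U'" using l l' khom_in[OF f(1)] by blast
    qed
    then have "span (f ` ?S U) \<subseteq> span (?S U')" by (rule span_mono)
    then show "f ` Rad_along W U j \<subseteq> Rad_along W U' j"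
      unfolding Rad_along_def khom_image_span[OF W' W' f(1) sub] .
  qed
  show "dim (Soc_along W U j) \<le> dim (Soc_along W U' j)"
  proof (rule mono[OF Soc_along_subspace[OF W'] Soc_along_carrier[OF W'] Soc_along_carrier[OF W']])
    show "f ` Soc_along W U j \<subseteq> Soc_along W U' j"
    proof
      fix x assume "x \<in> f ` Soc_along W U j"
      then obtain w where w: "x = f w" "w \<in> Carrier W"
        "\<And>l. set l \<subseteq> U \<Longrightarrow> length l = j \<Longrightarrow> act W (prod_list l) w = 0"
        unfolding Soc_along_def by blast
      have "act W (prod_list l') x = 0" if l': "set l' \<subseteq> U'" "length l' = j" for l'
      proof -
        obtain l where l: "set l \<subseteq> U" "length l = length l'" "?P (prod_list l) (prod_list l')"
          using from_list[OF l'(1)] by blast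
        then have "act W (prod_list l') x = f (act W (prod_list l) w)" using w by simp
        then show ?thesis using w(3)[OF l(1)] l(2) l'(2) khom_zero[OF f(1) W'] by simp
      qed
      then show "x \<in> Soc_along W U' j" using w khom_in[OF f(1)] by (simp add: Soc_along_def)
    qed
  qed
qed

lemma ideal_act_span:
  assumes M: "kE_mod M" and x: "x \<in> group_algebra.span (set us)" and m: "m \<in> Carrier M"
  shows "act M x m \<in> ideal_act (set us) M"
  using x
proof (induction rule: group_algebra.span_induct_alt)
  case base
  then show ?case by (simp add: act_zero[OF M] ideal_act_0[OF M])
next
  case (step c x y)
  show ?case
    using ideal_act_add[OF M ideal_act_scale[OF M ideal_act_base[OF M step(1) m]] step(2)]
    by (simp add: act_add_left[OF M] kscale_def act_act[OF M])
qed

text \<open>The kernel of \<open>q\<close> is the line through \<open>i 1\<close>, which meets U M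
  in 0. So \<open>q\<close> is injective on radicals of positive degree. The socle of
  \<open>M\<close> is the full preimage of that of \<open>W\<close>: a product of j elements of U
  sends such a preimage into both U M and the kernel. The preimage has one extra dimension.\<close>

lemma
  fixes M :: "('e::{ab_group_add, finite}, 'k::field, 'm::ab_group_add) kE_module"
    and W :: "('e, 'k, 'w::ab_group_add) kE_module"
  assumes ext: "short_exact trivial_module M W i q" and j: "j \<ge> 1"
    and i1: "i 1 \<notin> ideal_act (set us) M" and U: "group_algebra.span (set us) = U"
  shows dim_Rad_extension: "vector_space.dim (kscale (act M)) (Rad_along M U j)
      = vector_space.dim (kscale (act W)) (Rad_along W U j)"
    and dim_Soc_extension: "vector_space.dim (kscale (act M)) (Soc_along M U j)
      = Suc (vector_space.dim (kscale (act W)) (Soc_along W U j))"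
proof -
  let ?T = "trivial_module :: ('e, 'k, 'k) kE_module"
  have k: "kE_mod ?T" and M: "kE_mod M" and fdW: "fd_module W"
    and i: "kE_hom ?T M i" "inj_on i (Carrier ?T)" and q: "kE_hom M W q" "q ` Carrier M = Carrier W"
    and ker: "{x \<in> Carrier M. q x = 0} = i ` Carrier ?T"
    using ext unfolding short_exact_def by (auto intro: fd_module_kE_mod)
  note W = fd_module_kE_mod[OF fdW]
  have cT: "Carrier ?T = UNIV" by (simp add: trivial_module_def)
  have ik: "khom ?T M Id i" and qk: "khom M W Id q"
    using kE_hom_khom[OF i(1)] kE_hom_khom[OF q(1)] by auto
  interpret vM: vector_space "kscale (act M)" using M by (rule kE_mod_vector_space)
  have ic: "i c = kscale (act M) c (i 1)" for c
  proof -
    have "act ?T (Poly_Mapping.single 0 c) 1 = aug (Poly_Mapping.single 0 c :: ('e, 'k) group_algebra) * 1"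
      by (simp only: trivial_module_def aug_def kE_module.simps)
    then show ?thesis using khom_scalar[OF ik, of 1 c] by (simp add: cT kscale_def)
  qed
  \<comment> \<open>Here \<open>j \<ge> 1\<close> provides a factor from U. In degree 0 the radical
    is all of \<open>M\<close> and contains the line through \<open>i 1\<close>.\<close>
  have ideal: "act M (prod_list l) m \<in> ideal_act (set us) M"
    if l: "set l \<subseteq> U" "length l = j" and m: "m \<in> Carrier M" for l m
  proof -
    obtain x l' where "l = x # l'" using l(2) j by (cases l) auto
    then show ?thesis
      using ideal_act_span[OF M, of x us "act M (prod_list l') m"] l(1) m U kE_mod_act[OF M m]
      by (simp add: act_act[OF M])
  qed
  have ker0: "x = 0" if x: "x \<in> ideal_act (set us) M" "q x = 0" for x
  proof -
    have "x \<in> {x \<in> Carrier M. q x = 0}" using x ideal_act_carrier[OF M] by blast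
    then obtain c where c: "x = i c" using ker by auto
    show ?thesis
    proof (cases "c = 0")
      case False
      have "kscale (act M) (inverse c) x = i 1" using False c ic[of c] by simp
      then show ?thesis using i1 ideal_act_scale[OF M x(1)] by (metis kscale_def)
    qed (use c khom_zero[OF ik k] in simp)
  qed
  let ?S = "{act M (prod_list us) m |us m. set us \<subseteq> U \<and> length us = j \<and> m \<in> Carrier M}"
  have sub: "?S \<subseteq> Carrier M" by (auto simp: kE_mod_act[OF M])
  have "vM.subspace (ideal_act (set us) M)"
    by (rule vM.subspaceI) (auto simp: kscale_def ideal_act_0[OF M] ideal_act_add[OF M] ideal_act_scale[OF M])
  then have Rad_ideal: "Rad_along M U j \<subseteq> ideal_act (set us) M"
    unfolding Rad_along_def using ideal by (intro vM.span_minimal) auto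
  have inj: "inj_on q (Rad_along M U j)"
  proof (rule inj_onI)
    fix x y assume xy: "x \<in> Rad_along M U j" "y \<in> Rad_along M U j" "q x = q y"
    have m: "x \<in> Carrier M" "y \<in> Carrier M" using xy Rad_along_carrier[OF M] by blast+
    have "x - y \<in> ideal_act (set us) M" using xy Rad_ideal by (intro ideal_act_diff[OF M]) auto
    moreover have "q (x - y) = 0" using khom_diff[OF qk M m] xy(3) by simp
    ultimately have "x - y = 0" by (rule ker0)
    then show "x = y" by simp
  qed
  have "q ` ?S = {act W (prod_list us) m |us m. set us \<subseteq> U \<and> length us = j \<and> m \<in> Carrier W}"
  proof (intro subset_antisym subsetI)
    fix x assume "x \<in> q ` ?S"
    then obtain l m where l: "x = q (act M (prod_list l) m)" "set l \<subseteq> U" "length l = j" "m \<in> Carrier M" by auto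
    then have "x = act W (prod_list l) (q m)" using khom_act[OF qk IdI] by simp
    then show "x \<in> {act W (prod_list us) m |us m. set us \<subseteq> U \<and> length us = j \<and> m \<in> Carrier W}"
      using l khom_in[OF qk] by blast
  next
    fix x assume "x \<in> {act W (prod_list us) m |us m. set us \<subseteq> U \<and> length us = j \<and> m \<in> Carrier W}"
    then obtain l m' where l: "x = act W (prod_list l) m'" "set l \<subseteq> U" "length l = j" "m' \<in> Carrier W" by auto
    then obtain m where m: "m \<in> Carrier M" "m' = q m" using q(2) by blast
    then have "x = q (act M (prod_list l) m)" using khom_act[OF qk IdI] l by simp
    then show "x \<in> q ` ?S" using l m by blast
  qed
  then have "q ` Rad_along M U j = Rad_along W U j"
    unfolding Rad_along_def using khom_image_span[OF M W qk sub] by simp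
  then show "vM.dim (Rad_along M U j) = vector_space.dim (kscale (act W)) (Rad_along W U j)"
    using dim_image_khom[OF M W qk Rad_along_carrier[OF M] Rad_along_subspace[OF M] inj] by simp
  have Soc: "Soc_along M U j = {x \<in> Carrier M. q x \<in> Soc_along W U j}"
  proof (intro subset_antisym subsetI)
    fix x assume x: "x \<in> Soc_along M U j"
    have "act W (prod_list l) (q x) = 0" if "set l \<subseteq> U" "length l = j" for l
    proof -
      have "act W (prod_list l) (q x) = q (act M (prod_list l) x)"
        using x khom_act[OF qk IdI] by (simp add: Soc_along_def)
      then show ?thesis using x that khom_zero[OF qk M] by (simp add: Soc_along_def)
    qed
    then show "x \<in> {x \<in> Carrier M. q x \<in> Soc_along W U j}"
      using x khom_in[OF qk] by (simp add: Soc_along_def)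
  next
    fix x assume x: "x \<in> {x \<in> Carrier M. q x \<in> Soc_along W U j}"
    have "act M (prod_list l) x = 0" if l: "set l \<subseteq> U" "length l = j" for l
    proof (rule ker0)
      show "act M (prod_list l) x \<in> ideal_act (set us) M" using ideal l x by simp
      show "q (act M (prod_list l) x) = 0"
        using x l khom_act[OF qk IdI] by (simp add: Soc_along_def)
    qed
    then show "x \<in> Soc_along M U j" using x by (simp add: Soc_along_def)
  qed
  have ker': "{x \<in> Carrier M. q x = 0} = vM.span {i 1}"
    unfolding ker cT vM.span_singleton by (rule image_cong[OF refl ic])
  have "i 1 \<noteq> 0" using i1 ideal_act_0[OF M] by metis
  then show "vM.dim (Soc_along M U j) = Suc (vector_space.dim (kscale (act W)) (Soc_along W U j))"
    unfolding Soc
    by (rule dim_vimage_khom[OF M fdW qk q(2) ker' _ Soc_along_carrier[OF W] Soc_along_subspace[OF W]])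
qed

theorem proposition3p8:
  fixes V :: "('e::{ab_group_add, finite}, 'k::alg_closed_field) group_algebra set"
    and P :: "int \<Rightarrow> ('e, 'k, 'p::ab_group_add) kE_module"
    and d :: "int \<Rightarrow> 'p \<Rightarrow> 'p" and \<epsilon> :: "'p \<Rightarrow> 'k" and \<eta> :: "'k \<Rightarrow> 'p"
    and W :: "nat \<Rightarrow> ('e, 'k, 'w::ab_group_add) kE_module"
    and I :: "nat \<Rightarrow> ('e, 'k, 'i::ab_group_add) kE_module"
    and \<theta> :: "'k \<Rightarrow> 'w" and \<iota> :: "nat \<Rightarrow> 'w \<Rightarrow> 'i" and \<pi> :: "nat \<Rightarrow> 'i \<Rightarrow> 'w"
    and M :: "('e, 'k, 'm::ab_group_add) kE_module"
    and i :: "'k \<Rightarrow> 'm" and q :: "'m \<Rightarrow> 'w"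
    and \<zeta> :: "('p \<Rightarrow> 'k) set" and n t :: nat
  assumes "CHAR('k) > 0"
    and "elementary_abelian TYPE('e) CHAR('k) n" and "n \<ge> 1"
    and "Rad_complement V"
    and "complete_resolution trivial_module P d \<epsilon> \<eta>"
    and "t > 0"
    and "\<zeta> \<in> tate_cohomology P d (- int t)" and "\<zeta> \<noteq> tate_coboundaries P d (- int t)"
    and "iterated_Omega_inv (t + 1) trivial_module W I \<theta> \<iota> \<pi>"
    and "short_exact trivial_module M (W (t + 1)) i q"
    and "extension_has_class t P d \<eta> W I \<theta> \<iota> \<pi> M i q \<zeta>"
  shows "\<forall>r. 0 < r \<and> r < n \<longrightarrow> constant_radical_type V r M \<and> constant_socle_type V r M"
proof (intro allI impI)
  fix r assume r: "0 < r \<and> r < n"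
  interpret rad_complement V n using assms(2,4) by unfold_locales
  note om = assms(9) and ext = assms(10)
  let ?W = "W (t + 1)"
  let ?dM = "vector_space.dim (kscale (act M))" and ?dW = "vector_space.dim (kscale (act ?W))"
  have fd: "fd_module M" "fd_module ?W" using ext by (auto simp: short_exact_def)
  have M_W: "?dM (Rad_along M U j) = ?dW (Rad_along ?W U j) \<and>
      ?dM (Soc_along M U j) = Suc (?dW (Soc_along ?W U j))"
    if U: "plane V r U" and j: "1 \<le> j" for U j
  proof -
    obtain us vs where us: "length us = r" "group_algebra.span (set us) = U" "kbasis V (us @ vs)"
      using U by (rule plane_basis)
    have "vs \<noteq> []" using length_kbasis[OF us(3)] us(1) r by auto
    then have "i 1 \<notin> ideal_act (set us) M"
      using extension_not_in_ideal[OF om assms(6) ext us(3)] by blast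
    then show ?thesis
      using dim_Rad_extension[OF ext j _ us(2)] dim_Soc_extension[OF ext j _ us(2)] by blast
  qed
  have W_le: "?dW (Rad_along ?W U j) \<le> ?dW (Rad_along ?W U' j) \<and>
      ?dW (Soc_along ?W U j) \<le> ?dW (Soc_along ?W U' j)"
    if U: "plane V r U" and U': "plane V r U'" for U U' j
  proof -
    obtain us vs where us: "length us = r" "group_algebra.span (set us) = U" "kbasis V (us @ vs)"
      using U by (rule plane_basis)
    obtain us' vs' where us': "length us' = r" "group_algebra.span (set us') = U'" "kbasis V (us' @ vs')"
      using U' by (rule plane_basis)
    \<comment> \<open>Bases of V that begin with bases of \<open>U\<close> and \<open>U'\<close> of
      the same length are paired, so that the twist carries \<open>U\<close> to
      \<open>U'\<close>.\<close>
    obtain \<phi> where \<phi>: "khom ?W ?W (set (zip (us @ vs) (us' @ vs'))) \<phi>" "inj_on \<phi> (Carrier ?W)"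
      using twisted_maps[OF om _ us(3) us'(3) order_refl] by auto
    have "khom ?W ?W (set (zip us us')) \<phi>"
      using \<phi>(1) by (rule khom_subset) (use us(1) us'(1) in \<open>simp add: zip_append\<close>)
    note sp = khom_span[OF this fd_module_kE_mod[OF fd(2)] fd_module_kE_mod[OF fd(2)], unfolded us(2) us'(2)]
    have len: "length us = length us'" using us(1) us'(1) by simp
    show ?thesis
      using dim_Rad_along_le[OF fd(2) \<phi> sp(1)[OF len] sp(2)[OF len]]
        dim_Soc_along_le[OF fd(2) \<phi> sp(1)[OF len] sp(2)[OF len]] by blast
  qed
  show "constant_radical_type V r M \<and> constant_socle_type V r M"
    unfolding constant_radical_type_def constant_socle_type_def
  proof (intro conjI allI impI fd(1))
    fix j U U' assume j: "1 \<le> j \<and> j \<le> (CHAR('k) - 1) * r" and U: "plane V r U \<and> plane V r U'"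
    \<comment> \<open>\<open>W_le\<close> is applied to the two planes in both orders.\<close>
    have "?dW (Rad_along ?W U j) = ?dW (Rad_along ?W U' j)" "?dW (Soc_along ?W U j) = ?dW (Soc_along ?W U' j)"
      using W_le U by (simp_all add: order_antisym)
    then show "?dM (Rad_along M U j) = ?dM (Rad_along M U' j)" "?dM (Soc_along M U j) = ?dM (Soc_along M U' j)"
      using M_W j U by simp_all
  qed
qed

end
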